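(* Let $R$ be a finite ring. Then $R$ is Frobenius if and only if for every positive integer $n$ and every left code $C\leq R^n$ it holds that $|C|\,|C^\perp|=|R^n|$.
   Context: Rings are associative with unity, not necessarily commutative. A left code of length $n$ over $R$ is a left $R$-submodule $C\le R^n$. For $x,y\in R^n$ put $xy:=\sum_{i=1}^n x_iy_i$. For $X\subseteq R^n$, $X^\perp:=\{s\in R^n\mid xs=0 \text{ for all } x\in X\}$ (a right submodule of $R^n$). Frobenius rings: Let $R$ be a semiperfect ring (e.g. a finite ring) with Jacobson radical $J(R)$, and let $e_1,\dots,e_m$ be a complete set of pairwise orthogonal primitive idempotents, ordered so that for some $k\le m$ the modules $e_1R,\dots,e_kR$ are pairwise non-isomorphic and for each $k<i\le m$ there is $j\le k$ with $e_iR\cong e_jR$ (equivalently $Re_i\cong Re_j$). For a module $M$, $\mathrm{top}(M)$ is $M$ modulo its radical, so $\mathrm{top}(e_iR)=e_iR/e_iJ(R)$, $\mathrm{top}(Re_i)=Re_i/J(R)e_i$; $\mathrm{soc}$ denotes the socle. For $i\le k$ let $V_i:=\mathrm{top}(e_iR)$, and let the multiplicity $\mu_i$ be the number of copies of $V_i$ in a decomposition of the right module $\mathrm{top}(R)=R/J(R)$ into simple modules. A permutation $\pi$ of $\{1,\dots,k\}$ is a Nakayama permutation if for all $i\le k$: $\mathrm{soc}(e_iR)\cong \mathrm{top}(e_{\pi(i)}R)$ and $\mathrm{soc}(Re_{\pi(i)})\cong\mathrm{top}(Re_i)$. A ring is quasi-Frobenius (QF) if it is (left and right) Artinian and has a Nakayama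 permutation. A ring is Frobenius if it is QF and its Nakayama permutation preserves multiplicities, i.e. $\mu_i=\mu_{\pi(i)}$ for all $i\le k$. *)

theory Defs
  imports "Jordan_Normal_Form.Matrix" "HOL-Combinatorics.Permutations"
begin

text \<open>
  Rings are types of sort \<open>{ring, monoid_mult}\<close>: associative with unity, not necessarily
  commutative. Unlike the class \<open>ring_1\<close> this does not impose \<open>0 \<noteq> 1\<close>, so the zero ring is included.

  The module notions of the libraries presuppose a commutative ring of scalars. Here left and right
  modules share one record: for a left module \<open>mod_act M r x\<close> is \<open>r x\<close>, for a right
  module it is \<open>x r\<close>. Submodules, quotients, homomorphisms etc. do not refer to the
  multiplication of the scalars and are therefore literally the same for both sides.
\<close>

record ('r, 'm) mod_struct =
  mod_carrier :: "'m set"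
  mod_zero :: "'m"
  mod_add :: "'m \<Rightarrow> 'm \<Rightarrow> 'm"
  mod_act :: "'r \<Rightarrow> 'm \<Rightarrow> 'm"

text \<open>Closure under negation is the action of \<open>-1\<close>.\<close>

definition is_submod :: "('r, 'm) mod_struct \<Rightarrow> 'm set \<Rightarrow> bool" where
  "is_submod M N \<longleftrightarrow>
     N \<subseteq> mod_carrier M \<and> mod_zero M \<in> N \<and>
     (\<forall>x\<in>N. \<forall>y\<in>N. mod_add M x y \<in> N) \<and>
     (\<forall>r. \<forall>x\<in>N. mod_act M r x \<in> N)"

definition submod_of :: "('r, 'm) mod_struct \<Rightarrow> 'm set \<Rightarrow> ('r, 'm) mod_struct" where
  "submod_of M N = M\<lparr>mod_carrier := N\<rparr>"

definition mod_coset :: "('r, 'm) mod_struct \<Rightarrow> 'm set \<Rightarrow> 'm \<Rightarrow> 'm set" where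
  "mod_coset M N x = mod_add M x ` N"

definition quot_mod :: "('r, 'm) mod_struct \<Rightarrow> 'm set \<Rightarrow> ('r, 'm set) mod_struct" where
  "quot_mod M N =
     \<lparr>mod_carrier = mod_coset M N ` mod_carrier M,
      mod_zero = N,
      mod_add = (\<lambda>X Y. {mod_add M x y | x y. x \<in> X \<and> y \<in> Y}),
      mod_act = (\<lambda>r X. \<Union>x\<in>X. mod_coset M N (mod_act M r x))\<rparr>"

definition mod_iso :: "('r, 'm) mod_struct \<Rightarrow> ('r, 'n) mod_struct \<Rightarrow> bool" where
  "mod_iso M M' \<longleftrightarrow>
     (\<exists>f. bij_betw f (mod_carrier M) (mod_carrier M') \<and>
          (\<forall>x\<in>mod_carrier M. \<forall>y\<in>mod_carrier M. f (mod_add M x y) = mod_add M' (f x) (f y)) \<and>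
          (\<forall>r. \<forall>x\<in>mod_carrier M. f (mod_act M r x) = mod_act M' r (f x)))"

definition simple_mod :: "('r, 'm) mod_struct \<Rightarrow> bool" where
  "simple_mod M \<longleftrightarrow>
     mod_carrier M \<noteq> {mod_zero M} \<and>
     (\<forall>N. is_submod M N \<longrightarrow> N = {mod_zero M} \<or> N = mod_carrier M)"

definition maximal_submod :: "('r, 'm) mod_struct \<Rightarrow> 'm set \<Rightarrow> bool" where
  "maximal_submod M N \<longleftrightarrow>
     is_submod M N \<and> N \<noteq> mod_carrier M \<and>
     (\<forall>N'. is_submod M N' \<and> N \<subseteq> N' \<longrightarrow> N' = N \<or> N' = mod_carrier M)"

definition rad_mod :: "('r, 'm) mod_struct \<Rightarrow> 'm set" where
  "rad_mod M = mod_carrier M \<inter> \<Inter>{N. maximal_submod M N}"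

definition top_mod :: "('r, 'm) mod_struct \<Rightarrow> ('r, 'm set) mod_struct" where
  "top_mod M = quot_mod M (rad_mod M)"

text \<open>The sum of all simple submodules, i.e. the least submodule containing each of them.\<close>

definition soc_mod :: "('r, 'm) mod_struct \<Rightarrow> ('r, 'm) mod_struct" where
  "soc_mod M = submod_of M
     (\<Inter>{N. is_submod M N \<and>
          (\<forall>S. is_submod M S \<and> simple_mod (submod_of M S) \<longrightarrow> S \<subseteq> N)})"

definition artinian_mod :: "('r, 'm) mod_struct \<Rightarrow> bool" where
  "artinian_mod M \<longleftrightarrow>
     (\<forall>N :: nat \<Rightarrow> 'm set. (\<forall>i. is_submod M (N i)) \<and> (\<forall>i. N (Suc i) \<subseteq> N i) \<longrightarrow>
        (\<exists>n. \<forall>i\<ge>n. N i = N n))"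

text \<open>
  \<open>M\<close> is the internal direct sum of the list \<open>Ss\<close> of simple submodules: \<open>listset Ss\<close> is the
  cartesian product of the members of \<open>Ss\<close>, and the summation map from it to \<open>M\<close> is bijective.
\<close>

definition simple_decomposition :: "('r, 'm) mod_struct \<Rightarrow> 'm set list \<Rightarrow> bool" where
  "simple_decomposition M Ss \<longleftrightarrow>
     (\<forall>S\<in>set Ss. is_submod M S \<and> simple_mod (submod_of M S)) \<and>
     bij_betw (\<lambda>xs. foldr (mod_add M) xs (mod_zero M)) (listset Ss) (mod_carrier M)"

text \<open>The number does not depend on the decomposition (Krull-Schmidt).\<close>

definition mod_multiplicity :: "('r, 'm) mod_struct \<Rightarrow> ('r, 'n) mod_struct \<Rightarrow> nat" where
  "mod_multiplicity M V =
     (THE \<mu>. \<exists>Ss. simple_decomposition M Ss \<and>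
        \<mu> = length (filter (\<lambda>S. mod_iso (submod_of M S) V) Ss))"


definition left_regular :: "('a::{ring,monoid_mult}, 'a) mod_struct" where
  "left_regular =
     \<lparr>mod_carrier = UNIV, mod_zero = 0, mod_add = (+), mod_act = (\<lambda>r x. r * x)\<rparr>"

definition right_regular :: "('a::{ring,monoid_mult}, 'a) mod_struct" where
  "right_regular =
     \<lparr>mod_carrier = UNIV, mod_zero = 0, mod_add = (+), mod_act = (\<lambda>r x. x * r)\<rparr>"

text \<open>The left module \<open>Ra\<close> and the right module \<open>aR\<close>.\<close>

definition left_principal :: "'a::{ring,monoid_mult} \<Rightarrow> ('a, 'a) mod_struct" where
  "left_principal a = submod_of left_regular {r * a | r. True}"

definition right_principal :: "'a::{ring,monoid_mult} \<Rightarrow> ('a, 'a) mod_struct" where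
  "right_principal a = submod_of right_regular {a * r | r. True}"

definition idempotent_elem :: "'a::{ring,monoid_mult} \<Rightarrow> bool" where
  "idempotent_elem e \<longleftrightarrow> e * e = e"

definition orthogonal_elems :: "'a::{ring,monoid_mult} \<Rightarrow> 'a \<Rightarrow> bool" where
  "orthogonal_elems e f \<longleftrightarrow> e * f = 0 \<and> f * e = 0"

definition primitive_idempotent :: "'a::{ring,monoid_mult} \<Rightarrow> bool" where
  "primitive_idempotent e \<longleftrightarrow>
     idempotent_elem e \<and> e \<noteq> 0 \<and>
     (\<forall>f g. idempotent_elem f \<and> idempotent_elem g \<and> orthogonal_elems f g \<and> e = f + g \<longrightarrow>
        f = 0 \<or> g = 0)"

definition complete_primitive_idempotents ::
    "nat \<Rightarrow> (nat \<Rightarrow> 'a::{ring,monoid_mult}) \<Rightarrow> bool" where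
  "complete_primitive_idempotents m e \<longleftrightarrow>
     (\<forall>i\<in>{1..m}. primitive_idempotent (e i)) \<and>
     (\<forall>i\<in>{1..m}. \<forall>j\<in>{1..m}. i \<noteq> j \<longrightarrow> orthogonal_elems (e i) (e j)) \<and>
     (\<Sum>i\<in>{1..m}. e i) = 1"

definition ordered_idempotents ::
    "nat \<Rightarrow> nat \<Rightarrow> (nat \<Rightarrow> 'a::{ring,monoid_mult}) \<Rightarrow> bool" where
  "ordered_idempotents m k e \<longleftrightarrow>
     complete_primitive_idempotents m e \<and> k \<le> m \<and>
     (\<forall>i\<in>{1..k}. \<forall>j\<in>{1..k}. i \<noteq> j \<longrightarrow>
        \<not> mod_iso (right_principal (e i)) (right_principal (e j))) \<and>
     (\<forall>i\<in>{k<..m}. \<exists>j\<in>{1..k}. mod_iso (right_principal (e i)) (right_principal (e j)))"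

definition nakayama_permutation ::
    "nat \<Rightarrow> (nat \<Rightarrow> 'a::{ring,monoid_mult}) \<Rightarrow> (nat \<Rightarrow> nat) \<Rightarrow> bool" where
  "nakayama_permutation k e \<pi> \<longleftrightarrow>
     \<pi> permutes {1..k} \<and>
     (\<forall>i\<in>{1..k}.
        mod_iso (soc_mod (right_principal (e i))) (top_mod (right_principal (e (\<pi> i)))) \<and>
        mod_iso (soc_mod (left_principal (e (\<pi> i)))) (top_mod (left_principal (e i))))"

definition idem_multiplicity :: "'a::{ring,monoid_mult} \<Rightarrow> nat" where
  "idem_multiplicity e =
     mod_multiplicity (top_mod (right_regular :: ('a, 'a) mod_struct))
       (top_mod (right_principal e))"

definition quasi_frobenius :: "'a::{ring,monoid_mult} itself \<Rightarrow> bool" where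
  "quasi_frobenius _ \<longleftrightarrow>
     artinian_mod (left_regular :: ('a, 'a) mod_struct) \<and>
     artinian_mod (right_regular :: ('a, 'a) mod_struct) \<and>
     (\<exists>m k (e :: nat \<Rightarrow> 'a) \<pi>. ordered_idempotents m k e \<and> nakayama_permutation k e \<pi>)"

text \<open>
  The idempotents are unique up to conjugation and order and the Nakayama permutation is determined
  by them, so it is immaterial that they are existentially quantified.
\<close>

definition frobenius :: "'a::{ring,monoid_mult} itself \<Rightarrow> bool" where
  "frobenius T \<longleftrightarrow>
     quasi_frobenius T \<and>
     (\<exists>m k (e :: nat \<Rightarrow> 'a) \<pi>. ordered_idempotents m k e \<and> nakayama_permutation k e \<pi> \<and>
        (\<forall>i\<in>{1..k}. idem_multiplicity (e i) = idem_multiplicity (e (\<pi> i))))"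


definition left_vec_mod :: "nat \<Rightarrow> ('a::{ring,monoid_mult}, 'a vec) mod_struct" where
  "left_vec_mod n =
     \<lparr>mod_carrier = carrier_vec n, mod_zero = 0\<^sub>v n, mod_add = (+),
      mod_act = (\<lambda>r x. r \<cdot>\<^sub>v x)\<rparr>"

definition left_code :: "nat \<Rightarrow> 'a::{ring,monoid_mult} vec set \<Rightarrow> bool" where
  "left_code n C \<longleftrightarrow> is_submod (left_vec_mod n) C"

definition right_annihilator :: "nat \<Rightarrow> 'a::{ring,monoid_mult} vec set \<Rightarrow> 'a vec set" where
  "right_annihilator n X = {s \<in> carrier_vec n. \<forall>x\<in>X. x \<bullet> s = 0}"

end

theory Submission
  imports Defs
begin

text \<open>
  Write \<open>J\<close> for the radical and, for a left code \<open>C\<close>, let \<open>x\<close> generate a minimal extension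
  \<open>C' = C + R x\<close>. Then \<open>A = {r. r x \<in> C}\<close> is a maximal left ideal with \<open>|C'/C| = |R/A|\<close>, and
  \<open>s \<mapsto> x s\<close> embeds \<open>C\<^sup>\<bottom> / C'\<^sup>\<bottom>\<close> into the right annihilator of \<open>A\<close>. If this annihilator never has more than
  \<open>|R/A|\<close> elements, then \<open>|C| |C\<^sup>\<bottom>|\<close> is monotone in \<open>C\<close>; as it equals \<open>|R\<^sup>n|\<close> for \<open>C = 0\<close> and for
  \<open>C = R\<^sup>n\<close>, it is constant. No injectivity of \<open>R\<close> is needed. The bound on the annihilators amounts
  to \<open>|e\<^sub>i S| = |top (R e\<^sub>i)|\<close> where \<open>S\<close> is the socle; both sides are powers
  \<open>q\<^sub>i ^ \<mu>\<^sub>i\<close> with \<open>q\<^sub>i = |e\<^sub>i R e\<^sub>i / e\<^sub>i J e\<^sub>i|\<close>, because a Nakayama permutation makes \<open>e\<^sub>i S\<close> isomorphic to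
  \<open>top (e\<^sub>j R)\<close>, \<open>j = \<pi> i\<close>, and forces \<open>q\<^sub>i = q\<^sub>j\<close> by counting \<open>e\<^sub>i S e\<^sub>j\<close> from both sides.

  Conversely, codes of length one and codes generated by a single word give \<open>|I| |r(I)| = |R|\<close> for left
  ideals and \<open>|K| |l(K)| = |R|\<close> for right ideals. Hence the left and right socles agree, every \<open>e\<^sub>i S\<close>
  and every \<open>S e\<^sub>j\<close> is simple, and \<open>e\<^sub>i S e\<^sub>j \<noteq> 0\<close> defines the Nakayama permutation.
\<close>

section \<open>Counting\<close>

text \<open>The definitions speak of isomorphic tops and socles and of a multiplicity given by a
  definite description, while the code identity sees only cardinalities. The bridge is to replace
  homomorphisms by ring elements: a map out of \<open>e R\<close> is left multiplication by the
  image of \<open>e\<close>. An isomorphism of two principal modules thus becomes a pair of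
  elements, and an isomorphism from a top to a socle becomes one generator \<open>z\<close>. The
  engine behind this is that, for a primitive \<open>e\<close>, every element of \<open>e R\<close>
  outside \<open>J\<close> generates \<open>e R\<close>.

  The multiplicity is recovered as an exponent: multiplying a decomposition of \<open>R/J\<close> by
  \<open>f\<close> on the right keeps \<open>q\<close> elements of each summand isomorphic to the
  top of \<open>f R\<close> and only zero of the others, so \<open>|(R/J) f| = q ^ \<mu>\<close>.
  This counts \<open>R f\<close>, whereas socle generators count \<open>f R\<close>; a Peirce
  decomposition shows that the two tops have the same size.\<close>

lemma card_fibers:
  assumes "finite X" "\<And>x. x \<in> X \<Longrightarrow> card {y \<in> X. f y = f x} = c"
  shows "card X = card (f ` X) * c"
proof -
  have "card X = (\<Sum>x\<in>X. 1)" by simp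
  also have "\<dots> = (\<Sum>b\<in>f ` X. card {x \<in> X. f x = b})"
    using sum.group[OF assms(1) finite_imageI[OF assms(1)], of f f "\<lambda>_. 1::nat"] by simp
  also have "\<dots> = (\<Sum>b\<in>f ` X. c)"
    by (rule sum.cong) (use assms(2) in auto)
  finally show ?thesis by simp
qed

text \<open>The map \<open>f\<close> need not be a homomorphism; all that matters is that its fibres
  in \<open>X\<close> are the cosets of \<open>K\<close>. So it may take values in sets of cosets or
  in the carrier of an abstract module.\<close>

lemma card_subgroup_fibers:
  fixes X :: "'a::{ab_group_add,finite} set"
  assumes "\<And>x y. x \<in> X \<Longrightarrow> y \<in> X \<Longrightarrow> x + y \<in> X"
    and "\<And>x y. x \<in> X \<Longrightarrow> y \<in> X \<Longrightarrow> f x = f y \<longleftrightarrow> x - y \<in> K"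
    and "K \<subseteq> X"
  shows "card X = card (f ` X) * card K"
proof (rule card_fibers)
  fix x assume x: "x \<in> X"
  have "bij_betw (\<lambda>k. k + x) K {y \<in> X. f y = f x}"
    using assms x by (intro bij_betw_byWitness[where f' = "\<lambda>y. y - x"]) (auto simp: subset_iff)
  then show "card {y \<in> X. f y = f x} = card K"
    by (simp add: bij_betw_same_card)
qed simp

lemma card_Collect_pos: "P x \<Longrightarrow> card {x :: 'a :: finite. P x} > 0"
  by (auto simp: card_gt_0_iff)

lemma mult_right_cancel_nat: "(a::nat) * k = b * k \<Longrightarrow> k > 0 \<Longrightarrow> a = b"
  by simp

lemma card_listset:
  "(\<And>A. A \<in> set As \<Longrightarrow> finite A) \<Longrightarrow> finite (listset As) \<and> card (listset As) = prod_list (map card As)"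
proof (induction As)
  case (Cons A As)
  have "listset (A # As) = (\<lambda>(x, xs). x # xs) ` (A \<times> listset As)"
    by (auto simp: set_Cons_def)
  moreover have "inj_on (\<lambda>(x, xs). x # xs) (A \<times> listset As)"
    by (auto simp: inj_on_def)
  ultimately show ?case
    using Cons by (simp add: card_image card_cartesian_product)
qed simp

text \<open>Distinct indices allow a tuple to be read as a function on the index set.\<close>

lemma in_listset_map:
  "distinct is \<Longrightarrow> xs \<in> listset (map A is) \<longleftrightarrow> (\<exists>h. xs = map h is \<and> (\<forall>i\<in>set is. h i \<in> A i))"
proof (induction "is" arbitrary: xs)
  case (Cons i "is")
  show ?case
  proof
    assume "xs \<in> listset (map A (i # is))"
    then obtain x ys where x: "xs = x # ys" "x \<in> A i" "ys \<in> listset (map A is)"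
      by (auto simp: set_Cons_def)
    then obtain h where h: "ys = map h is" "\<forall>j\<in>set is. h j \<in> A j"
      using Cons by auto
    show "\<exists>h. xs = map h (i # is) \<and> (\<forall>i\<in>set (i # is). h i \<in> A i)"
      using x h Cons.prems by (intro exI[of _ "h(i := x)"]) auto
  next
    assume "\<exists>h. xs = map h (i # is) \<and> (\<forall>i\<in>set (i # is). h i \<in> A i)"
    then show "xs \<in> listset (map A (i # is))"
      using Cons by (auto simp: set_Cons_def)
  qed
qed simp

lemma listset_map_image: "listset (map ((`) f) As) = map f ` listset As"
proof (induction As)
  case (Cons A As)
  then show ?case by (auto simp: set_Cons_def image_iff) (metis list.simps(9))
qed simp

section \<open>Finite rings and primitive idempotents\<close>

text \<open>The multiplication is a parameter so that everything proved about right modules can be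
  instantiated with the opposite multiplication.\<close>

locale finite_ring =
  fixes mul :: "'a::{ab_group_add,finite} \<Rightarrow> 'a \<Rightarrow> 'a" (infixl "\<star>" 70) and one :: 'a
  assumes assoc: "(x \<star> y) \<star> z = x \<star> (y \<star> z)"
    and one_left [simp]: "one \<star> x = x" and one_right [simp]: "x \<star> one = x"
    and add_left: "(x + y) \<star> z = x \<star> z + y \<star> z"
    and add_right: "x \<star> (y + z) = x \<star> y + x \<star> z"
begin

lemma opposite: "finite_ring (\<lambda>x y. y \<star> x) one"
  by unfold_locales (simp_all add: assoc add_left add_right)

lemma zero_left [simp]: "0 \<star> x = 0"
  using add_left[of 0 0 x] by simp

lemma zero_right [simp]: "x \<star> 0 = 0"
  using add_right[of x 0 0] by simp

lemma minus_left [simp]: "(- x) \<star> y = - (x \<star> y)"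
  using add_left[of "- x" x y] by (simp add: eq_neg_iff_add_eq_0)

lemma minus_right [simp]: "x \<star> (- y) = - (x \<star> y)"
  using add_right[of x "- y" y] by (simp add: eq_neg_iff_add_eq_0)

lemma diff_left: "(x - y) \<star> z = x \<star> z - y \<star> z"
  using add_left[of x "- y" z] by simp

lemma diff_right: "x \<star> (y - z) = x \<star> y - x \<star> z"
  using add_right[of x y "- z"] by simp

lemmas ring_simps = assoc add_left add_right diff_left diff_right

lemma absorb_left: "e \<star> x = x \<Longrightarrow> e \<star> (x \<star> y) = x \<star> y"
  by (simp flip: assoc)

lemma absorb_right: "x \<star> e = x \<Longrightarrow> (y \<star> x) \<star> e = y \<star> x"
  by (simp add: assoc)

lemma sum_left: "(\<Sum>i\<in>I. f i) \<star> x = (\<Sum>i\<in>I. f i \<star> x)"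
  by (induction I rule: infinite_finite_induct) (simp_all add: add_left)

lemma sum_right: "x \<star> (\<Sum>i\<in>I. f i) = (\<Sum>i\<in>I. x \<star> f i)"
  by (induction I rule: infinite_finite_induct) (simp_all add: add_right)

definition pw :: "'a \<Rightarrow> nat \<Rightarrow> 'a" where
  "pw x n = ((\<star>) x ^^ n) one"

lemma pw_0 [simp]: "pw x 0 = one" and pw_Suc: "pw x (Suc n) = x \<star> pw x n"
  by (simp_all add: pw_def)

lemma pw_add: "pw x (m + n) = pw x m \<star> pw x n"
  by (induction m) (simp_all add: pw_Suc assoc)

text \<open>By finiteness the powers of \<open>x\<close> are periodic from some exponent
  \<open>i\<close> on, with a period \<open>p\<close>. An exponent that is a multiple of
  \<open>p\<close> and at least \<open>i\<close> can be doubled without changing the power.\<close>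

lemma idempotent_power: "\<exists>n>0. pw x n \<star> pw x n = pw x n"
proof -
  have "\<not> inj (pw x)"
    using finite_imageD[of "pw x" UNIV] by auto
  then obtain i p where ip: "p > 0" "pw x (i + p) = pw x i"
    unfolding inj_def by (metis less_imp_add_positive linorder_neqE_nat)
  have "pw x (i + k * p) = pw x i" for k
  proof (induction k)
    case (Suc k)
    have "pw x (i + Suc k * p) = pw x (i + k * p) \<star> pw x p"
      by (simp flip: pw_add add: ac_simps)
    also have "\<dots> = pw x (i + p)" using Suc by (simp add: pw_add)
    finally show ?case using ip by simp
  qed simp
  then have "pw x (j + k * p) = pw x j" if "j \<ge> i" for j k
    using that by (metis (no_types, lifting) le_add_diff_inverse2 pw_add add.assoc)
  \<comment> \<open>The factor \<open>Suc i\<close> instead of \<open>i\<close> keeps the exponent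
    positive when \<open>i = 0\<close>.\<close>
  moreover have "i \<le> Suc i * p" using ip(1) by (simp add: trans_le_add2)
  ultimately have "pw x (Suc i * p + Suc i * p) = pw x (Suc i * p)" by blast
  then show ?thesis
    using ip(1) by (intro exI[of _ "Suc i * p"]) (simp add: pw_add del: mult_Suc)
qed

section \<open>Units and the Jacobson radical\<close>

definition unit :: "'a \<Rightarrow> bool" where
  "unit u \<longleftrightarrow> (\<exists>v. u \<star> v = one \<and> v \<star> u = one)"

lemma unit_mul: "unit u \<Longrightarrow> unit v \<Longrightarrow> unit (u \<star> v)"
  unfolding unit_def by (metis assoc one_left)

text \<open>Formally the inverse of \<open>1 - b a\<close> is the series
  \<open>1 + b a + b a b a + ...\<close>, that is \<open>1 + b (1 + a b + ...) a\<close>. Writing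
  \<open>v\<close> for the inner series suggests the witness \<open>one + b v a\<close>.\<close>

lemma unit_one_minus_swap:
  assumes "unit (one - a \<star> b)" shows "unit (one - b \<star> a)"
proof -
  obtain v where v: "(one - a \<star> b) \<star> v = one" "v \<star> (one - a \<star> b) = one"
    using assms by (auto simp: unit_def)
  have v1: "a \<star> (b \<star> v) = v - one" and v2: "v \<star> (a \<star> b) = v - one"
    using v by (auto simp: ring_simps algebra_simps)
  have v3: "a \<star> (b \<star> (v \<star> y)) = v \<star> y - y" and v4: "v \<star> (a \<star> (b \<star> y)) = v \<star> y - y" for y
    using arg_cong[OF v1, of "\<lambda>t. t \<star> y"] arg_cong[OF v2, of "\<lambda>t. t \<star> y"]
    by (auto simp: ring_simps)
  show ?thesis unfolding unit_def
    by (rule exI[of _ "one + b \<star> v \<star> a"]) (simp add: ring_simps v3 v4)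
qed

lemma unit_one_minus_nilpotent: "pw t n = 0 \<Longrightarrow> unit (one - t)"
proof -
  assume n: "pw t n = 0"
  have c: "pw t i \<star> t = t \<star> pw t i" for i
    by (induction i) (simp_all add: pw_Suc assoc)
  have "(one - t) \<star> (\<Sum>i<n. pw t i) = one - pw t n" for n
    by (induction n) (simp_all add: add_right diff_left[of one t "pw t _"] pw_Suc)
  moreover have "(\<Sum>i<n. pw t i) \<star> (one - t) = one - pw t n" for n
    by (induction n) (simp_all add: add_left diff_right[of "pw t _" one t] pw_Suc c)
  ultimately show ?thesis using n unfolding unit_def by (metis diff_zero)
qed

text \<open>With factors on both sides, the unit criterion for the Jacobson radical is stable under
  multiplication from either side by its very form, and it reads the same in the opposite ring.
  Agreement with the intersection of the maximal right ideals is \<open>rad_regular\<close>.\<close>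

definition rad :: "'a set" where
  "rad = {x. \<forall>a b. unit (one - a \<star> x \<star> b)}"

lemma rad_opposite: "finite_ring.rad (\<lambda>x y. y \<star> x) one = rad"
  unfolding rad_def finite_ring.rad_def[OF opposite] unit_def finite_ring.unit_def[OF opposite] assoc
  by blast

lemma rad_zero [simp]: "0 \<in> rad"
  by (auto simp: rad_def unit_def)

lemma rad_left [simp]: "x \<in> rad \<Longrightarrow> r \<star> x \<in> rad"
  unfolding rad_def by (simp flip: assoc)

lemma rad_right [simp]: "x \<in> rad \<Longrightarrow> x \<star> r \<in> rad"
  unfolding rad_def by (simp add: assoc)

lemma rad_add [simp]:
  assumes "x \<in> rad" "y \<in> rad" shows "x + y \<in> rad"
  unfolding rad_def
proof safe
  fix a b
  obtain v where v: "(one - a \<star> x \<star> b) \<star> v = one" "v \<star> (one - a \<star> x \<star> b) = one"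
    using assms(1) by (auto simp: rad_def unit_def)
  have u: "unit (one - (v \<star> a) \<star> y \<star> b)" "unit (one - a \<star> x \<star> b)"
    using assms by (auto simp: rad_def)
  \<comment> \<open>The unit \<open>one - a x b\<close> is factored out of
    \<open>one - a (x + y) b\<close>; its inverse \<open>v\<close> is absorbed into the left factor
    of \<open>y\<close>, which leaves a second unit.\<close>
  have "(one - a \<star> x \<star> b) \<star> (one - (v \<star> a) \<star> y \<star> b)
      = (one - a \<star> x \<star> b) - ((one - a \<star> x \<star> b) \<star> v) \<star> (a \<star> y \<star> b)"
    by (simp add: diff_right assoc)
  also have "\<dots> = one - a \<star> (x + y) \<star> b"
    unfolding v by (simp add: ring_simps)
  finally show "unit (one - a \<star> (x + y) \<star> b)"
    using unit_mul u by metis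
qed

lemma rad_minus [simp]: "- x \<in> rad \<longleftrightarrow> x \<in> rad"
  using rad_left[of "- x" "- one"] rad_left[of "x" "- one"] by auto

lemma rad_diff [simp]: "x \<in> rad \<Longrightarrow> y \<in> rad \<Longrightarrow> x - y \<in> rad"
  using rad_add[of x "- y"] by simp

text \<open>Nakayama's lemma for a cyclic module: the unit \<open>one - j\<close> annihilates
  \<open>x\<close>.\<close>

lemma rad_fix_left:
  assumes "j \<in> rad" "j \<star> x = x" shows "x = 0"
proof -
  have "unit (one - one \<star> j \<star> one)" using assms(1) unfolding rad_def by blast
  then obtain v where v: "v \<star> (one - j) = one" by (auto simp: unit_def)
  have "x = (v \<star> (one - j)) \<star> x" using v by simp
  also have "\<dots> = 0" using assms(2) by (simp add: ring_simps)
  finally show ?thesis .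
qed

lemma rad_fix_right:
  assumes "j \<in> rad" "x \<star> j = x" shows "x = 0"
  by (rule finite_ring.rad_fix_left[OF opposite]) (use assms in \<open>auto simp: rad_opposite\<close>)

section \<open>Primitive idempotents and their equivalence\<close>

definition prim :: "'a \<Rightarrow> bool" where
  "prim e \<longleftrightarrow> e \<star> e = e \<and> e \<noteq> 0 \<and>
     (\<forall>f g. f \<star> f = f \<and> g \<star> g = g \<and> f \<star> g = 0 \<and> g \<star> f = 0 \<and> e = f + g \<longrightarrow> f = 0 \<or> g = 0)"

lemma prim_opposite: "finite_ring.prim (\<lambda>x y. y \<star> x) e \<longleftrightarrow> prim e"
  unfolding prim_def finite_ring.prim_def[OF opposite] by blast

lemma prim_idem: "prim e \<Longrightarrow> e \<star> e = e"
  by (simp add: prim_def)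

lemma prim_idem2: "prim e \<Longrightarrow> e \<star> (e \<star> x) = e \<star> x"
  using assoc[of e e x] by (simp add: prim_idem)

lemma prim_notin_rad: "prim e \<Longrightarrow> e \<notin> rad"
  using rad_fix_left[of e e] by (auto simp: prim_def)

text \<open>A power of \<open>x r e\<close> is an idempotent of \<open>eRe\<close>, hence \<open>0\<close> or \<open>e\<close>.\<close>

lemma prim_generated:
  assumes e: "prim e" and x: "e \<star> x = x" "x \<notin> rad"
  obtains r where "x \<star> r = e" "r \<star> e = r"
proof -
  obtain a b where ab: "\<not> unit (one - a \<star> x \<star> b)"
    using x(2) by (auto simp: rad_def)
  \<comment> \<open>The swap lemma moves \<open>x\<close> to the front of the product that witnesses
    \<open>x \<notin> rad\<close>, so that \<open>e\<close> acts as the identity on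
    \<open>t\<close>.\<close>
  define t where "t = x \<star> (b \<star> a)"
  have nu: "\<not> unit (one - t)"
    using ab unit_one_minus_swap[of "x \<star> b" a] by (auto simp: t_def assoc)
  have et: "e \<star> t = t" using x(1) by (simp add: t_def flip: assoc)
  define w where "w = t \<star> e"
  obtain n where n: "n > 0" "pw w n \<star> pw w n = pw w n"
    using idempotent_power by blast
  have ew: "e \<star> w = w" "w \<star> e = w"
    using absorb_left[OF et] e by (simp_all add: w_def prim_idem assoc)
  have ewp: "e \<star> pw w i = pw w i" "pw w i \<star> e = pw w i" if "i > 0" for i
    using that
  proof (induction i)
    case (Suc i)
    { case 1 show ?case using ew by (simp add: pw_Suc flip: assoc) }
    { case 2 show ?case using Suc ew by (cases "i = 0") (auto simp: pw_Suc assoc) }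
  qed auto
  let ?f = "pw w n"
  have "?f = 0 \<or> e - ?f = 0"
    using e n ewp[of n] unfolding prim_def
    by (elim conjE allE[of _ ?f] allE[of _ "e - ?f"]) (auto simp: ring_simps)
  then show thesis
  proof
    \<comment> \<open>If the power of \<open>w\<close> vanishes, then so does
      \<open>t ^ (n + 1) = w ^ n t\<close>, and \<open>one - t\<close> would be a unit.\<close>
    assume f0: "?f = 0"
    have ep: "e \<star> (pw w i \<star> t) = pw w i \<star> t" for i
      using absorb_left[OF ewp(1), of i t] et by (cases "i = 0") auto
    have "pw t (Suc i) = pw w i \<star> t" for i
    proof (induction i)
      case (Suc i)
      then have "pw t (Suc (Suc i)) = t \<star> (pw w i \<star> t)" by (simp only: pw_Suc[of t "Suc i"])
      also have "\<dots> = t \<star> (e \<star> (pw w i \<star> t))" by (simp only: ep)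
      also have "\<dots> = pw w (Suc i) \<star> t" by (simp add: pw_Suc w_def assoc)
      finally show ?case .
    qed (simp add: pw_Suc)
    then have "pw t (Suc n) = 0" using f0 by simp
    then show thesis using nu unit_one_minus_nilpotent by blast
  next
    assume "e - ?f = 0"
    then have "e = pw w n" by simp
    also have "\<dots> = w \<star> pw w (n - 1)" using n(1) by (cases n) (simp_all add: pw_Suc)
    also have "\<dots> = x \<star> (b \<star> a \<star> e \<star> pw w (n - 1))" by (simp add: w_def t_def assoc)
    finally have "e = x \<star> (b \<star> a \<star> e \<star> pw w (n - 1))" .
    then have "x \<star> (b \<star> a \<star> e \<star> pw w (n - 1) \<star> e) = e"
      using prim_idem[OF e] by (metis assoc)
    then show thesis using absorb_right[OF prim_idem[OF e]] by (rule that)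
  qed
qed

lemma prim_generated_left:
  assumes "prim e" "x \<star> e = x" "x \<notin> rad"
  obtains r where "r \<star> x = e" "e \<star> r = r"
  using finite_ring.prim_generated[OF opposite, of e x] assms
  by (auto simp: prim_opposite rad_opposite)

text \<open>Left multiplications by \<open>v\<close> and \<open>u\<close> are mutually inverse maps
  between \<open>e R\<close> and \<open>f R\<close>, and right multiplications do the same for
  \<open>R e\<close> and \<open>R f\<close>. In this form the equivalence of the two isomorphism
  conditions is visible.\<close>

definition eqv :: "'a \<Rightarrow> 'a \<Rightarrow> bool" where
  "eqv e f \<longleftrightarrow> (\<exists>u v. u \<star> v = e \<and> v \<star> u = f \<and> e \<star> u = u \<and> u \<star> f = u \<and> f \<star> v = v \<and> v \<star> e = v)"

lemma eqv_opposite: "finite_ring.eqv (\<lambda>x y. y \<star> x) e f \<longleftrightarrow> eqv e f"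
  unfolding eqv_def finite_ring.eqv_def[OF opposite] by blast

lemma eqv_refl: "e \<star> e = e \<Longrightarrow> eqv e e"
  unfolding eqv_def by blast

lemma eqv_sym: "eqv e f \<Longrightarrow> eqv f e"
  unfolding eqv_def by blast

lemma eqv_trans:
  assumes "eqv e f" "eqv f g" shows "eqv e g"
proof -
  obtain u v where 1: "u \<star> v = e" "v \<star> u = f" "e \<star> u = u" "u \<star> f = u" "f \<star> v = v" "v \<star> e = v"
    using assms(1) by (auto simp: eqv_def)
  obtain u' v' where 2: "u' \<star> v' = f" "v' \<star> u' = g" "f \<star> u' = u'" "u' \<star> g = u'" "g \<star> v' = v'" "v' \<star> f = v'"
    using assms(2) by (auto simp: eqv_def)
  show ?thesis unfolding eqv_def
    by (rule exI[of _ "u \<star> u'"], rule exI[of _ "v' \<star> v"]) (metis 1 2 assoc)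
qed

text \<open>An element of \<open>e R f\<close> outside the radical has a partner \<open>v\<close>
  with \<open>x v = e\<close>. Then \<open>v x\<close> is a nonzero idempotent in the corner
  \<open>f R f\<close>, hence equal to \<open>f\<close>.\<close>

lemma eqvI:
  assumes e: "prim e" and f: "prim f" and x: "e \<star> x = x" "x \<star> f = x" "x \<notin> rad"
  shows "eqv e f"
proof -
  obtain r where r: "x \<star> r = e" "r \<star> e = r" using prim_generated[OF e x(1,3)] .
  define v where "v = f \<star> r"
  have xv: "x \<star> v = e" using r x by (simp add: v_def flip: assoc)
  have "x \<noteq> 0" using x(3) by auto
  have "v \<star> x \<noteq> 0" using xv x(1) \<open>x \<noteq> 0\<close> by (metis assoc zero_right)
  have fv: "f \<star> v = v" using f by (simp add: v_def prim_idem2)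
  have i: "(v \<star> x) \<star> (v \<star> x) = v \<star> x"
  proof -
    have "(v \<star> x) \<star> (v \<star> x) = v \<star> ((x \<star> v) \<star> x)" by (simp only: assoc)
    then show ?thesis using xv x(1) by simp
  qed
  have k: "f \<star> (v \<star> x) = v \<star> x" "(v \<star> x) \<star> f = v \<star> x"
    using absorb_left[OF fv] x by (simp_all add: assoc)
  have "v \<star> x = 0 \<or> f - v \<star> x = 0"
    using f i k unfolding prim_def
    by (elim conjE allE[of _ "v \<star> x"] allE[of _ "f - v \<star> x"]) (simp add: diff_left diff_right)
  then have "v \<star> x = f" using \<open>v \<star> x \<noteq> 0\<close> by simp
  moreover have "v \<star> e = v" using r by (simp add: v_def assoc)
  ultimately show ?thesis unfolding eqv_def using xv x fv by blast
qed

subsection \<open>Tops and socles\<close>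

definition right_ideal :: "'a set \<Rightarrow> bool" where
  "right_ideal N \<longleftrightarrow> 0 \<in> N \<and> (\<forall>x\<in>N. \<forall>y\<in>N. x + y \<in> N) \<and> (\<forall>x\<in>N. \<forall>r. x \<star> r \<in> N)"

lemma right_ideal_minus: "right_ideal N \<Longrightarrow> x \<in> N \<Longrightarrow> - x \<in> N"
  unfolding right_ideal_def by (metis minus_right one_right)

lemma right_ideal_diff: "right_ideal N \<Longrightarrow> x \<in> N \<Longrightarrow> y \<in> N \<Longrightarrow> x - y \<in> N"
  using right_ideal_minus[of N y] by (metis right_ideal_def uminus_add_conv_diff add.commute)

lemma right_ideal_sum:
  "right_ideal N \<Longrightarrow> (\<And>i. i \<in> I \<Longrightarrow> f i \<in> N) \<Longrightarrow> (\<Sum>i\<in>I. f i) \<in> N"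
  by (induction I rule: infinite_finite_induct) (auto simp: right_ideal_def)

lemma right_ideal_rad: "right_ideal rad"
  by (simp add: right_ideal_def)

lemma right_ideal_cyclic: "right_ideal {x \<star> r | r. True}"
  unfolding right_ideal_def by (auto simp: assoc) (metis zero_right, metis add_right)

definition coset :: "'a set \<Rightarrow> 'a \<Rightarrow> 'a set" where
  "coset K x = (+) x ` K"

lemma coset_iff: "right_ideal K \<Longrightarrow> y \<in> coset K x \<longleftrightarrow> y - x \<in> K"
  unfolding coset_def by (auto simp: image_iff) (metis add_diff_cancel_left' diff_add_cancel add.commute)

lemma coset_eq_iff: 
  assumes "right_ideal K" shows "coset K x = coset K y \<longleftrightarrow> x - y \<in> K"
proof
  assume "coset K x = coset K y"
  moreover have "x \<in> coset K x" using assms by (simp add: coset_iff) (simp add: right_ideal_def)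
  ultimately show "x - y \<in> K" using assms by (simp add: coset_iff)
next
  assume xy: "x - y \<in> K"
  have "z - x \<in> K \<longleftrightarrow> z - y \<in> K" for z
    using right_ideal_diff[OF assms _ xy, of "z - y"] assms xy
    by (auto simp: right_ideal_def) (metis diff_add_cancel add_diff_eq)
  then show "coset K x = coset K y" using assms by (auto simp: coset_iff)
qed

lemma coset_zero: "right_ideal K \<Longrightarrow> coset K 0 = K"
  by (auto simp: coset_iff)

lemma coset_add:
  assumes "right_ideal K"
  shows "{a + b | a b. a \<in> coset K x \<and> b \<in> coset K y} = coset K (x + y)"
proof -
  have "\<exists>a b. z = a + b \<and> a - x \<in> K \<and> b - y \<in> K" if "z - (x + y) \<in> K" for z
    using that assms by (intro exI[of _ "z - y"] exI[of _ y]) (auto simp: right_ideal_def algebra_simps)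
  moreover have "a + b - (x + y) \<in> K" if "a - x \<in> K" "b - y \<in> K" for a b
    using that assms by (simp add: right_ideal_def add_diff_add)
  ultimately show ?thesis using assms by (auto simp: coset_iff)
qed

lemma coset_act:
  assumes "right_ideal K"
  shows "(\<Union>a\<in>coset K x. coset K (a \<star> r)) = coset K (x \<star> r)"
proof -
  have "coset K (a \<star> r) = coset K (x \<star> r)" if "a \<in> coset K x" for a
    using that assms by (simp add: coset_iff coset_eq_iff flip: diff_left) (simp add: right_ideal_def)
  moreover have "x \<in> coset K x" using assms by (simp add: coset_iff) (simp add: right_ideal_def)
  ultimately show ?thesis by blast
qed

text \<open>In the opposite ring these become the left regular and the left principal
  modules.\<close>

definition regular :: "('a, 'a) mod_struct" where
  "regular = \<lparr>mod_carrier = UNIV, mod_zero = 0, mod_add = (+), mod_act = (\<lambda>r x. x \<star> r)\<rparr>"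

definition principal :: "'a \<Rightarrow> ('a, 'a) mod_struct" where
  "principal a = submod_of regular {a \<star> r | r. True}"

lemma regular_simps [simp]:
  "mod_carrier regular = UNIV" "mod_zero regular = 0" "mod_add regular = (+)"
  "mod_act regular = (\<lambda>r x. x \<star> r)"
  by (simp_all add: regular_def)

lemma principal_simps [simp]:
  "mod_zero (principal a) = 0" "mod_add (principal a) = (+)" "mod_act (principal a) = (\<lambda>r x. x \<star> r)"
  by (simp_all add: principal_def submod_of_def)

lemma submod_of_simps [simp]:
  "mod_carrier (submod_of M N) = N" "mod_zero (submod_of M N) = mod_zero M"
  "mod_add (submod_of M N) = mod_add M" "mod_act (submod_of M N) = mod_act M"
  by (simp_all add: submod_of_def)

lemma principal_carrier: "e \<star> e = e \<Longrightarrow> mod_carrier (principal e) = {x. e \<star> x = x}"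
  by (auto simp: principal_def absorb_left) metis

lemma submod_regular: "is_submod regular N \<longleftrightarrow> right_ideal N"
  by (auto simp: is_submod_def right_ideal_def)

lemma submod_principal:
  "e \<star> e = e \<Longrightarrow> is_submod (principal e) N \<longleftrightarrow> right_ideal N \<and> (\<forall>x\<in>N. e \<star> x = x)"
  by (auto simp: is_submod_def right_ideal_def principal_carrier)

text \<open>A submodule that leaves \<open>J\<close> contains a generator of \<open>e R\<close>. So
  \<open>e R \<inter> J\<close> contains all proper submodules and is the only maximal one.\<close>

lemma rad_principal:
  assumes e: "prim e"
  shows "rad_mod (principal e) = {x. e \<star> x = x \<and> x \<in> rad}" (is "_ = ?K")
proof -
  note i = prim_idem[OF e]
  have K: "is_submod (principal e) ?K"
    by (auto simp: submod_principal[OF i] right_ideal_def add_right absorb_left)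
  have neq: "?K \<noteq> mod_carrier (principal e)"
    using prim_notin_rad[OF e] i by (auto simp: principal_carrier[OF i])
  have sub: "N \<subseteq> ?K" if N: "is_submod (principal e) N" "N \<noteq> mod_carrier (principal e)" for N
  proof (rule ccontr)
    assume "\<not> N \<subseteq> ?K"
    then obtain x where x: "x \<in> N" "e \<star> x = x" "x \<notin> rad"
      using N(1) by (auto simp: submod_principal[OF i])
    then obtain r where "x \<star> r = e" using prim_generated[OF e] by metis
    then have "e \<in> N" using x(1) N(1) by (auto simp: submod_principal[OF i] right_ideal_def)
    then have "y \<in> N" if "e \<star> y = y" for y
      using that N(1) by (metis submod_principal[OF i] right_ideal_def)
    then show False using N by (auto simp: submod_principal[OF i] principal_carrier[OF i])
  qed
  have "maximal_submod (principal e) N \<longleftrightarrow> N = ?K" for N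
    using K neq sub unfolding maximal_submod_def by blast
  then show ?thesis
    using K by (auto simp: rad_mod_def is_submod_def)
qed

definition complete :: "nat \<Rightarrow> (nat \<Rightarrow> 'a) \<Rightarrow> bool" where
  "complete m e \<longleftrightarrow> (\<forall>i\<in>{1..m}. prim (e i)) \<and>
     (\<forall>i\<in>{1..m}. \<forall>j\<in>{1..m}. i \<noteq> j \<longrightarrow> e i \<star> e j = 0) \<and> (\<Sum>i\<in>{1..m}. e i) = one"

lemma complete_opposite:
  "complete m e \<Longrightarrow> finite_ring.complete (\<lambda>x y. y \<star> x) one m e"
  unfolding complete_def finite_ring.complete_def[OF opposite] prim_opposite by auto

lemma complete_decomp_left: "complete m e \<Longrightarrow> x = (\<Sum>i\<in>{1..m}. e i \<star> x)"
  by (simp add: complete_def flip: sum_left)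

lemma complete_decomp_right: "complete m e \<Longrightarrow> x = (\<Sum>i\<in>{1..m}. x \<star> e i)"
  by (simp add: complete_def flip: sum_right)

lemma maximal_regularD:
  "maximal_submod regular N \<Longrightarrow> right_ideal N' \<Longrightarrow> N \<subseteq> N' \<Longrightarrow> x \<in> N' \<Longrightarrow> x \<notin> N \<Longrightarrow> y \<in> N'"
  unfolding maximal_submod_def submod_regular by (metis UNIV_I regular_simps(1))

text \<open>The right ideal \<open>{y. e\<^sub>i y \<in> J}\<close> is the kernel of the projection
  from \<open>R\<close> to the top of \<open>e\<^sub>i R\<close>, hence maximal; since the
  idempotents sum to one, an element lying in all of these is in \<open>J\<close>. Conversely, a
  maximal right ideal missing some \<open>x \<in> J\<close> would contain an element
  \<open>one - x r\<close>, which is a unit.\<close>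

lemma rad_regular:
  assumes c: "complete m e"
  shows "rad_mod regular = rad"
proof (intro Set.set_eqI iffI)
  fix x assume x: "x \<in> rad_mod regular"
  show "x \<in> rad"
  proof (rule ccontr)
    assume "x \<notin> rad"
    then obtain i where i: "i \<in> {1..m}" "e i \<star> x \<notin> rad"
      using right_ideal_sum[OF right_ideal_rad, of "{1..m}" "\<lambda>i. e i \<star> x"]
      unfolding complete_decomp_left[OF c, of x, symmetric] by blast
    have pe: "prim (e i)" using c i(1) by (simp add: complete_def)
    let ?N = "{y. e i \<star> y \<in> rad}"
    have rN: "right_ideal ?N"
      by (auto simp: right_ideal_def add_right simp flip: assoc)
    have "one \<in> N'" if N': "right_ideal N'" "?N \<subseteq> N'" "N' \<noteq> ?N" for N'
    proof -
      obtain y where y: "y \<in> N'" "e i \<star> y \<notin> rad" using N' by blast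
      obtain r where r: "e i \<star> y \<star> r = e i"
        using prim_generated[OF pe prim_idem2[OF pe] y(2)] by metis
      have "one - y \<star> r \<in> ?N" using r by (simp add: diff_right assoc)
      moreover have "y \<star> r \<in> N'" using y(1) N'(1) by (simp add: right_ideal_def)
      ultimately have "one - y \<star> r + y \<star> r \<in> N'"
        using N' unfolding right_ideal_def by blast
      then show ?thesis by simp
    qed
    then have "N' = UNIV" if N': "right_ideal N'" "?N \<subseteq> N'" "N' \<noteq> ?N" for N'
      using that unfolding right_ideal_def by (metis UNIV_eq_I one_left)
    moreover have "one \<notin> ?N" using prim_notin_rad[OF pe] by simp
    ultimately have "maximal_submod regular ?N"
      unfolding maximal_submod_def submod_regular using rN by (metis UNIV_I regular_simps(1))
    then show False using x i(2) by (auto simp: rad_mod_def)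
  qed
next
  fix x assume x: "x \<in> rad"
  have "x \<in> N" if N: "maximal_submod regular N" for N
  proof (rule ccontr)
    assume "x \<notin> N"
    have rN: "right_ideal N" using N by (simp add: maximal_submod_def submod_regular)
    let ?N = "{n + x \<star> r | n r. n \<in> N}"
    have "right_ideal ?N"
      unfolding right_ideal_def
    proof (safe)
      show "\<exists>n r. 0 = n + x \<star> r \<and> n \<in> N"
        using rN by (intro exI[of _ 0]) (auto simp: right_ideal_def)
    next
      fix n r n' r' assume "n \<in> N" "n' \<in> N"
      then show "\<exists>n'' r''. n + x \<star> r + (n' + x \<star> r') = n'' + x \<star> r'' \<and> n'' \<in> N"
        using rN by (intro exI[of _ "n + n'"] exI[of _ "r + r'"])
          (auto simp: right_ideal_def add_right ac_simps)
    next
      fix n r s assume "n \<in> N"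
      then show "\<exists>n'' r''. (n + x \<star> r) \<star> s = n'' + x \<star> r'' \<and> n'' \<in> N"
        using rN by (intro exI[of _ "n \<star> s"] exI[of _ "r \<star> s"])
          (auto simp: right_ideal_def add_left assoc)
    qed
    moreover have "n \<in> ?N" if "n \<in> N" for n
      using that by (intro CollectI exI[of _ n] exI[of _ 0]) simp
    moreover have "x \<in> ?N"
      using rN by (intro CollectI exI[of _ 0] exI[of _ one]) (simp add: right_ideal_def)
    ultimately have "one \<in> ?N"
      using \<open>x \<notin> N\<close> by (intro maximal_regularD[OF N, of ?N x one] subsetI)
    then obtain n r where nr: "one = n + x \<star> r" "n \<in> N" by blast
    have "unit (one - one \<star> x \<star> r)" using x unfolding rad_def by blast
    moreover have "one - one \<star> x \<star> r = n" unfolding one_left diff_eq_eq by (rule nr(1))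
    ultimately obtain v where "n \<star> v = one" by (auto simp: unit_def)
    then have "one \<in> N" using nr(2) rN by (metis right_ideal_def)
    then have "N = UNIV" using rN unfolding right_ideal_def by (metis UNIV_eq_I one_left)
    then show False using \<open>x \<notin> N\<close> by simp
  qed
  then show "x \<in> rad_mod regular" by (simp add: rad_mod_def)
qed

section \<open>Isomorphisms with the top of a principal module\<close>

lemma top_principal:
  assumes e: "prim e"
  defines "K \<equiv> {x. e \<star> x = x \<and> x \<in> rad}" and "T \<equiv> top_mod (principal e)"
  shows "right_ideal K" and "mod_carrier T = coset K ` {x. e \<star> x = x}"
    and "mod_add T (coset K x) (coset K y) = coset K (x + y)"
    and "mod_act T r (coset K x) = coset K (x \<star> r)"
proof -
  show K: "right_ideal K"
    by (auto simp: K_def right_ideal_def add_right absorb_left)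
  have T: "T = quot_mod (principal e) K"
    unfolding T_def top_mod_def rad_principal[OF e] K_def ..
  have mc: "mod_coset (principal e) K = coset K"
    by (auto simp: mod_coset_def coset_def)
  show "mod_carrier T = coset K ` {x. e \<star> x = x}"
    by (simp add: T quot_mod_def mc principal_carrier prim_idem[OF e])
  show "mod_add T (coset K x) (coset K y) = coset K (x + y)"
    by (simp add: T quot_mod_def mc coset_add[OF K])
  show "mod_act T r (coset K x) = coset K (x \<star> r)"
    by (simp add: T quot_mod_def mc coset_act[OF K])
qed

text \<open>The map \<open>g\<close> induces an isomorphism from the top of \<open>e R\<close> onto
  \<open>M\<close>, but is given on representatives in \<open>e R\<close>, so that later
  calculations take place in the ring rather than with cosets.\<close>

definition covers :: "'a \<Rightarrow> ('a, 'm) mod_struct \<Rightarrow> ('a \<Rightarrow> 'm) \<Rightarrow> bool" where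
  "covers e M g \<longleftrightarrow> g ` {y. e \<star> y = y} = mod_carrier M \<and>
     (\<forall>y y'. e \<star> y = y \<and> e \<star> y' = y' \<longrightarrow>
        g (y + y') = mod_add M (g y) (g y') \<and> (g y = g y' \<longleftrightarrow> y - y' \<in> rad)) \<and>
     (\<forall>y r. e \<star> y = y \<longrightarrow> g (y \<star> r) = mod_act M r (g y))"

lemma mod_iso_topD:
  assumes e: "prim e" and iso: "mod_iso M (top_mod (principal e))"
    and closed: "\<And>x y. x \<in> mod_carrier M \<Longrightarrow> y \<in> mod_carrier M \<Longrightarrow> mod_add M x y \<in> mod_carrier M"
      "\<And>r x. x \<in> mod_carrier M \<Longrightarrow> mod_act M r x \<in> mod_carrier M"
  shows "\<exists>g. covers e M g"
proof -
  define K where "K = {x. e \<star> x = x \<and> x \<in> rad}"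
  note T = top_principal[OF e, folded K_def]
  obtain f where f: "bij_betw f (mod_carrier M) (coset K ` {x. e \<star> x = x})"
    "\<And>x y. x \<in> mod_carrier M \<Longrightarrow> y \<in> mod_carrier M \<Longrightarrow>
       f (mod_add M x y) = mod_add (top_mod (principal e)) (f x) (f y)"
    "\<And>r x. x \<in> mod_carrier M \<Longrightarrow> f (mod_act M r x) = mod_act (top_mod (principal e)) r (f x)"
    using iso unfolding mod_iso_def T(2) by blast
  \<comment> \<open>The inverse isomorphism composed with the projection of \<open>e R\<close> onto
    its top.\<close>
  define g where "g y = the_inv_into (mod_carrier M) f (coset K y)" for y
  have inj: "inj_on f (mod_carrier M)" using f(1) by (simp add: bij_betw_def)
  have g: "g y \<in> mod_carrier M" "f (g y) = coset K y" if "e \<star> y = y" for y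
    using that f(1) unfolding g_def bij_betw_def
    by (auto intro!: the_inv_into_into f_the_inv_into_f)
  have gI: "g y = z" if "e \<star> y = y" "z \<in> mod_carrier M" "f z = coset K y" for y z
    using inj_onD[OF inj, of "g y" z] g that by simp
  have "g ` {y. e \<star> y = y} = mod_carrier M"
  proof (intro equalityI subsetI)
    fix z assume z: "z \<in> mod_carrier M"
    then have "f z \<in> coset K ` {x. e \<star> x = x}" using f(1) by (auto simp: bij_betw_def)
    then obtain y where "e \<star> y = y" "f z = coset K y" by blast
    then show "z \<in> g ` {y. e \<star> y = y}" using gI[of y z] z by blast
  qed (use g in auto)
  moreover have "g (y + y') = mod_add M (g y) (g y') \<and> (g y = g y' \<longleftrightarrow> y - y' \<in> rad)"
    if y: "e \<star> y = y" "e \<star> y' = y'" for y y'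
  proof
    show "g (y + y') = mod_add M (g y) (g y')"
      using y g closed f(2) T(3) by (intro gI) (simp_all add: add_right)
    have "g y = g y' \<longleftrightarrow> coset K y = coset K y'"
      using g[OF y(1)] g[OF y(2)] inj by (metis g_def)
    then show "g y = g y' \<longleftrightarrow> y - y' \<in> rad"
      using y by (simp add: coset_eq_iff[OF T(1)]) (simp add: K_def diff_right)
  qed
  moreover have "g (y \<star> r) = mod_act M r (g y)" if y: "e \<star> y = y" for y r
    using y g closed f(3) T(4) by (intro gI) (simp_all add: absorb_left)
  ultimately show ?thesis unfolding covers_def by blast
qed

lemma mod_iso_topI:
  assumes e: "prim e" and g: "covers e M g"
  shows "mod_iso M (top_mod (principal e))"
proof -
  define K where "K = {x. e \<star> x = x \<and> x \<in> rad}"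
  note T = top_principal[OF e, folded K_def]
  have img: "g ` {y. e \<star> y = y} = mod_carrier M"
    and add: "\<And>y y'. e \<star> y = y \<Longrightarrow> e \<star> y' = y' \<Longrightarrow> g (y + y') = mod_add M (g y) (g y')"
    and ker: "\<And>y y'. e \<star> y = y \<Longrightarrow> e \<star> y' = y' \<Longrightarrow> g y = g y' \<longleftrightarrow> y - y' \<in> rad"
    and act: "\<And>y r. e \<star> y = y \<Longrightarrow> g (y \<star> r) = mod_act M r (g y)"
    using g by (auto simp: covers_def)
  \<comment> \<open>The fibres of \<open>g\<close> are cosets of \<open>K\<close>, so sending
    \<open>z\<close> to its fibre inverts the induced map.\<close>
  define f where "f z = {y. e \<star> y = y \<and> g y = z}" for z
  have fg: "f (g y) = coset K y" if y: "e \<star> y = y" for y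
  proof -
    have "z \<in> f (g y) \<longleftrightarrow> z \<in> coset K y" for z
      using y ker[of z y] unfolding f_def coset_iff[OF T(1)] by (auto simp: K_def diff_right)
    then show ?thesis by blast
  qed
  have "inj_on f (mod_carrier M)"
  proof (rule inj_onI)
    fix x y assume xy: "x \<in> mod_carrier M" "y \<in> mod_carrier M" "f x = f y"
    obtain u where u: "e \<star> u = u" "g u = x" using xy(1) unfolding img[symmetric] by blast
    obtain v where v: "e \<star> v = v" "g v = y" using xy(2) unfolding img[symmetric] by blast
    have "coset K u = coset K v" using fg[OF u(1)] fg[OF v(1)] u(2) v(2) xy(3) by simp
    then have "u - v \<in> rad" unfolding coset_eq_iff[OF T(1)] by (simp add: K_def)
    then show "x = y" using ker[OF u(1) v(1)] u(2) v(2) by simp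
  qed
  moreover have "f ` mod_carrier M = coset K ` {x. e \<star> x = x}"
    unfolding img[symmetric] image_image using fg by (intro image_cong) auto
  moreover have "f (mod_add M x y) = mod_add (top_mod (principal e)) (f x) (f y)"
    if xy: "x \<in> mod_carrier M" "y \<in> mod_carrier M" for x y
  proof -
    obtain u where u: "e \<star> u = u" "g u = x" using xy(1) unfolding img[symmetric] by blast
    obtain v where v: "e \<star> v = v" "g v = y" using xy(2) unfolding img[symmetric] by blast
    have "e \<star> (u + v) = u + v" using u(1) v(1) by (simp add: add_right)
    from fg[OF this] show ?thesis
      unfolding add[OF u(1) v(1)] T(3)[symmetric] fg[OF u(1), symmetric] fg[OF v(1), symmetric] u(2) v(2) .
  qed
  moreover have "f (mod_act M r x) = mod_act (top_mod (principal e)) r (f x)"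
    if x: "x \<in> mod_carrier M" for r x
  proof -
    obtain u where u: "e \<star> u = u" "g u = x" using x unfolding img[symmetric] by blast
    from fg[OF absorb_left[OF u(1)], of r] show ?thesis
      unfolding act[OF u(1)] T(4)[symmetric] fg[OF u(1), symmetric] u(2) .
  qed
  ultimately show ?thesis
    unfolding mod_iso_def T(2) bij_betw_def by (intro exI[of _ f]) simp
qed

section \<open>The right socle as an annihilator of the radical\<close>

definition socle :: "'a set" where
  "socle = {x. \<forall>j\<in>rad. x \<star> j = 0}"

lemma right_ideal_socle: "right_ideal socle"
  by (auto simp: right_ideal_def socle_def add_left assoc)

lemma socle_left: "x \<in> socle \<Longrightarrow> r \<star> x \<in> socle"
  by (auto simp: socle_def assoc)

text \<open>An element of \<open>x e R\<close> outside \<open>0\<close> comes from an element of \<open>e R\<close> outside the radical,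
  and such an element generates \<open>e R\<close>.\<close>

lemma socle_simple:
  assumes e: "prim e" and x: "x \<in> socle" "x \<star> e = x" and y: "x \<star> r \<noteq> 0"
  shows "\<exists>s. x \<star> r \<star> s = x"
proof -
  have "e \<star> r \<notin> rad" using x y by (auto simp: socle_def) (metis assoc)
  then obtain s where "e \<star> r \<star> s = e" using prim_generated[OF e prim_idem2[OF e]] by metis
  then show ?thesis using x(2) by (metis assoc)
qed

text \<open>A simple \<open>S\<close> is killed by \<open>J\<close>: if
  \<open>x j \<noteq> 0\<close>, then \<open>x j R = S\<close> contains \<open>x\<close>, and
  \<open>x = x j r\<close> forces \<open>x = 0\<close>. Conversely, if \<open>J\<close> kills
  \<open>x\<close>, every nonzero piece \<open>x e\<^sub>i\<close> generates a simple submodule, so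
  a submodule containing all simple ones contains the sum \<open>x\<close> of the pieces.\<close>

lemma socle_principal:
  assumes c: "complete m e" and a: "a \<star> a = a"
  shows "soc_mod (principal a) = submod_of (principal a) {x. a \<star> x = x \<and> x \<in> socle}"
    (is "_ = submod_of _ ?K")
proof -
  note subm = submod_principal[OF a]
  let ?F = "{N. is_submod (principal a) N \<and>
          (\<forall>S. is_submod (principal a) S \<and> simple_mod (submod_of (principal a) S) \<longrightarrow> S \<subseteq> N)}"
  have "right_ideal ?K"
    using right_ideal_socle by (auto simp: right_ideal_def add_right absorb_left)
  moreover have "S \<subseteq> ?K"
    if S: "right_ideal S" "\<forall>x\<in>S. a \<star> x = x" "simple_mod (submod_of (principal a) S)" for S
  proof -
    have "x \<star> j = 0" if x: "x \<in> S" and j: "j \<in> rad" for x j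
    proof (rule ccontr)
      assume nz: "x \<star> j \<noteq> 0"
      let ?N = "{x \<star> j \<star> r | r. True}"
      have "?N \<subseteq> S" using x S(1) by (auto simp: right_ideal_def)
      then have "is_submod (submod_of (principal a) S) ?N"
        using right_ideal_cyclic[of "x \<star> j"] by (auto simp: is_submod_def right_ideal_def)
      then have "?N = {0} \<or> ?N = S" using S(3) by (auto simp: simple_mod_def)
      moreover have "x \<star> j \<in> ?N" by (auto intro: exI[of _ one])
      ultimately have "x \<in> ?N" using nz x by auto
      then obtain r where "x = x \<star> j \<star> r" by blast
      then have "x \<star> (j \<star> r) = x" by (simp only: assoc)
      then have "x = 0" using j rad_fix_right[of "j \<star> r" x] by simp
      then show False using nz by simp
    qed
    then show ?thesis using S(2) by (auto simp: socle_def)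
  qed
  ultimately have "?K \<in> ?F" by (auto simp: subm)
  moreover have "x \<in> N" if N: "N \<in> ?F" and x: "x \<in> ?K" for N x
  proof -
    have rN: "right_ideal N" using N by (simp add: subm)
    have "x \<star> e i \<in> N" if i: "i \<in> {1..m}" for i
    proof (cases "x \<star> e i = 0")
      case True then show ?thesis using rN by (simp add: right_ideal_def)
    next
      case False
      let ?y = "x \<star> e i" and ?S = "{x \<star> e i \<star> r | r. True}"
      have pe: "prim (e i)" using c i by (simp add: complete_def)
      have y: "?y \<in> socle" "?y \<star> e i = ?y"
        using x right_ideal_socle pe by (auto simp: right_ideal_def assoc prim_idem)
      have yS: "?y \<in> ?S" by (auto intro: exI[of _ one])
      have "is_submod (principal a) ?S"
        using right_ideal_cyclic[of ?y] x by (auto simp: subm absorb_left assoc)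
      moreover have "simple_mod (submod_of (principal a) ?S)"
        unfolding simple_mod_def
      proof (intro conjI allI impI)
        show "mod_carrier (submod_of (principal a) ?S) \<noteq> {mod_zero (submod_of (principal a) ?S)}"
          using yS False by auto
        fix N' assume "is_submod (submod_of (principal a) ?S) N'"
        then have N': "N' \<subseteq> ?S" "right_ideal N'"
          by (auto simp: is_submod_def right_ideal_def)
        show "N' = {mod_zero (submod_of (principal a) ?S)} \<or> N' = mod_carrier (submod_of (principal a) ?S)"
        proof (cases "N' \<subseteq> {0}")
          case True
          then show ?thesis using N'(2) by (auto simp: right_ideal_def)
        next
          case False
          then obtain r where r: "?y \<star> r \<in> N'" "?y \<star> r \<noteq> 0" using N'(1) by auto
          then obtain s where "?y \<star> r \<star> s = ?y" using socle_simple[OF pe y] by blast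
          then have "?y \<in> N'" using r(1) N'(2) by (metis right_ideal_def)
          then have "?S \<subseteq> N'" using N'(2) by (auto simp: right_ideal_def)
          then show ?thesis using N'(1) by auto
        qed
      qed
      ultimately show ?thesis using N yS by blast
    qed
    then have "(\<Sum>i\<in>{1..m}. x \<star> e i) \<in> N" by (rule right_ideal_sum[OF rN])
    then show ?thesis using complete_decomp_right[OF c, of x] by simp
  qed
  ultimately have "\<Inter>?F = ?K" by blast
  then show ?thesis by (simp add: soc_mod_def)
qed

text \<open>The element \<open>z\<close> is the image of \<open>b\<close>. A nonzero
  \<open>z\<close> in the socle automatically has kernel \<open>b R \<inter> J\<close> on
  \<open>b R\<close>, since any element outside \<open>J\<close> generates \<open>b R\<close>;
  generating the socle is therefore the whole condition.\<close>

lemma socle_iso_top: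
  assumes c: "complete m e" and a: "prim a" and b: "prim b"
  shows "mod_iso (soc_mod (principal a)) (top_mod (principal b)) \<longleftrightarrow>
    (\<exists>z. z \<noteq> 0 \<and> a \<star> z = z \<and> z \<star> b = z \<and> {x. a \<star> x = x \<and> x \<in> socle} = {z \<star> r | r. True})"
    (is "_ \<longleftrightarrow> (\<exists>z. ?P z)")
proof -
  let ?K = "{x. a \<star> x = x \<and> x \<in> socle}"
  note S = socle_principal[OF c prim_idem[OF a]]
  have rK: "right_ideal ?K"
    using right_ideal_socle by (auto simp: right_ideal_def add_right absorb_left)
  show ?thesis
  proof
    assume "mod_iso (soc_mod (principal a)) (top_mod (principal b))"
    then have "\<exists>g. covers b (soc_mod (principal a)) g"
      by (rule mod_iso_topD[OF b]) (use rK in \<open>auto simp: S right_ideal_def\<close>)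
    then obtain g where g: "covers b (soc_mod (principal a)) g" ..
    have img: "g ` {y. b \<star> y = y} = ?K" and gact: "\<And>y r. b \<star> y = y \<Longrightarrow> g (y \<star> r) = g y \<star> r"
      and gadd: "\<And>y y'. b \<star> y = y \<Longrightarrow> b \<star> y' = y' \<Longrightarrow> g (y + y') = g y + g y'"
      and ker: "\<And>y y'. b \<star> y = y \<Longrightarrow> b \<star> y' = y' \<Longrightarrow> g y = g y' \<longleftrightarrow> y - y' \<in> rad"
      using g by (auto simp: covers_def S)
    have bb: "b \<star> b = b" using b by (rule prim_idem)
    have gy: "g y = g b \<star> y" if "b \<star> y = y" for y using gact[OF bb, of y] that by simp
    have "g b \<in> ?K" using img bb by blast
    moreover have "g b \<noteq> 0" using ker[OF bb, of 0] prim_notin_rad[OF b] gact[OF bb, of 0] by auto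
    moreover have "g b \<star> b = g b" using gy[OF bb] by simp
    moreover have "?K = {g b \<star> r | r. True}"
    proof
      show "?K \<subseteq> {g b \<star> r | r. True}" unfolding img[symmetric] using gy by blast
      show "{g b \<star> r | r. True} \<subseteq> ?K" using rK \<open>g b \<in> ?K\<close> unfolding right_ideal_def by blast
    qed
    ultimately show "\<exists>z. ?P z" by blast
  next
    assume "\<exists>z. ?P z"
    then obtain z where z: "z \<noteq> 0" "a \<star> z = z" "z \<star> b = z" "?K = {z \<star> r | r. True}" by blast
    have "z \<star> one \<in> ?K" unfolding z(4) by blast
    then have zs: "z \<in> socle" by simp
    have "covers b (soc_mod (principal a)) (\<lambda>y. z \<star> y)"
      unfolding covers_def
    proof (intro conjI allI impI)
      have "z \<star> r \<in> (\<lambda>y. z \<star> y) ` {y. b \<star> y = y}" for r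
        using z(3) prim_idem2[OF b, of r] by (intro image_eqI[of _ _ "b \<star> r"]) (auto simp flip: assoc)
      then show "(\<lambda>y. z \<star> y) ` {y. b \<star> y = y} = mod_carrier (soc_mod (principal a))"
        by (auto simp: S z(4))
      fix y y' assume "b \<star> y = y \<and> b \<star> y' = y'"
      then have d: "b \<star> (y - y') = y - y'" by (simp add: diff_right)
      show "z \<star> (y + y') = mod_add (soc_mod (principal a)) (z \<star> y) (z \<star> y')"
        by (simp add: S add_right)
      have "z \<star> (y - y') = 0 \<longleftrightarrow> y - y' \<in> rad"
      proof
        assume 0: "z \<star> (y - y') = 0"
        show "y - y' \<in> rad"
        proof (rule ccontr)
          assume "y - y' \<notin> rad"
          then obtain r where "(y - y') \<star> r = b" using prim_generated[OF b d] by metis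
          then have "z = 0" using 0 z(3) by (metis assoc zero_left)
          then show False using z(1) by simp
        qed
      qed (use zs in \<open>auto simp: socle_def\<close>)
      then show "z \<star> y = z \<star> y' \<longleftrightarrow> y - y' \<in> rad" by (simp add: diff_right)
    qed (simp add: S assoc)
    then show "mod_iso (soc_mod (principal a)) (top_mod (principal b))"
      by (rule mod_iso_topI[OF b])
  qed
qed

text \<open>An isomorphism \<open>g\<close> is left multiplication by \<open>g e\<close>, and its
  inverse is left multiplication by the preimage \<open>b\<close> of \<open>f\<close>. These two
  elements are the pair in \<open>eqv\<close>.\<close>

lemma principal_iso_iff:
  assumes e: "e \<star> e = e" and f: "f \<star> f = f"
  shows "mod_iso (principal e) (principal f) \<longleftrightarrow> eqv e f"
proof
  assume "mod_iso (principal e) (principal f)"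
  then obtain g where g: "bij_betw g {x. e \<star> x = x} {x. f \<star> x = x}"
    "\<And>r x. e \<star> x = x \<Longrightarrow> g (x \<star> r) = g x \<star> r"
    by (auto simp: mod_iso_def principal_carrier e f)
  have ge: "f \<star> g e = g e" using g(1) e by (auto simp: bij_betw_def)
  have "f \<in> g ` {x. e \<star> x = x}" using g(1) f by (simp add: bij_betw_def)
  then obtain b where b: "e \<star> b = b" "g b = f" by blast
  have gy: "g y = g e \<star> y" if "e \<star> y = y" for y using g(2)[OF e, of y] that by simp
  have inj: "x = y" if "e \<star> x = x" "e \<star> y = y" "g x = g y" for x y
    using g(1) that by (auto simp: bij_betw_def inj_on_def)
  have bf: "b \<star> f = b"
    by (rule inj) (use b f in \<open>auto simp: absorb_left g(2)\<close>)
  have ab: "g e \<star> b = f" using gy[OF b(1)] b(2) by simp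
  have ba: "b \<star> g e = e"
    by (rule inj) (use b e ge in \<open>auto simp: absorb_left g(2)\<close>)
  show "eqv e f" unfolding eqv_def
    by (rule exI[of _ b], rule exI[of _ "g e"]) (use ab ba ge bf b gy[OF e] in auto)
next
  assume "eqv e f"
  then obtain u v where uv: "u \<star> v = e" "v \<star> u = f" "e \<star> u = u" "u \<star> f = u" "f \<star> v = v" "v \<star> e = v"
    by (auto simp: eqv_def)
  have "bij_betw (\<lambda>x. v \<star> x) {x. e \<star> x = x} {x. f \<star> x = x}"
    by (rule bij_betw_byWitness[where f' = "\<lambda>x. u \<star> x"])
      (use uv in \<open>auto simp: absorb_left simp flip: assoc\<close>)
  then show "mod_iso (principal e) (principal f)"
    unfolding mod_iso_def principal_carrier[OF e] principal_carrier[OF f]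
    by (intro exI[of _ "\<lambda>x. v \<star> x"]) (auto simp: add_right assoc)
qed

subsection \<open>Multiplicities\<close>

text \<open>The order \<open>q\<close> of the residue ring \<open>e R e / e J e\<close>. The
  division is exact because the divisor counts a subgroup, see \<open>card_corner\<close>.\<close>

definition residue_card :: "'a \<Rightarrow> nat" where
  "residue_card e =
     card {x. e \<star> x = x \<and> x \<star> e = x} div card {x. e \<star> x = x \<and> x \<star> e = x \<and> x \<in> rad}"

lemma residue_card_opposite:
  "finite_ring.residue_card (\<lambda>x y. y \<star> x) one e = residue_card e"
  unfolding residue_card_def finite_ring.residue_card_def[OF opposite] rad_opposite
  by (simp add: conj_ac)

lemma card_corner_rad_pos: "card {x. e \<star> x = x \<and> x \<star> e = x \<and> x \<in> rad} > 0"
  by (rule card_Collect_pos[of _ 0]) simp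

text \<open>The lower bound \<open>2\<close> comes from the distinct cosets of \<open>e\<close> and
  \<open>0\<close>; it makes \<open>q ^ \<mu>\<close> injective in \<open>\<mu>\<close>.\<close>

lemma card_corner:
  "card {x. e \<star> x = x \<and> x \<star> e = x}
    = residue_card e * card {x. e \<star> x = x \<and> x \<star> e = x \<and> x \<in> rad}"
  and residue_card_ge: "prim e \<Longrightarrow> residue_card e \<ge> 2"
proof -
  let ?X = "{x. e \<star> x = x \<and> x \<star> e = x}" and ?K = "{x. e \<star> x = x \<and> x \<star> e = x \<and> x \<in> rad}"
  have c: "card ?X = card (coset rad ` ?X) * card ?K"
    by (rule card_subgroup_fibers)
      (auto simp: add_left add_right diff_left diff_right coset_eq_iff[OF right_ideal_rad])
  have q: "residue_card e = card (coset rad ` ?X)"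
    unfolding residue_card_def c using card_corner_rad_pos[of e] by (simp only: div_mult_self_is_m)
  show "card ?X = residue_card e * card ?K" unfolding q by (rule c)
  assume e: "prim e"
  have "coset rad e \<noteq> coset rad 0"
    using prim_notin_rad[OF e] by (simp add: coset_eq_iff[OF right_ideal_rad])
  then have "card {coset rad e, coset rad 0} = 2" by simp
  moreover have "card {coset rad e, coset rad 0} \<le> card (coset rad ` ?X)"
    by (rule card_mono) (use prim_idem[OF e] in auto)
  ultimately show "residue_card e \<ge> 2" unfolding q by simp
qed

section \<open>Peirce decomposition and counts symmetric in left and right\<close>

lemma complete_prim: "complete m e \<Longrightarrow> i \<in> {1..m} \<Longrightarrow> prim (e i)"
  by (simp add: complete_def)

lemma complete_select_left:
  assumes "complete m e" "i \<in> {1..m}" "\<And>j. j \<in> {1..m} \<Longrightarrow> e j \<star> h j = h j"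
  shows "e i \<star> (\<Sum>j\<in>{1..m}. h j) = h i"
proof -
  have "e i \<star> h j = (if j = i then h i else 0)" if "j \<in> {1..m}" for j
    using assms that unfolding complete_def by (metis assoc zero_left)
  then have "e i \<star> (\<Sum>j\<in>{1..m}. h j) = (\<Sum>j\<in>{1..m}. if j = i then h i else 0)"
    by (simp add: sum_right)
  then show ?thesis using assms(2) by simp
qed

lemma complete_select_right:
  assumes "complete m e" "i \<in> {1..m}" "\<And>j. j \<in> {1..m} \<Longrightarrow> h j \<star> e j = h j"
  shows "(\<Sum>j\<in>{1..m}. h j) \<star> e i = h i"
  using finite_ring.complete_select_left[OF opposite complete_opposite] assms by blast

text \<open>The map \<open>x \<mapsto> (x e\<^sub>i)\<close> splits \<open>N\<close> into the
  product of its parts \<open>N e\<^sub>i\<close>, with summation as inverse.\<close>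

lemma peirce:
  assumes c: "complete m e" and N: "right_ideal N"
  shows "card N = (\<Prod>i\<in>{1..m}. card {x \<in> N. x \<star> e i = x})"
proof -
  let ?I = "{1..m}"
  have "bij_betw (\<lambda>x. \<lambda>i\<in>?I. x \<star> e i) N (Pi\<^sub>E ?I (\<lambda>i. {x \<in> N. x \<star> e i = x}))"
  proof (rule bij_betw_byWitness[where f' = "\<lambda>h. \<Sum>i\<in>?I. h i"])
    show "\<forall>x\<in>N. (\<Sum>i\<in>?I. (\<lambda>i\<in>?I. x \<star> e i) i) = x"
      using complete_decomp_right[OF c] by simp
    show "\<forall>h\<in>Pi\<^sub>E ?I (\<lambda>i. {x \<in> N. x \<star> e i = x}). (\<lambda>i\<in>?I. (\<Sum>i\<in>?I. h i) \<star> e i) = h"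
    proof
      fix h assume h: "h \<in> Pi\<^sub>E ?I (\<lambda>i. {x \<in> N. x \<star> e i = x})"
      then have "(\<Sum>j\<in>?I. h j) \<star> e i = h i" if "i \<in> ?I" for i
        by (intro complete_select_right[OF c that]) (auto simp: PiE_iff)
      then show "(\<lambda>i\<in>?I. (\<Sum>i\<in>?I. h i) \<star> e i) = h"
        using h by (auto simp: PiE_iff extensional_def fun_eq_iff)
    qed
    show "(\<lambda>x. \<lambda>i\<in>?I. x \<star> e i) ` N \<subseteq> Pi\<^sub>E ?I (\<lambda>i. {x \<in> N. x \<star> e i = x})"
      using N complete_prim[OF c] by (auto simp: right_ideal_def assoc prim_idem)
    show "(\<lambda>h. \<Sum>i\<in>?I. h i) ` Pi\<^sub>E ?I (\<lambda>i. {x \<in> N. x \<star> e i = x}) \<subseteq> N"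
      by (auto intro!: right_ideal_sum[OF N] simp: PiE_iff)
  qed
  then show ?thesis
    by (simp add: bij_betw_same_card card_PiE)
qed

text \<open>Modulo \<open>J\<close> the corners \<open>a R b\<close> and \<open>b R a\<close> have
  the same size, written without division. For equivalent idempotents,
  \<open>x \<mapsto> v x v\<close> is a bijection of the corners preserving \<open>J\<close>.
  Otherwise both corners lie inside \<open>J\<close> by \<open>eqvI\<close>.\<close>

lemma corner_symmetric:
  assumes a: "prim a" and b: "prim b"
  shows "card {x. a \<star> x = x \<and> x \<star> b = x} * card {x. x \<star> a = x \<and> b \<star> x = x \<and> x \<in> rad}
    = card {x. x \<star> a = x \<and> b \<star> x = x} * card {x. a \<star> x = x \<and> x \<star> b = x \<and> x \<in> rad}"
proof (cases "eqv a b")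
  case True
  then obtain u v where uv: "u \<star> v = a" "v \<star> u = b" "a \<star> u = u" "u \<star> b = u" "b \<star> v = v" "v \<star> a = v"
    by (auto simp: eqv_def)
  have r: "u \<star> (v \<star> x) = a \<star> x" "v \<star> (u \<star> x) = b \<star> x" for x
    unfolding uv(1,2)[symmetric] by (simp_all add: assoc)
  have "bij_betw (\<lambda>x. v \<star> x \<star> v) {x. a \<star> x = x \<and> x \<star> b = x \<and> P x} {x. x \<star> a = x \<and> b \<star> x = x \<and> P x}"
    if "\<And>x. P x \<Longrightarrow> P (v \<star> (x \<star> v))" "\<And>x. P x \<Longrightarrow> P (u \<star> (x \<star> u))" for P
    by (rule bij_betw_byWitness[where f' = "\<lambda>x. u \<star> x \<star> u"])
      (auto simp: assoc r uv absorb_left that)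
  from bij_betw_same_card[OF this[of "\<lambda>x. True"]] bij_betw_same_card[OF this[of "\<lambda>x. x \<in> rad"]]
  show ?thesis by simp
next
  case False
  have "{x. a \<star> x = x \<and> x \<star> b = x} = {x. a \<star> x = x \<and> x \<star> b = x \<and> x \<in> rad}"
    using False eqvI[OF a b] by blast
  moreover have "{x. x \<star> a = x \<and> b \<star> x = x} = {x. x \<star> a = x \<and> b \<star> x = x \<and> x \<in> rad}"
    using False eqvI[OF b a] eqv_sym by blast
  ultimately show ?thesis by simp
qed

text \<open>The tops of \<open>a R\<close> and \<open>R a\<close> have equal size: the Peirce
  decompositions on the two sides cut them into corners that match factor by factor.\<close>

lemma top_card_symmetric:
  assumes c: "complete m e" and a: "prim a"
  shows "card {x. a \<star> x = x} * card {x. x \<star> a = x \<and> x \<in> rad}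
    = card {x. x \<star> a = x} * card {x. a \<star> x = x \<and> x \<in> rad}"
proof -
  interpret op: finite_ring "\<lambda>x y. y \<star> x" one by (rule opposite)
  note c' = complete_opposite[OF c]
  have 1: "right_ideal {x. a \<star> x = x}" "right_ideal {x. a \<star> x = x \<and> x \<in> rad}"
    by (auto simp: right_ideal_def add_right absorb_left)
  have 2: "op.right_ideal {x. x \<star> a = x}" "op.right_ideal {x. x \<star> a = x \<and> x \<in> rad}"
    by (auto simp: op.right_ideal_def add_left absorb_right)
  show ?thesis
    unfolding peirce[OF c 1(1)] peirce[OF c 1(2)] op.peirce[OF c' 2(1)] op.peirce[OF c' 2(2)]
      prod.distrib[symmetric]
    using corner_symmetric[OF a complete_prim[OF c]]
    by (intro prod.cong) (simp_all add: conj_ac)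
qed

lemma socle_kernel:
  assumes f: "prim f" and z: "z \<noteq> 0" "z \<star> f = z" "z \<in> socle" and y: "f \<star> y = y"
  shows "z \<star> y = 0 \<longleftrightarrow> y \<in> rad"
proof
  assume 0: "z \<star> y = 0"
  show "y \<in> rad"
  proof (rule ccontr)
    assume "y \<notin> rad"
    then obtain r where "y \<star> r = f" using prim_generated[OF f y] by metis
    then have "z = 0" using 0 z(2) by (metis assoc zero_left)
    then show False using z(1) by simp
  qed
qed (use z(3) in \<open>auto simp: socle_def\<close>)

lemma socle_image_card:
  assumes f: "prim f" and z: "z \<noteq> 0" "z \<star> f = z" "z \<in> socle"
    and X: "\<And>x. x \<in> X \<Longrightarrow> f \<star> x = x" "\<And>x y. x \<in> X \<Longrightarrow> y \<in> X \<Longrightarrow> x + y \<in> X"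
      "\<And>x y. x \<in> X \<Longrightarrow> y \<in> X \<Longrightarrow> x - y \<in> X"
  shows "card X = card ((\<star>) z ` X) * card {x \<in> X. x \<in> rad}"
proof (rule card_subgroup_fibers)
  fix x y assume "x \<in> X" "y \<in> X"
  then show "z \<star> x = z \<star> y \<longleftrightarrow> x - y \<in> {x \<in> X. x \<in> rad}"
    using socle_kernel[OF f z X(1), of "x - y"] X(3) by (simp add: diff_right)
qed (use X in auto)

text \<open>Left multiplication by \<open>z\<close> maps \<open>f R\<close> onto the socle of
  \<open>a R\<close> with kernel \<open>f R \<inter> J\<close>. Restricted to \<open>f R f\<close>
  it hits exactly the part of the socle fixed by \<open>f\<close>, and the kernel becomes
  \<open>f J f\<close>.\<close>

lemma socle_cards:
  assumes f: "prim f" and z: "z \<noteq> 0" "a \<star> z = z" "z \<star> f = z"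
    and eq: "{x. a \<star> x = x \<and> x \<in> socle} = {z \<star> r | r. True}"
  shows "card {x. a \<star> x = x \<and> x \<star> f = x \<and> x \<in> socle} = residue_card f"
    and "card {x. a \<star> x = x \<and> x \<in> socle} * card {x. f \<star> x = x \<and> x \<in> rad} = card {x. f \<star> x = x}"
proof -
  have "z \<star> one \<in> {x. a \<star> x = x \<and> x \<in> socle}" unfolding eq by blast
  then have zs: "z \<in> socle" by simp
  note c = socle_image_card[OF f z(1,3) zs]
  have ff: "f \<star> f = f" using f by (rule prim_idem)
  have zr: "z \<star> (f \<star> r) = z \<star> r" for r using z(3) by (simp flip: assoc)
  have "{x. a \<star> x = x \<and> x \<in> socle} = (\<star>) z ` {x. f \<star> x = x}"
  proof -
    have "z \<star> r \<in> (\<star>) z ` {x. f \<star> x = x}" for r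
      using zr[of r] prim_idem2[OF f] by (intro image_eqI[of _ _ "f \<star> r"]) auto
    then show ?thesis unfolding eq by auto
  qed
  with c[of "{x. f \<star> x = x}"]
  show "card {x. a \<star> x = x \<and> x \<in> socle} * card {x. f \<star> x = x \<and> x \<in> rad} = card {x. f \<star> x = x}"
    by (simp add: add_right diff_right)
  have "{x. a \<star> x = x \<and> x \<star> f = x \<and> x \<in> socle} = (\<star>) z ` {x. f \<star> x = x \<and> x \<star> f = x}"
  proof (intro equalityI subsetI)
    fix x assume x: "x \<in> {x. a \<star> x = x \<and> x \<star> f = x \<and> x \<in> socle}"
    then have "x \<in> {z \<star> r | r. True}" unfolding eq[symmetric] by blast
    then obtain r where r: "x = z \<star> r" by blast
    have "x = z \<star> (f \<star> r \<star> f)" using x r by (simp add: assoc zr)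
    then show "x \<in> (\<star>) z ` {x. f \<star> x = x \<and> x \<star> f = x}"
      by (rule image_eqI) (simp add: assoc ff prim_idem2[OF f])
  next
    fix x assume "x \<in> (\<star>) z ` {x. f \<star> x = x \<and> x \<star> f = x}"
    then obtain y where y: "x = z \<star> y" "y \<star> f = y" by blast
    then have "x \<in> {z \<star> r | r. True}" by blast
    then show "x \<in> {x. a \<star> x = x \<and> x \<star> f = x \<and> x \<in> socle}"
      unfolding eq[symmetric] using y by (simp add: assoc)
  qed
  moreover have "card {x. f \<star> x = x \<and> x \<star> f = x} =
      card ((\<star>) z ` {x. f \<star> x = x \<and> x \<star> f = x}) * card {x. f \<star> x = x \<and> x \<star> f = x \<and> x \<in> rad}"
    using c[of "{x. f \<star> x = x \<and> x \<star> f = x}"]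
    by (simp add: add_right diff_right add_left diff_left conj_assoc)
  ultimately show "card {x. a \<star> x = x \<and> x \<star> f = x \<and> x \<in> socle} = residue_card f"
    unfolding card_corner[of f]
    by (metis (no_types, lifting) mult_right_cancel_nat card_corner_rad_pos)
qed

section \<open>The multiplicity as the exponent of a cardinality\<close>

abbreviation cls :: "'a \<Rightarrow> 'a set" where "cls \<equiv> coset rad"

lemma cls_eq_iff: "cls x = cls y \<longleftrightarrow> x - y \<in> rad"
  by (rule coset_eq_iff[OF right_ideal_rad])

lemma cls_zero: "cls 0 = rad"
  by (rule coset_zero[OF right_ideal_rad])

lemma cls_eq_rad: "cls x = rad \<longleftrightarrow> x \<in> rad"
  using cls_eq_iff[of x 0] by (simp add: cls_zero)

lemma top_regular:
  assumes c: "complete m e"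
  shows "mod_carrier (top_mod regular) = range cls" "mod_zero (top_mod regular) = rad"
    "mod_add (top_mod regular) (cls x) (cls y) = cls (x + y)"
    "mod_act (top_mod regular) r (cls x) = cls (x \<star> r)"
proof -
  have T: "top_mod regular = quot_mod regular rad"
    unfolding top_mod_def rad_regular[OF c] ..
  have mc: "mod_coset regular rad = cls" by (auto simp: mod_coset_def coset_def)
  show "mod_carrier (top_mod regular) = range cls" "mod_zero (top_mod regular) = rad"
    "mod_add (top_mod regular) (cls x) (cls y) = cls (x + y)"
    "mod_act (top_mod regular) r (cls x) = cls (x \<star> r)"
    by (simp_all add: T quot_mod_def mc coset_add[OF right_ideal_rad] coset_act[OF right_ideal_rad])
qed

text \<open>The elements of \<open>S f\<close> correspond to the homomorphisms from
  \<open>f R\<close> to \<open>S\<close>. By Schur's lemma there is only the zero map unless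
  \<open>S\<close> is isomorphic to the top of \<open>f R\<close>, and then the homomorphisms form a
  copy of \<open>f R f / f J f\<close>.\<close>

lemma simple_part_card:
  assumes c: "complete m e" and f: "prim f"
    and S: "is_submod (top_mod regular) S" "simple_mod (submod_of (top_mod regular) S)"
  shows "card (mod_act (top_mod regular) f ` S) =
    (if mod_iso (submod_of (top_mod regular) S) (top_mod (principal f)) then residue_card f else 1)"
proof -
  let ?T = "top_mod regular"
  note T = top_regular[OF c]
  have S1: "S \<subseteq> range cls" "rad \<in> S" "\<And>x y. cls x \<in> S \<Longrightarrow> cls y \<in> S \<Longrightarrow> cls (x + y) \<in> S"
    "\<And>x r. cls x \<in> S \<Longrightarrow> cls (x \<star> r) \<in> S"
    using S(1) unfolding is_submod_def T(1,2) by (auto simp flip: T(3,4))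
  have ff: "f \<star> f = f" using f by (rule prim_idem)
  show ?thesis
  proof (cases "mod_iso (submod_of ?T S) (top_mod (principal f))")
    case True
    have "\<exists>g. covers f (submod_of ?T S) g"
      by (rule mod_iso_topD[OF f True]) (use S(1) in \<open>auto simp: is_submod_def\<close>)
    then obtain g where g: "covers f (submod_of ?T S) g" ..
    have img: "g ` {y. f \<star> y = y} = S"
      and ker: "\<And>y y'. f \<star> y = y \<Longrightarrow> f \<star> y' = y' \<Longrightarrow> g y = g y' \<longleftrightarrow> y - y' \<in> rad"
      and act: "\<And>y r. f \<star> y = y \<Longrightarrow> g (y \<star> r) = mod_act ?T r (g y)"
      using g by (auto simp: covers_def)
    let ?X = "{y. f \<star> y = y \<and> y \<star> f = y}"
    have "mod_act ?T f ` S = g ` ?X"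
    proof -
      have "mod_act ?T f (g y) \<in> g ` ?X" if "f \<star> y = y" for y
        unfolding act[OF that, symmetric]
        using that ff by (intro imageI) (simp add: assoc absorb_left)
      moreover have "g y \<in> mod_act ?T f ` g ` {y. f \<star> y = y}" if "f \<star> y = y" "y \<star> f = y" for y
        using act[OF that(1), of f] that by (simp add: image_iff) metis
      ultimately show ?thesis unfolding img[symmetric] by auto
    qed
    moreover have "card ?X = card (g ` ?X) * card {y. f \<star> y = y \<and> y \<star> f = y \<and> y \<in> rad}"
      by (rule card_subgroup_fibers) (auto simp: add_left add_right diff_left diff_right ker)
    ultimately have "card (mod_act ?T f ` S) = residue_card f"
      using card_corner_rad_pos[of f] unfolding card_corner[of f]
      by (metis (no_types, lifting) mult_right_cancel_nat)
    then show ?thesis using True by simp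
  next
    case False
    have "cls (x \<star> f) = rad" if x: "cls x \<in> S" for x
    proof (rule ccontr)
      assume nz: "cls (x \<star> f) \<noteq> rad"
      then have xf: "x \<star> f \<notin> rad" by (simp add: cls_eq_rad)
      \<comment> \<open>The image of \<open>f R\<close> under left multiplication by
        \<open>x\<close>. It is a nonzero submodule, hence all of \<open>S\<close>, which would make
        \<open>S\<close> a copy of the top of \<open>f R\<close>.\<close>
      let ?N = "(\<lambda>y. cls (x \<star> y)) ` {y. f \<star> y = y}"
      have "is_submod (submod_of ?T S) ?N"
        unfolding is_submod_def
      proof (intro conjI ballI allI; simp)
        show "?N \<subseteq> S" using S1(4)[OF x] by auto
        show "mod_zero ?T \<in> ?N"
          unfolding T by (rule image_eqI[of _ _ 0]) (simp_all add: cls_zero)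
        fix X Y assume "X \<in> ?N" "Y \<in> ?N"
        then obtain y y' where "X = cls (x \<star> y)" "f \<star> y = y" "Y = cls (x \<star> y')" "f \<star> y' = y'"
          by blast
        then show "mod_add ?T X Y \<in> ?N"
          by (intro image_eqI[of _ _ "y + y'"]) (simp_all add: T(3) add_right)
      next
        fix r X assume "X \<in> ?N"
        then obtain y where "X = cls (x \<star> y)" "f \<star> y = y" by blast
        then show "mod_act ?T r X \<in> ?N"
          by (intro image_eqI[of _ _ "y \<star> r"]) (simp_all add: T(4) assoc absorb_left)
      qed
      then have "?N = {rad} \<or> ?N = S" using S(2) by (simp add: simple_mod_def T(2))
      moreover have "cls (x \<star> f) \<in> ?N" using ff by blast
      ultimately have N: "?N = S" using nz by blast
      have "covers f (submod_of ?T S) (\<lambda>y. cls (x \<star> y))"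
        unfolding covers_def
      proof (intro conjI allI impI)
        show "?N = mod_carrier (submod_of ?T S)" using N by simp
        fix y y' assume y: "f \<star> y = y \<and> f \<star> y' = y'"
        show "cls (x \<star> (y + y')) = mod_add (submod_of ?T S) (cls (x \<star> y)) (cls (x \<star> y'))"
          by (simp add: T(3) add_right)
        show "cls (x \<star> y) = cls (x \<star> y') \<longleftrightarrow> y - y' \<in> rad"
        proof
          assume "cls (x \<star> y) = cls (x \<star> y')"
          then have 0: "x \<star> (y - y') \<in> rad" by (simp add: cls_eq_iff diff_right)
          show "y - y' \<in> rad"
          proof (rule ccontr)
            assume "y - y' \<notin> rad"
            then obtain r where "(y - y') \<star> r = f"
              using prim_generated[OF f, of "y - y'"] y by (metis diff_right)
            then have "x \<star> f \<in> rad" using rad_right[OF 0, of r] by (simp add: assoc)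
            then show False using xf by simp
          qed
        qed (simp add: cls_eq_iff flip: diff_right)
      qed (simp add: T(4) assoc)
      then show False using False mod_iso_topI[OF f] by blast
    qed
    then have "mod_act ?T f ` S = {rad}"
      using S1(1,2) T(4)[of f] by (auto simp: image_iff) (metis cls_zero zero_left)+
    then show ?thesis using False by simp
  qed
qed

text \<open>Right multiplication by \<open>f\<close> is additive and preserves every summand, so
  through the summation map it acts on tuples component by component, and the size of
  \<open>(R/J) f\<close> is the product of the sizes of the \<open>S f\<close>.\<close>

lemma decomposition_card:
  assumes c: "complete m e" and f: "prim f" and Ss: "simple_decomposition (top_mod regular) Ss"
  shows "residue_card f ^ length (filter (\<lambda>S. mod_iso (submod_of (top_mod regular) S) (top_mod (principal f))) Ss)
    * card {x. x \<star> f = x \<and> x \<in> rad} = card {x. x \<star> f = x}"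
proof -
  let ?T = "top_mod regular" 
  let ?E = "mod_act ?T f" and ?F = "\<lambda>xs. foldr (mod_add ?T) xs (mod_zero ?T)"
  note T = top_regular[OF c]
  have ff: "f \<star> f = f" using f by (rule prim_idem)
  have S: "is_submod ?T S" "simple_mod (submod_of ?T S)" if "S \<in> set Ss" for S
    using Ss that by (auto simp: simple_decomposition_def)
  have bij: "bij_betw ?F (listset Ss) (range cls)"
    using Ss unfolding simple_decomposition_def T(1) by blast
  have F: "?F xs \<in> range cls \<and> ?E (?F xs) = ?F (map ?E xs)" if "set xs \<subseteq> range cls" for xs
    using that
  proof (induction xs)
    case Nil
    show ?case using T(4)[of f 0] by (auto simp: T(2) cls_zero intro: range_eqI[of _ _ 0])
  next
    case (Cons X xs)
    then obtain x y where xy: "X = cls x" "?F xs = cls y" by auto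
    have "?E (mod_add ?T X (?F xs)) = mod_add ?T (?E X) (?E (?F xs))"
      unfolding xy T(3,4) by (simp add: add_left)
    moreover have "mod_add ?T X (?F xs) \<in> range cls" unfolding xy T(3) by simp
    ultimately show ?case using Cons by simp
  qed
  have sub: "set xs \<subseteq> range cls" if "xs \<in> listset Ss" for xs
  proof -
    have "set xs \<subseteq> range cls" if "xs \<in> listset Rs" "\<forall>S\<in>set Rs. S \<subseteq> range cls"
      for xs and Rs :: "'a set set list"
      using that by (induction Rs arbitrary: xs) (force simp: set_Cons_def)+
    then show ?thesis using that S(1) by (simp add: is_submod_def T(1))
  qed
  \<comment> \<open>Summation is injective only on tuples from the summands, so the multiplied
    tuples must stay among these.\<close>
  have subE: "map ?E ` listset Ss \<subseteq> listset Ss"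
  proof -
    have "map ?E xs \<in> listset Rs" if "xs \<in> listset Rs" "set Rs \<subseteq> set Ss" for xs Rs
      using that S(1) by (induction Rs arbitrary: xs) (auto simp: set_Cons_def is_submod_def)
    then show ?thesis by blast
  qed
  have "?E ` range cls = ?E ` ?F ` listset Ss" using bij by (simp add: bij_betw_def)
  also have "\<dots> = ?F ` map ?E ` listset Ss" using F sub by (auto simp: image_iff)
  finally have "card (?E ` range cls) = card (?F ` map ?E ` listset Ss)" by simp
  also have "\<dots> = card (map ?E ` listset Ss)"
    using bij subE by (intro card_image) (auto simp: bij_betw_def intro: inj_on_subset)
  also have "\<dots> = prod_list (map card (map ((`) ?E) Ss))"
    unfolding listset_map_image[symmetric] by (intro conjunct2[OF card_listset]) simp
  also have "\<dots> = residue_card f ^ length (filter (\<lambda>S. mod_iso (submod_of ?T S) (top_mod (principal f))) Ss)"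
    using simple_part_card[OF c f S] by (induction Ss) auto
  finally have 1: "card (?E ` range cls) = \<dots>" .
  have "?E ` range cls = cls ` {x. x \<star> f = x}"
    by (auto simp: T(4) image_image image_iff ff assoc) (metis ff assoc)+
  moreover have "card {x. x \<star> f = x} = card (cls ` {x. x \<star> f = x}) * card {x. x \<star> f = x \<and> x \<in> rad}"
    by (rule card_subgroup_fibers) (auto simp: add_left diff_left cls_eq_iff)
  ultimately show ?thesis unfolding 1[symmetric] by simp
qed

text \<open>The images of the \<open>e\<^sub>i R\<close> in \<open>R/J\<close> serve as summands.
  Existence is what gives the definite description in \<open>mod_multiplicity\<close> a
  value.\<close>

lemma decomposition_exists:
  assumes c: "complete m e"
  shows "\<exists>Ss. simple_decomposition (top_mod regular) Ss"
proof -
  let ?T = "top_mod regular"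
  define js where "js = [1..<Suc m]"
  have js: "distinct js" "set js = {1..m}" by (auto simp: js_def)
  have sl: "sum_list (map x js) = (\<Sum>i\<in>{1..m}. x i)" for x :: "nat \<Rightarrow> 'a"
    by (simp add: sum_list_distinct_conv_sum_set js)
  let ?S = "\<lambda>i. cls ` {x. e i \<star> x = x}"
  let ?F = "\<lambda>xs. foldr (mod_add ?T) xs (mod_zero ?T)"
  note T = top_regular[OF c]
  have "is_submod ?T (?S i) \<and> simple_mod (submod_of ?T (?S i))" if i: "i \<in> {1..m}" for i
  proof
    have p: "prim (e i)" and ei: "e i \<star> e i = e i"
      using complete_prim[OF c i] prim_idem by auto
    show "is_submod ?T (?S i)"
      unfolding is_submod_def T(1,2)
    proof (intro conjI ballI allI)
      show "rad \<in> ?S i" by (rule image_eqI[of _ _ 0]) (simp_all add: cls_zero)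
      fix X Y assume "X \<in> ?S i" "Y \<in> ?S i"
      then obtain x y where "X = cls x" "Y = cls y" "e i \<star> x = x" "e i \<star> y = y" by blast
      then show "mod_add ?T X Y \<in> ?S i"
        by (intro image_eqI[of _ _ "x + y"]) (simp_all add: T(3) add_right)
    next
      fix r X assume "X \<in> ?S i"
      then obtain x where "X = cls x" "e i \<star> x = x" by blast
      then show "mod_act ?T r X \<in> ?S i"
        by (intro image_eqI[of _ _ "x \<star> r"]) (simp_all add: T(4) absorb_left)
    qed auto
    show "simple_mod (submod_of ?T (?S i))"
      unfolding simple_mod_def
    proof (intro conjI allI impI; simp add: T(2))
      have "cls (e i) \<in> ?S i" using ei by blast
      moreover have "cls (e i) \<noteq> rad" using prim_notin_rad[OF p] by (simp add: cls_eq_rad)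
      ultimately show "?S i \<noteq> {rad}" by blast
      fix N assume "is_submod (submod_of ?T (?S i)) N"
      then have N: "N \<subseteq> ?S i" "rad \<in> N" "\<And>x r. cls x \<in> N \<Longrightarrow> cls (x \<star> r) \<in> N"
        unfolding is_submod_def by (auto simp: T(2) simp flip: T(4))
      show "N = {rad} \<or> N = ?S i"
      proof (cases "N \<subseteq> {rad}")
        case False
        then obtain x where x: "cls x \<in> N" "e i \<star> x = x" "cls x \<noteq> rad" using N(1) by blast
        then obtain r where "x \<star> r = e i" using prim_generated[OF p x(2)] cls_eq_rad by metis
        then have "cls (e i) \<in> N" using N(3)[OF x(1), of r] by simp
        then have "?S i \<subseteq> N" using N(3) by (metis (mono_tags, lifting) image_subsetI mem_Collect_eq)
        then show ?thesis using N(1) by blast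
      qed (use N(2) in auto)
    qed
  qed
  moreover have "bij_betw ?F (listset (map ?S js)) (range cls)"
  proof -
    have F: "?F (map (\<lambda>i. cls (x i)) ks) = cls (sum_list (map x ks))" for x and ks :: "nat list"
      by (induction ks) (simp_all add: T cls_zero)
    have L: "\<exists>x. xs = map (\<lambda>i. cls (x i)) js \<and> (\<forall>i\<in>{1..m}. e i \<star> x i = x i)"
      if xs: "xs \<in> listset (map ?S js)" for xs
    proof -
      obtain h where h: "xs = map h js" "\<forall>i\<in>{1..m}. h i \<in> ?S i"
        using in_listset_map[OF js(1), of xs ?S] xs by (auto simp: js(2))
      then have "\<forall>i\<in>{1..m}. \<exists>x. h i = cls x \<and> e i \<star> x = x" by blast
      then obtain x where "\<forall>i\<in>{1..m}. h i = cls (x i) \<and> e i \<star> x i = x i" by metis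
      then show ?thesis using h(1) by (intro exI[of _ x]) (simp add: js(2))
    qed
    have "inj_on ?F (listset (map ?S js))"
    proof (rule inj_onI)
      fix xs ys assume xy: "xs \<in> listset (map ?S js)" "ys \<in> listset (map ?S js)" "?F xs = ?F ys"
      obtain x where x: "xs = map (\<lambda>i. cls (x i)) js" "\<forall>i\<in>{1..m}. e i \<star> x i = x i"
        using L[OF xy(1)] by blast
      obtain y where y: "ys = map (\<lambda>i. cls (y i)) js" "\<forall>i\<in>{1..m}. e i \<star> y i = y i"
        using L[OF xy(2)] by blast
      have r: "(\<Sum>i\<in>{1..m}. x i - y i) \<in> rad"
        using xy(3) unfolding x(1) y(1) F sl by (simp add: cls_eq_iff sum_subtractf)
      have "x i - y i \<in> rad" if i: "i \<in> {1..m}" for i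
        using complete_select_left[OF c i, of "\<lambda>i. x i - y i"] x(2) y(2) rad_left[OF r, of "e i"]
        by (simp add: diff_right)
      then show "xs = ys" unfolding x(1) y(1) by (simp add: cls_eq_iff js(2))
    qed
    moreover have "?F ` listset (map ?S js) = range cls"
    proof
      show "?F ` listset (map ?S js) \<subseteq> range cls" using L F by force
      have "cls x \<in> ?F ` listset (map ?S js)" for x
      proof (rule image_eqI)
        show "cls x = ?F (map (\<lambda>i. cls (e i \<star> x)) js)"
          unfolding F sl using complete_decomp_left[OF c, of x] by simp
        show "map (\<lambda>i. cls (e i \<star> x)) js \<in> listset (map ?S js)"
          using prim_idem2[OF complete_prim[OF c]] by (subst in_listset_map) (auto simp: js)
      qed
      then show "range cls \<subseteq> ?F ` listset (map ?S js)" by blast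
    qed
    ultimately show ?thesis by (simp add: bij_betw_def)
  qed
  ultimately have "simple_decomposition ?T (map ?S js)"
    unfolding simple_decomposition_def T(1) by (auto simp: js(2))
  then show ?thesis ..
qed

text \<open>Every decomposition gives the same value of \<open>q ^ \<mu>\<close>, and
  \<open>q \<ge> 2\<close>, so the number described by \<open>mod_multiplicity\<close> is
  unique.\<close>

lemma multiplicity_card:
  assumes c: "complete m e" and f: "prim f"
  shows "residue_card f ^ mod_multiplicity (top_mod regular) (top_mod (principal f))
    * card {x. x \<star> f = x \<and> x \<in> rad} = card {x. x \<star> f = x}"
proof -
  let ?P = "\<lambda>\<mu>. \<exists>Ss. simple_decomposition (top_mod regular) Ss \<and>
     \<mu> = length (filter (\<lambda>S. mod_iso (submod_of (top_mod regular) S) (top_mod (principal f))) Ss)"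
  have pos: "card {x. x \<star> f = x \<and> x \<in> rad} > 0"
    by (rule card_Collect_pos[of _ 0]) simp
  have P: "residue_card f ^ \<mu> * card {x. x \<star> f = x \<and> x \<in> rad} = card {x. x \<star> f = x}" if "?P \<mu>" for \<mu>
    using that decomposition_card[OF c f] by blast
  have uniq: "\<mu> = \<nu>" if "?P \<mu>" "?P \<nu>" for \<mu> \<nu>
  proof -
    have "residue_card f ^ \<mu> = residue_card f ^ \<nu>"
      by (rule mult_right_cancel_nat[OF _ pos]) (simp only: P[OF that(1)] P[OF that(2)])
    then show ?thesis using residue_card_ge[OF f] by simp
  qed
  obtain \<mu> where \<mu>: "?P \<mu>" using decomposition_exists[OF c] by blast
  have "(THE \<mu>. ?P \<mu>) = \<mu>" by (rule the_equality, rule \<mu>, rule uniq[OF _ \<mu>])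
  then show ?thesis unfolding mod_multiplicity_def using P[OF \<mu>] by simp
qed

subsection \<open>Nakayama permutations and annihilators\<close>

definition left_socle :: "'a set" where
  "left_socle = {x. \<forall>j\<in>rad. j \<star> x = 0}"

lemma socle_opposite: "finite_ring.socle (\<lambda>x y. y \<star> x) one = left_socle"
  unfolding left_socle_def finite_ring.socle_def[OF opposite] rad_opposite ..

lemma left_socle_opposite: "finite_ring.left_socle (\<lambda>x y. y \<star> x) one = socle"
  unfolding socle_def finite_ring.left_socle_def[OF opposite] rad_opposite ..

lemma left_socle_right: "x \<in> left_socle \<Longrightarrow> x \<star> r \<in> left_socle"
  by (simp add: left_socle_def flip: assoc)

lemma left_socle_left: "x \<in> left_socle \<Longrightarrow> r \<star> x \<in> left_socle"
  by (simp add: left_socle_def flip: assoc)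

text \<open>Among the nonzero multiples of \<open>z\<close> take one, \<open>y\<close>, with
  \<open>R y\<close> of least size. If \<open>j y \<noteq> 0\<close> for some
  \<open>j \<in> J\<close>, then \<open>R j y = R y\<close>, so \<open>y = r j y\<close> and hence
  \<open>y = 0\<close>.\<close>

lemma left_socle_meets:
  assumes "z \<noteq> 0" shows "\<exists>t. t \<star> z \<noteq> 0 \<and> t \<star> z \<in> left_socle"
proof -
  define n where "n y = card {r \<star> y | r. True}" for y
  obtain t where t: "t \<star> z \<noteq> 0" "\<And>s. s \<star> z \<noteq> 0 \<Longrightarrow> n (t \<star> z) \<le> n (s \<star> z)"
    using ex_has_least_nat[of "\<lambda>t. t \<star> z \<noteq> 0" one "\<lambda>t. n (t \<star> z)"] assms by auto
  let ?y = "t \<star> z"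
  have "j \<star> ?y = 0" if j: "j \<in> rad" for j
  proof (rule ccontr)
    assume nz: "j \<star> ?y \<noteq> 0"
    have sub: "{r \<star> (j \<star> ?y) | r. True} \<subseteq> {r \<star> ?y | r. True}" by (auto simp flip: assoc)
    moreover have "n ?y \<le> n (j \<star> ?y)" using t(2)[of "j \<star> t"] nz by (simp add: assoc)
    ultimately have "{r \<star> (j \<star> ?y) | r. True} = {r \<star> ?y | r. True}"
      unfolding n_def by (intro card_seteq) auto
    moreover have "one \<star> ?y \<in> {r \<star> ?y | r. True}" by blast
    ultimately have "?y \<in> {r \<star> (j \<star> ?y) | r. True}" by simp
    then obtain r where r: "?y = r \<star> (j \<star> ?y)" by blast
    then have "(r \<star> j) \<star> ?y = ?y" by (simp only: assoc)
    then show False using rad_fix_left[OF rad_left[OF j]] t(1) by blast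
  qed
  then show ?thesis using t(1) by (auto simp: left_socle_def)
qed

definition ordered :: "nat \<Rightarrow> nat \<Rightarrow> (nat \<Rightarrow> 'a) \<Rightarrow> bool" where
  "ordered m k e \<longleftrightarrow> complete m e \<and> k \<le> m \<and>
     (\<forall>i\<in>{1..k}. \<forall>j\<in>{1..k}. i \<noteq> j \<longrightarrow> \<not> eqv (e i) (e j)) \<and>
     (\<forall>i\<in>{k<..m}. \<exists>j\<in>{1..k}. eqv (e i) (e j))"

lemma ordered_opposite:
  "ordered m k e \<Longrightarrow> finite_ring.ordered (\<lambda>x y. y \<star> x) one m k e"
  unfolding ordered_def finite_ring.ordered_def[OF opposite] eqv_opposite
  using complete_opposite by blast

lemma ordered_complete: "ordered m k e \<Longrightarrow> complete m e"
  by (simp add: ordered_def)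

lemma ordered_prim: "ordered m k e \<Longrightarrow> i \<in> {1..k} \<Longrightarrow> prim (e i)"
  by (rule complete_prim[of m]) (auto simp: ordered_def)

lemma ordered_rep:
  assumes "ordered m k e" "l \<in> {1..m}" obtains j where "j \<in> {1..k}" "eqv (e l) (e j)"
proof (cases "l \<le> k")
  case True
  then show thesis
    using that[of l] assms eqv_refl prim_idem[OF ordered_prim[OF assms(1), of l]] by auto
next
  case False
  then show thesis using that assms unfolding ordered_def by (metis greaterThanAtMost_iff atLeastAtMost_iff not_le)
qed

text \<open>The element \<open>z\<close> encodes an isomorphism from the top of \<open>b R\<close> to the socle of \<open>a R\<close>.\<close>

definition socle_gen :: "'a \<Rightarrow> 'a \<Rightarrow> 'a \<Rightarrow> bool" where
  "socle_gen a b z \<longleftrightarrow> z \<noteq> 0 \<and> a \<star> z = z \<and> z \<star> b = z \<and>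
     {x. a \<star> x = x \<and> x \<in> socle} = {z \<star> r | r. True}"

definition left_socle_gen :: "'a \<Rightarrow> 'a \<Rightarrow> 'a \<Rightarrow> bool" where
  "left_socle_gen a b z \<longleftrightarrow> z \<noteq> 0 \<and> a \<star> z = z \<and> z \<star> b = z \<and>
     {x. x \<star> b = x \<and> x \<in> left_socle} = {r \<star> z | r. True}"

lemma socle_gen_opposite:
  "finite_ring.socle_gen (\<lambda>x y. y \<star> x) one a b z \<longleftrightarrow> left_socle_gen b a z"
  "finite_ring.left_socle_gen (\<lambda>x y. y \<star> x) one a b z \<longleftrightarrow> socle_gen b a z"
  unfolding finite_ring.socle_gen_def[OF opposite] left_socle_gen_def socle_opposite
    finite_ring.left_socle_gen_def[OF opposite] socle_gen_def left_socle_opposite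
  by auto

text \<open>Some nonzero \<open>t z\<close> lies in the left socle, hence in \<open>R w\<close>. As
  \<open>R w\<close> is minimal, \<open>w\<close> is in turn a multiple of \<open>t z\<close>, and
  so \<open>w\<close> is in the right socle together with \<open>z\<close>. Thus the part
  \<open>R w\<close> of the left socle fixed by \<open>e\<^sub>j\<close> lies in the right socle for
  \<open>j \<le> k\<close>; equivalence of idempotents carries this to all
  \<open>l \<le> m\<close>.\<close>

lemma left_socle_subset_socle:
  assumes o: "ordered m k e"
    and N: "\<And>j. j \<in> {1..k} \<Longrightarrow> \<exists>i\<in>{1..k}. (\<exists>z. socle_gen (e i) (e j) z) \<and> (\<exists>w. left_socle_gen (e i) (e j) w)"
  shows "left_socle \<subseteq> socle"
proof
  interpret op: finite_ring "\<lambda>x y. y \<star> x" one by (rule opposite)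
  fix x assume x: "x \<in> left_socle"
  have "x \<star> e l \<in> socle" if l: "l \<in> {1..m}" for l
  proof -
    obtain j where j: "j \<in> {1..k}" "eqv (e l) (e j)" using ordered_rep[OF o l] .
    obtain u v where uv: "u \<star> v = e l" "u \<star> e j = u" using j(2) unfolding eqv_def by blast
    obtain i z w where i: "i \<in> {1..k}" and z: "socle_gen (e i) (e j) z" and w: "left_socle_gen (e i) (e j) w"
      using N[OF j(1)] by blast
    have "z \<star> one \<in> {z \<star> r | r. True}" by blast
    then have zs: "z \<in> socle" using z unfolding socle_gen_def by auto
    have "one \<star> w \<in> {r \<star> w | r. True}" by blast
    then have ws: "w \<in> left_socle" using w unfolding left_socle_gen_def by auto
    obtain t where t: "t \<star> z \<noteq> 0" "t \<star> z \<in> left_socle"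
      using left_socle_meets[of z] z by (auto simp: socle_gen_def)
    moreover have "(t \<star> z) \<star> e j = t \<star> z" using z by (simp add: socle_gen_def assoc)
    ultimately have "t \<star> z \<in> {r \<star> w | r. True}" using w unfolding left_socle_gen_def by blast
    then obtain s where s: "t \<star> z = s \<star> w" by blast
    have "prim (e i)" by (rule ordered_prim[OF o i])
    then have "\<exists>s'. s' \<star> (s \<star> w) = w"
      using op.socle_simple[of "e i" w s] w ws t(1) s
      by (simp add: prim_opposite socle_opposite left_socle_gen_def)
    then obtain s' where "s' \<star> (t \<star> z) = w" using s by auto
    then have "w \<in> socle" using socle_left[OF zs, of "s' \<star> t"] by (simp add: assoc)
    moreover have "(x \<star> u) \<star> e j = x \<star> u" using uv(2) by (simp add: assoc)
    then have "x \<star> u \<in> {r \<star> w | r. True}"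
      using left_socle_right[OF x, of u] w unfolding left_socle_gen_def by blast
    then obtain r where "x \<star> u = r \<star> w" by blast
    ultimately have "x \<star> u \<in> socle" using socle_left by simp
    then have "x \<star> u \<star> v \<in> socle" using right_ideal_socle unfolding right_ideal_def by blast
    then show ?thesis using uv(1) by (simp add: assoc)
  qed
  then have "(\<Sum>l\<in>{1..m}. x \<star> e l) \<in> socle" by (rule right_ideal_sum[OF right_ideal_socle])
  then show "x \<in> socle" using complete_decomp_right[OF ordered_complete[OF o], of x] by simp
qed

definition nakayama :: "nat \<Rightarrow> (nat \<Rightarrow> 'a) \<Rightarrow> (nat \<Rightarrow> nat) \<Rightarrow> bool" where
  "nakayama k e \<pi> \<longleftrightarrow> \<pi> permutes {1..k} \<and>
     (\<forall>i\<in>{1..k}. (\<exists>z. socle_gen (e i) (e (\<pi> i)) z) \<and> (\<exists>w. left_socle_gen (e i) (e (\<pi> i)) w))"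

lemma nakayama_socle_eq:
  assumes o: "ordered m k e" and n: "nakayama k e \<pi>"
  shows "left_socle = socle"
proof
  show "left_socle \<subseteq> socle"
  proof (rule left_socle_subset_socle[OF o])
    fix j assume "j \<in> {1..k}"
    moreover have "\<pi> ` {1..k} = {1..k}" using n by (auto simp: nakayama_def permutes_image)
    ultimately obtain i where "i \<in> {1..k}" "\<pi> i = j" by (metis imageE)
    then show "\<exists>i\<in>{1..k}. (\<exists>z. socle_gen (e i) (e j) z) \<and> (\<exists>w. left_socle_gen (e i) (e j) w)"
      using n unfolding nakayama_def by blast
  qed
  \<comment> \<open>In the opposite ring the other index is quantified: the first inclusion used
    that \<open>\<pi>\<close> is onto, this one uses that it maps \<open>{1..k}\<close> into
    itself.\<close>
  have "\<exists>j\<in>{1..k}. (\<exists>w. left_socle_gen (e i) (e j) w) \<and> (\<exists>z. socle_gen (e i) (e j) z)"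
    if "i \<in> {1..k}" for i
    using n that permutes_in_image[of \<pi> "{1..k}" i] unfolding nakayama_def by blast
  then show "socle \<subseteq> left_socle"
    using finite_ring.left_socle_subset_socle[OF opposite ordered_opposite[OF o]]
    unfolding socle_gen_opposite socle_opposite left_socle_opposite by blast
qed

section \<open>Sizes of socle components in a Frobenius ring\<close>

definition multiplicity :: "'a \<Rightarrow> nat" where
  "multiplicity f = mod_multiplicity (top_mod regular) (top_mod (principal f))"

text \<open>A socle generator measures \<open>b R\<close>, whereas \<open>multiplicity_card\<close>
  measures \<open>R b\<close>; \<open>top_card_symmetric\<close> passes from one side to the
  other.\<close>

lemma socle_gen_power:
  assumes c: "complete m e" and b: "prim b" and z: "socle_gen a b z"
  shows "card {x. a \<star> x = x \<and> x \<in> socle} = residue_card b ^ multiplicity b"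
proof -
  let ?S = "card {x. a \<star> x = x \<and> x \<in> socle}"
  let ?B = "card {x. b \<star> x = x \<and> x \<in> rad}" and ?D = "card {x. x \<star> b = x \<and> x \<in> rad}"
  have pos: "?B * ?D > 0"
    by (intro mult_pos_pos card_Collect_pos[of _ 0]) simp_all
  have "?S * ?B = card {x. b \<star> x = x}"
    using socle_cards(2)[OF b] z unfolding socle_gen_def by blast
  moreover have "residue_card b ^ multiplicity b * ?D = card {x. x \<star> b = x}"
    unfolding multiplicity_def by (rule multiplicity_card[OF c b])
  ultimately have "?S * ?B * ?D = residue_card b ^ multiplicity b * ?D * ?B"
    using top_card_symmetric[OF c b] by (simp only:)
  then have "?S * (?B * ?D) = residue_card b ^ multiplicity b * (?B * ?D)"
    by (simp only: ac_simps)
  then show ?thesis using pos by (rule mult_right_cancel_nat)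
qed

lemma socle_gen_residue:
  assumes "left_socle = socle" "prim a" "prim b" "socle_gen a b z" "left_socle_gen a b w"
  shows "residue_card a = residue_card b"
proof -
  interpret op: finite_ring "\<lambda>x y. y \<star> x" one by (rule opposite)
  have "card {x. a \<star> x = x \<and> x \<star> b = x \<and> x \<in> socle} = residue_card b"
    using socle_cards(1)[OF assms(3)] assms(4) unfolding socle_gen_def by blast
  moreover have "card {x. x \<star> b = x \<and> a \<star> x = x \<and> x \<in> socle} = residue_card a"
    using op.socle_cards(1)[of a w b] assms unfolding left_socle_gen_def
    by (simp add: prim_opposite socle_opposite residue_card_opposite)
  ultimately show ?thesis by (simp add: conj_commute conj_left_commute)
qed

text \<open>The count yields the power \<open>q ^ \<mu>\<close> belonging to \<open>\<pi> i\<close>.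
  Equality of residue cardinalities and of multiplicities turns it into the power belonging to
  \<open>i\<close>, which is the size of the top of \<open>R e\<^sub>i\<close>.\<close>

lemma frobenius_socle_card:
  assumes o: "ordered m k e" and n: "nakayama k e \<pi>" and i: "i \<in> {1..k}"
    and \<mu>: "multiplicity (e i) = multiplicity (e (\<pi> i))"
  shows "card {x. e i \<star> x = x \<and> x \<in> left_socle} * card {x. x \<star> e i = x \<and> x \<in> rad}
    = card {x. x \<star> e i = x}"
proof -
  note c = ordered_complete[OF o]
  have pi: "\<pi> i \<in> {1..k}" using n i unfolding nakayama_def by (metis permutes_in_image)
  note pr = ordered_prim[OF o i] ordered_prim[OF o pi]
  obtain z w where zw: "socle_gen (e i) (e (\<pi> i)) z" "left_socle_gen (e i) (e (\<pi> i)) w"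
    using n i unfolding nakayama_def by blast
  have s: "left_socle = socle" by (rule nakayama_socle_eq[OF o n])
  have "card {x. e i \<star> x = x \<and> x \<in> left_socle} = residue_card (e i) ^ multiplicity (e i)"
    unfolding s socle_gen_power[OF c pr(2) zw(1)] socle_gen_residue[OF s pr zw] \<mu> ..
  then show ?thesis
    unfolding multiplicity_def by (simp only: multiplicity_card[OF c pr(1)])
qed

section \<open>Annihilators of maximal left ideals\<close>

abbreviation left_ideal :: "'a set \<Rightarrow> bool" where
  "left_ideal \<equiv> finite_ring.right_ideal (\<lambda>x y. y \<star> x)"

lemmas left_ideal_def = finite_ring.right_ideal_def[OF opposite]

text \<open>The last condition on \<open>A\<close> is maximality. With
  \<open>v \<in> e\<^sub>i R\<close> outside \<open>A\<close> there are two injections. Left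
  multiplication by \<open>v\<close> embeds the annihilator of \<open>A\<close> into
  \<open>e\<^sub>i S\<close>, because some \<open>t v\<close> is \<open>one\<close> modulo
  \<open>A\<close> and so acts as the identity there. The map \<open>r \<mapsto> r v\<close> embeds
  the top of \<open>R e\<^sub>i\<close> into \<open>R/A\<close>.\<close>

lemma maximal_left_ideal_card:
  assumes o: "ordered m k e"
    and S: "\<And>i. i \<in> {1..k} \<Longrightarrow>
      card {x. e i \<star> x = x \<and> x \<in> left_socle} * card {x. x \<star> e i = x \<and> x \<in> rad} = card {x. x \<star> e i = x}"
    and A: "left_ideal A" "one \<notin> A" "\<And>r. r \<notin> A \<Longrightarrow> \<exists>s. one - s \<star> r \<in> A"
  shows "card A * card {x. \<forall>a\<in>A. a \<star> x = 0} \<le> card (UNIV :: 'a set)"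
proof -
  note c = ordered_complete[OF o]
  have A0: "0 \<in> A" and Aadd: "\<And>x y. x \<in> A \<Longrightarrow> y \<in> A \<Longrightarrow> x + y \<in> A"
    and Amul: "\<And>x r. x \<in> A \<Longrightarrow> r \<star> x \<in> A"
    using A(1) by (auto simp: left_ideal_def)
  have Adiff: "\<And>x y. x \<in> A \<Longrightarrow> y \<in> A \<Longrightarrow> x - y \<in> A"
    using finite_ring.right_ideal_diff[OF opposite A(1)] by blast
  have radA: "j \<in> A" if j: "j \<in> rad" for j
  proof (rule ccontr)
    assume "j \<notin> A"
    then obtain s where s: "one - s \<star> j \<in> A" using A(3) by blast
    have "unit (one - s \<star> j \<star> one)" using j unfolding rad_def by blast
    then obtain v where "v \<star> (one - s \<star> j) = one" by (auto simp: unit_def)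
    then show False using Amul[OF s, of v] A(2) by simp
  qed
  \<comment> \<open>If \<open>A\<close> contained every \<open>e\<^sub>j R\<close> with
    \<open>j \<le> k\<close>, it would contain each \<open>e\<^sub>l = u v\<close> with
    \<open>v \<in> e\<^sub>j R\<close>, and so their sum \<open>one\<close>.\<close>
  have "\<exists>i\<in>{1..k}. \<exists>v. e i \<star> v = v \<and> v \<notin> A"
  proof (rule ccontr)
    assume no: "\<not> ?thesis"
    have "e l \<in> A" if l: "l \<in> {1..m}" for l
    proof -
      obtain j where j: "j \<in> {1..k}" "eqv (e l) (e j)" using ordered_rep[OF o l] .
      obtain u v where uv: "u \<star> v = e l" "e j \<star> v = v" using j(2) unfolding eqv_def by blast
      have "v \<in> A" using no j(1) uv(2) by blast
      then show ?thesis using Amul[of v u] uv(1) by simp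
    qed
    then have "(\<Sum>l\<in>{1..m}. e l) \<in> A"
      by (rule finite_ring.right_ideal_sum[OF opposite A(1)])
    then show False using A(2) c by (simp add: complete_def)
  qed
  then obtain i v where i: "i \<in> {1..k}" and v: "e i \<star> v = v" "v \<notin> A" by blast
  obtain t where t: "one - t \<star> v \<in> A" using A(3)[OF v(2)] by blast
  have p: "prim (e i)" by (rule ordered_prim[OF o i])
  let ?Ann = "{x. \<forall>a\<in>A. a \<star> x = 0}" and ?S = "{x. e i \<star> x = x \<and> x \<in> left_socle}"
  let ?R = "{x. x \<star> e i = x}" and ?RJ = "{x. x \<star> e i = x \<and> x \<in> rad}"
  have "card ?Ann \<le> card ?S"
  proof (rule card_inj_on_le)
    show "inj_on ((\<star>) v) ?Ann"
    proof (rule inj_onI)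
      fix x y assume xy: "x \<in> ?Ann" "y \<in> ?Ann" "v \<star> x = v \<star> y"
      have "(one - t \<star> v) \<star> x = 0" "(one - t \<star> v) \<star> y = 0" using xy(1,2) t by blast+
      then have "x = t \<star> (v \<star> x)" "y = t \<star> (v \<star> y)" by (simp_all add: diff_left assoc)
      then show "x = y" using xy(3) by simp
    qed
    show "(\<star>) v ` ?Ann \<subseteq> ?S"
      using absorb_left[OF v(1)] radA by (auto simp: left_socle_def simp flip: assoc)
  qed simp
  have RA: "r \<star> v \<in> A \<longleftrightarrow> r \<in> rad" if r: "r \<star> e i = r" for r
  proof
    assume rv: "r \<star> v \<in> A"
    show "r \<in> rad"
    proof (rule ccontr)
      assume "r \<notin> rad"
      then obtain s where "s \<star> r = e i" using prim_generated_left[OF p r] by metis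
      then have "v \<in> A" using Amul[OF rv, of s] v(1) by (simp flip: assoc)
      then show False using v(2) by simp
    qed
  qed (simp add: radA)
  \<comment> \<open>The embedding of the top of \<open>R e\<^sub>i\<close> into \<open>R/A\<close>
    in counted form: each fibre of \<open>?f\<close> is a translate of the pairs
    \<open>(j, - j v)\<close> with \<open>j\<close> in \<open>?RJ\<close>.\<close>
  let ?f = "\<lambda>(r, a). r \<star> v + a"
  have "card (?R \<times> A) = card (?f ` (?R \<times> A)) * card ?RJ"
  proof (rule card_fibers)
    fix p assume "p \<in> ?R \<times> A"
    then obtain r a where ra: "p = (r, a)" "r \<star> e i = r" "a \<in> A" by auto
    have "bij_betw (\<lambda>j. (r + j, a - j \<star> v)) ?RJ {y \<in> ?R \<times> A. ?f y = ?f p}"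
    proof (rule bij_betw_byWitness[where f' = "\<lambda>(s, b). s - r"])
      show "(\<lambda>j. (r + j, a - j \<star> v)) ` ?RJ \<subseteq> {y \<in> ?R \<times> A. ?f y = ?f p}"
        using ra Adiff radA by (auto simp: add_left)
      show "\<forall>a'\<in>{y \<in> ?R \<times> A. ?f y = ?f p}. (\<lambda>j. (r + j, a - j \<star> v)) ((\<lambda>(s, b). s - r) a') = a'"
        using ra(1) by (auto simp: diff_left algebra_simps)
      have "s - r \<in> rad" if "s \<star> e i = s" "b \<in> A" "s \<star> v + b = r \<star> v + a" for s b
      proof -
        have "(s - r) \<star> v = a - b" using that(3) by (simp add: diff_left algebra_simps)
        then show ?thesis using RA[of "s - r"] Adiff[OF ra(3) that(2)] that(1) ra(2)
          by (simp add: diff_left)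
      qed
      then show "(\<lambda>(s, b). s - r) ` {y \<in> ?R \<times> A. ?f y = ?f p} \<subseteq> ?RJ"
        using ra by (auto simp: diff_left)
    qed auto
    then show "card {y \<in> ?R \<times> A. ?f y = ?f p} = card ?RJ" by (simp add: bij_betw_same_card)
  qed simp
  also have "\<dots> \<le> card (UNIV :: 'a set) * card ?RJ" by (intro mult_right_mono card_mono) auto
  finally have "card ?R * card A \<le> card (UNIV :: 'a set) * card ?RJ" by (simp add: card_cartesian_product)
  then have "card A * card ?S * card ?RJ \<le> card (UNIV :: 'a set) * card ?RJ"
    using S[OF i] by (simp add: mult_ac)
  moreover have "card ?RJ > 0" by (rule card_Collect_pos[of _ 0]) simp
  ultimately have "card A * card ?S \<le> card (UNIV :: 'a set)" by simp
  then show ?thesis using mult_le_mono2[OF \<open>card ?Ann \<le> card ?S\<close>, of "card A"] by linarith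
qed

section \<open>Consequences of the annihilator identities\<close>

definition annihilator_cards :: bool where
  "annihilator_cards \<longleftrightarrow>
     (\<forall>I. left_ideal I \<longrightarrow> card I * card {x. \<forall>a\<in>I. a \<star> x = 0} = card (UNIV :: 'a set)) \<and>
     (\<forall>K. right_ideal K \<longrightarrow> card K * card {x. \<forall>a\<in>K. x \<star> a = 0} = card (UNIV :: 'a set))"

text \<open>The two conjuncts change places, so every consequence proved on one side holds on the
  other.\<close>

lemma annihilator_cards_opposite:
  "annihilator_cards \<Longrightarrow> finite_ring.annihilator_cards (\<lambda>x y. y \<star> x)"
  unfolding annihilator_cards_def finite_ring.annihilator_cards_def[OF opposite] by simp

lemma left_ideal_residual: "left_ideal {r. r \<star> a \<in> rad}"
  by (simp add: left_ideal_def add_left assoc)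

text \<open>The left ideal \<open>{r. r a \<in> J}\<close> is the kernel of the map from
  \<open>R\<close> to the top of \<open>R a\<close>. It contains \<open>J\<close> and
  \<open>one - a\<close>, and these two already force a right annihilator to be in the left socle
  and fixed by \<open>a\<close>.\<close>

lemma residual_annihilator:
  assumes a: "prim a"
  shows "{x. \<forall>r\<in>{r. r \<star> a \<in> rad}. r \<star> x = 0} = {x. a \<star> x = x \<and> x \<in> left_socle}"
proof (intro equalityI subsetI)
  fix x assume x: "x \<in> {x. \<forall>r\<in>{r. r \<star> a \<in> rad}. r \<star> x = 0}"
  have "(one - a) \<star> a = 0" using prim_idem[OF a] by (simp add: diff_left)
  then have "(one - a) \<star> x = 0" using x by simp
  then show "x \<in> {x. a \<star> x = x \<and> x \<in> left_socle}"
    using x by (auto simp: left_socle_def diff_left)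
next
  fix x assume x: "x \<in> {x. a \<star> x = x \<and> x \<in> left_socle}"
  show "x \<in> {x. \<forall>r\<in>{r. r \<star> a \<in> rad}. r \<star> x = 0}"
  proof safe
    fix r assume "r \<star> a \<in> rad"
    then have "(r \<star> a) \<star> x = 0" using x by (auto simp: left_socle_def)
    then show "r \<star> x = 0" using x by (simp add: assoc)
  qed
qed

lemma residual_cards:
  assumes D: annihilator_cards and a: "prim a"
  shows "card {r. r \<star> a \<in> rad} * card {x. a \<star> x = x \<and> x \<in> left_socle} = card (UNIV :: 'a set)"
  using D left_ideal_residual[of a] unfolding annihilator_cards_def residual_annihilator[OF a, symmetric]
  by blast

text \<open>The left annihilator of \<open>z R\<close> is \<open>{r. r a \<in> J}\<close>: for
  \<open>y\<close> outside this ideal some \<open>s y a\<close> equals \<open>a\<close>, so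
  \<open>s y z = z \<noteq> 0\<close>. The right annihilator of the same ideal is the component of
  the socle in question, so the two identities give it the size of its subset
  \<open>z R\<close>.\<close>

lemma left_socle_generated:
  assumes D: annihilator_cards and a: "prim a" and z: "z \<noteq> 0" "a \<star> z = z" "z \<in> left_socle"
  shows "{x. a \<star> x = x \<and> x \<in> left_socle} = {z \<star> r | r. True}"
proof -
  let ?K = "{z \<star> r | r. True}" and ?I = "{r. r \<star> a \<in> rad}"
  have sub: "?K \<subseteq> {x. a \<star> x = x \<and> x \<in> left_socle}"
    using z left_socle_right by (auto simp: absorb_left)
  have "{x. \<forall>a\<in>?K. x \<star> a = 0} = ?I"
  proof (intro equalityI subsetI)
    fix y assume y: "y \<in> {x. \<forall>a\<in>?K. x \<star> a = 0}"
    have "z \<star> one \<in> ?K" by blast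
    then have yz: "y \<star> z = 0" using y by auto
    show "y \<in> ?I"
    proof (rule ccontr)
      assume "y \<notin> ?I"
      then obtain s where "s \<star> (y \<star> a) = a"
        using prim_generated_left[OF a, of "y \<star> a"] prim_idem[OF a] by (auto simp: assoc)
      then have "z = s \<star> (y \<star> z)" using z(2) by (metis assoc)
      then show False using yz z(1) by simp
    qed
  next
    fix y assume "y \<in> ?I"
    then have "(y \<star> a) \<star> z = 0" using z(3) by (auto simp: left_socle_def)
    then have "y \<star> z = 0" using z(2) by (simp add: assoc)
    then show "y \<in> {x. \<forall>a\<in>?K. x \<star> a = 0}" by (auto simp flip: assoc)
  qed
  moreover have "card ?K * card {x. \<forall>a\<in>?K. x \<star> a = 0} = card (UNIV :: 'a set)"
    using D right_ideal_cyclic[of z] unfolding annihilator_cards_def by blast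
  ultimately have "card ?K * card ?I = card {x. a \<star> x = x \<and> x \<in> left_socle} * card ?I"
    using residual_cards[OF D a] by (simp add: mult.commute)
  moreover have "card ?I > 0" by (rule card_Collect_pos[of _ 0]) simp
  ultimately have "card ?K = card {x. a \<star> x = x \<and> x \<in> left_socle}"
    by (rule mult_right_cancel_nat)
  then show ?thesis using card_subset_eq[OF _ sub] by simp
qed

text \<open>If \<open>z = e\<^sub>i x\<close> had \<open>z j \<noteq> 0\<close> for some
  \<open>j \<in> J\<close>, then \<open>z j\<close> would also generate the component containing
  \<open>z\<close>, so \<open>z = z j r\<close>, which forces \<open>z = 0\<close>.\<close>

lemma annihilator_cards_socle_subset:
  assumes D: annihilator_cards and c: "complete m e"
  shows "left_socle \<subseteq> socle"
proof
  fix x assume x: "x \<in> left_socle"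
  have "e i \<star> x \<in> socle" if i: "i \<in> {1..m}" for i
    unfolding socle_def
  proof safe
    let ?z = "e i \<star> x"
    note p = complete_prim[OF c i]
    have z: "?z \<in> left_socle" "e i \<star> ?z = ?z" using x left_socle_left prim_idem2[OF p] by auto
    fix j assume j: "j \<in> rad"
    show "?z \<star> j = 0"
    proof (rule ccontr)
      assume nz: "?z \<star> j \<noteq> 0"
      have "{x. e i \<star> x = x \<and> x \<in> left_socle} = {?z \<star> j \<star> r | r. True}"
        by (rule left_socle_generated[OF D p nz]) (use z left_socle_right absorb_left in auto)
      then have "?z \<in> {?z \<star> j \<star> r | r. True}" using z by blast
      then obtain r where r: "?z = ?z \<star> j \<star> r" by blast
      have "?z \<star> (j \<star> r) = ?z \<star> j \<star> r" by (rule assoc[symmetric])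
      also have "\<dots> = ?z" by (rule r[symmetric])
      finally have "?z \<star> (j \<star> r) = ?z" .
      then have "?z = 0" using rad_fix_right[OF rad_right[OF j]] by blast
      then show False using nz by simp
    qed
  qed
  then have "(\<Sum>i\<in>{1..m}. e i \<star> x) \<in> socle" by (rule right_ideal_sum[OF right_ideal_socle])
  then show "x \<in> socle" using complete_decomp_left[OF c, of x] by simp
qed

lemma annihilator_cards_socle_eq:
  assumes D: annihilator_cards and c: "complete m e"
  shows "left_socle = socle"
proof
  show "left_socle \<subseteq> socle" by (rule annihilator_cards_socle_subset[OF D c])
  show "socle \<subseteq> left_socle"
    using finite_ring.annihilator_cards_socle_subset[OF opposite annihilator_cards_opposite[OF D]
        complete_opposite[OF c]]
    unfolding left_socle_opposite socle_opposite .
qed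

text \<open>Once the socles agree, a single nonzero element of \<open>a S b\<close> generates
  \<open>a S\<close> from the right and \<open>S b\<close> from the left.\<close>

lemma annihilator_cards_gen:
  assumes D: annihilator_cards and c: "complete m e" and a: "prim a" and b: "prim b"
    and z: "z \<noteq> 0" "a \<star> z = z" "z \<star> b = z" "z \<in> socle"
  shows "socle_gen a b z" "left_socle_gen a b z"
proof -
  interpret op: finite_ring "\<lambda>x y. y \<star> x" one by (rule opposite)
  note s = annihilator_cards_socle_eq[OF D c]
  show "socle_gen a b z"
    unfolding socle_gen_def using left_socle_generated[OF D a z(1,2)] z s by simp
  show "left_socle_gen a b z"
    unfolding left_socle_gen_def s
    using op.left_socle_generated[OF annihilator_cards_opposite[OF D], of b z] b z
    by (simp add: prim_opposite left_socle_opposite)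
qed

text \<open>The fibres of \<open>r \<mapsto> r a\<close> modulo \<open>J\<close> are the cosets of
  \<open>{r. r a \<in> J}\<close>, so the annihilator identity gives \<open>a S\<close> the size of
  \<open>(R/J) a\<close>, the power \<open>q ^ \<mu>\<close> for \<open>a\<close>. The generator
  gives the same power for \<open>b\<close>, and the bases agree.\<close>

lemma annihilator_cards_multiplicity:
  assumes D: annihilator_cards and c: "complete m e" and a: "prim a" and b: "prim b"
    and z: "socle_gen a b z" "left_socle_gen a b z"
  shows "multiplicity a = multiplicity b"
proof -
  note s = annihilator_cards_socle_eq[OF D c]
  let ?I = "{r. r \<star> a \<in> rad}" and ?X = "{x. x \<star> a = x}" and ?XJ = "{x. x \<star> a = x \<and> x \<in> rad}"
  let ?S = "card {x. a \<star> x = x \<and> x \<in> left_socle}"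
  have "card (UNIV :: 'a set) = card ((\<lambda>r. cls (r \<star> a)) ` UNIV) * card ?I"
    by (rule card_subgroup_fibers) (auto simp: cls_eq_iff diff_left)
  moreover have "(\<lambda>r. cls (r \<star> a)) ` UNIV = cls ` ?X"
    using prim_idem[OF a] by (auto simp: image_iff) (metis assoc)+
  ultimately have "card (cls ` ?X) * card ?I = ?S * card ?I"
    using residual_cards[OF D a] by (metis mult.commute)
  moreover have "card ?I > 0" by (rule card_Collect_pos[of _ 0]) simp
  ultimately have "card (cls ` ?X) = ?S" by (rule mult_right_cancel_nat)
  moreover have "card ?X = card (cls ` ?X) * card ?XJ"
    by (rule card_subgroup_fibers) (auto simp: add_left diff_left cls_eq_iff)
  moreover have "residue_card a ^ multiplicity a * card ?XJ = card ?X"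
    unfolding multiplicity_def by (rule multiplicity_card[OF c a])
  ultimately have "residue_card a ^ multiplicity a * card ?XJ = ?S * card ?XJ" by simp
  moreover have "card ?XJ > 0" by (rule card_Collect_pos[of _ 0]) simp
  ultimately have "residue_card a ^ multiplicity a = ?S" by (rule mult_right_cancel_nat)
  also have "\<dots> = residue_card b ^ multiplicity b"
    unfolding s by (rule socle_gen_power[OF c b z(1)])
  finally show ?thesis
    using residue_card_ge[OF b] unfolding socle_gen_residue[OF s a b z] by simp
qed

text \<open>Each generator is a multiple of the other, say \<open>z' = z (b r b')\<close>. The
  factor \<open>b r b'\<close> is outside \<open>J\<close> since otherwise \<open>z' = 0\<close>,
  and \<open>eqvI\<close> applies to it.\<close>

lemma socle_gen_unique:
  assumes b: "prim b" "prim b'" and z: "socle_gen a b z" "socle_gen a b' z'"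
  shows "eqv b b'"
proof -
  have "z \<star> one \<in> {z \<star> r | r. True}" "z' \<star> one \<in> {z' \<star> r | r. True}" by blast+
  then have zs: "z \<in> socle" "z' \<in> socle" using z unfolding socle_gen_def by auto
  then have "z' \<in> {z \<star> r | r. True}" using z unfolding socle_gen_def by blast
  then obtain r where r: "z' = z \<star> r" by blast
  have zb: "z \<star> b = z" "z' \<star> b' = z'" "z' \<noteq> 0" using z unfolding socle_gen_def by auto
  have eq: "z' = z \<star> (b \<star> r \<star> b')" using zb r by (metis assoc)
  have "b \<star> r \<star> b' \<notin> rad" using eq zb(3) zs(1) by (auto simp: socle_def)
  then show ?thesis
    by (intro eqvI[OF b, of "b \<star> r \<star> b'"]) (simp_all add: assoc prim_idem prim_idem2 b)
qed

lemma annihilator_cards_nakayama: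
  assumes D: annihilator_cards and o: "ordered m k e"
  shows "\<exists>\<pi>. nakayama k e \<pi> \<and> (\<forall>i\<in>{1..k}. multiplicity (e i) = multiplicity (e (\<pi> i)))"
proof -
  interpret op: finite_ring "\<lambda>x y. y \<star> x" one by (rule opposite)
  note c = ordered_complete[OF o] and pr = ordered_prim[OF o]
  note s = annihilator_cards_socle_eq[OF D c]
  have distinct: "i = j" if "i \<in> {1..k}" "j \<in> {1..k}" "eqv (e i) (e j)" for i j
    using o that unfolding ordered_def by blast
  have ex: "\<exists>j\<in>{1..k}. \<exists>z. socle_gen (e i) (e j) z \<and> left_socle_gen (e i) (e j) z"
    if i: "i \<in> {1..k}" for i
  proof -
    note p = pr[OF i]
    have "\<exists>x. e i \<star> x = x \<and> x \<in> left_socle \<and> x \<noteq> 0"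
    proof (rule ccontr)
      assume "\<not> ?thesis"
      then have "{x. e i \<star> x = x \<and> x \<in> left_socle} = {0}" by (auto simp: left_socle_def)
      \<comment> \<open>A trivial socle component would make the residual left ideal all of
        \<open>R\<close> and put \<open>e i\<close> into the radical.\<close>
      then have "card {r. r \<star> e i \<in> rad} = card (UNIV :: 'a set)" using residual_cards[OF D p] by simp
      then have "{r. r \<star> e i \<in> rad} = UNIV" by (intro card_subset_eq) auto
      then have "one \<in> {r. r \<star> e i \<in> rad}" by blast
      then show False using prim_notin_rad[OF p] by simp
    qed
    then obtain x where x: "e i \<star> x = x" "x \<in> socle" "x \<noteq> 0" unfolding s by blast
    have "\<exists>l\<in>{1..m}. x \<star> e l \<noteq> 0"
      using x(3) complete_decomp_right[OF c, of x] by (metis (no_types, lifting) sum.neutral)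
    then obtain l where l: "l \<in> {1..m}" "x \<star> e l \<noteq> 0" by blast
    obtain j where j: "j \<in> {1..k}" "eqv (e l) (e j)" using ordered_rep[OF o l(1)] .
    obtain u v where uv: "u \<star> v = e l" "u \<star> e j = u" using j(2) unfolding eqv_def by blast
    have "x \<star> u \<noteq> 0" using l(2) uv(1) by (metis assoc zero_left)
    moreover have "e i \<star> (x \<star> u) = x \<star> u" "(x \<star> u) \<star> e j = x \<star> u"
      using x(1) uv(2) by (simp_all add: absorb_left absorb_right)
    moreover have "x \<star> u \<in> socle" using x(2) right_ideal_socle by (simp add: right_ideal_def)
    ultimately show ?thesis
      using annihilator_cards_gen[OF D c p pr[OF j(1)]] j(1) by blast
  qed
  then obtain \<sigma> where \<sigma>: "\<And>i. i \<in> {1..k} \<Longrightarrow> \<sigma> i \<in> {1..k} \<and>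
      (\<exists>z. socle_gen (e i) (e (\<sigma> i)) z \<and> left_socle_gen (e i) (e (\<sigma> i)) z)"
    by metis
  \<comment> \<open>Outside \<open>{1..k}\<close> the value is \<open>i\<close>, as
    \<open>permutes\<close> demands.\<close>
  define \<pi> where "\<pi> i = (if i \<in> {1..k} then \<sigma> i else i)" for i
  have "inj_on \<pi> {1..k}"
  proof (rule inj_onI)
    fix i j assume ij: "i \<in> {1..k}" "j \<in> {1..k}" "\<pi> i = \<pi> j"
    then have "\<exists>z z'. left_socle_gen (e i) (e (\<sigma> i)) z \<and> left_socle_gen (e j) (e (\<sigma> i)) z'"
      using \<sigma> unfolding \<pi>_def by metis
    \<comment> \<open>Both left tops, of \<open>R e i\<close> and of \<open>R e j\<close>, are
      isomorphic to the socle of the left module of \<open>e (\<sigma> i)\<close>, so uniqueness is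
      applied in the opposite ring.\<close>
    then have "eqv (e i) (e j)"
      using op.socle_gen_unique[of "e i" "e j" "e (\<sigma> i)"] pr[OF ij(1)] pr[OF ij(2)]
      unfolding socle_gen_opposite prim_opposite eqv_opposite by blast
    then show "i = j" using distinct ij by blast
  qed
  moreover have "\<pi> ` {1..k} \<subseteq> {1..k}" using \<sigma> by (auto simp: \<pi>_def)
  ultimately have "bij_betw \<pi> {1..k} {1..k}"
    unfolding bij_betw_def using endo_inj_surj by blast
  then have "\<pi> permutes {1..k}" by (rule bij_imp_permutes) (auto simp: \<pi>_def)
  moreover have "(\<exists>z. socle_gen (e i) (e (\<pi> i)) z) \<and> (\<exists>w. left_socle_gen (e i) (e (\<pi> i)) w)"
    if i: "i \<in> {1..k}" for i
  proof -
    have "\<pi> i = \<sigma> i" using i by (simp add: \<pi>_def)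
    then show ?thesis using \<sigma>[OF i] by auto
  qed
  ultimately have "nakayama k e \<pi>" unfolding nakayama_def by blast
  moreover have "multiplicity (e i) = multiplicity (e (\<pi> i))" if i: "i \<in> {1..k}" for i
    using \<sigma>[OF i] annihilator_cards_multiplicity[OF D c pr[OF i] pr] i unfolding \<pi>_def by auto
  ultimately show ?thesis by blast
qed

subsection \<open>Existence of complete sets of primitive idempotents\<close>

text \<open>Take as many nonzero orthogonal idempotents with sum \<open>one\<close> as possible. If
  a member split, its two parts could replace it and enlarge the set.\<close>

lemma complete_set_exists:
  "\<exists>F. (\<forall>f\<in>F. prim f) \<and> (\<forall>f\<in>F. \<forall>g\<in>F. f \<noteq> g \<longrightarrow> f \<star> g = 0) \<and> \<Sum>F = one"
proof -
  define P where "P F \<longleftrightarrow> (\<forall>f\<in>F. f \<star> f = f \<and> f \<noteq> 0) \<and>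
    (\<forall>f\<in>F. \<forall>g\<in>F. f \<noteq> g \<longrightarrow> f \<star> g = 0) \<and> \<Sum>F = one" for F
  \<comment> \<open>In the zero ring \<open>{one}\<close> contains the zero element, so the empty
    set is the starting point there.\<close>
  have P0: "P (if one = 0 then {} else {one})" by (auto simp: P_def)
  have "\<exists>F. P F \<and> (\<forall>G. P G \<longrightarrow> card G \<le> card F)"
    by (rule ex_has_greatest_nat[where P = P and f = card and b = "Suc (card (UNIV :: 'a set))", OF P0])
      (simp add: card_mono less_Suc_eq_le)
  then obtain F where PF: "P F" and max: "\<And>G. P G \<Longrightarrow> card G \<le> card F" by blast
  note F = PF[unfolded P_def]
  have "prim f" if f: "f \<in> F" for f
    unfolding prim_def
  proof (intro conjI allI impI)
    show "f \<star> f = f" "f \<noteq> 0" using F f by auto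
    fix g h assume gh: "g \<star> g = g \<and> h \<star> h = h \<and> g \<star> h = 0 \<and> h \<star> g = 0 \<and> f = g + h"
    show "g = 0 \<or> h = 0"
    proof (rule ccontr)
      assume nz: "\<not> (g = 0 \<or> h = 0)"
      let ?G = "insert g (insert h (F - {f}))"
      have fg: "f \<star> g = g" "g \<star> f = g" "f \<star> h = h" "h \<star> f = h"
        using gh by (simp_all add: add_left add_right)
      have e: "e \<star> g = 0" "g \<star> e = 0" "e \<star> h = 0" "h \<star> e = 0" if "e \<in> F - {f}" for e
      proof -
        have "e \<star> f = 0" "f \<star> e = 0" using that F f by auto
        then show "e \<star> g = 0" "g \<star> e = 0" "e \<star> h = 0" "h \<star> e = 0"
          using fg by (metis assoc zero_left zero_right)+
      qed
      have new: "g \<notin> F - {f}" "h \<notin> F - {f}" "g \<noteq> h" using e[of g] e[of h] gh nz by auto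
      have "\<Sum>?G = g + h + \<Sum>(F - {f})" using new by (simp add: add.assoc)
      also have "\<dots> = \<Sum>F" using sum.remove[of F f "\<lambda>x. x"] f gh by simp
      finally have "\<Sum>?G = one" using F by simp
      moreover have "\<forall>f\<in>?G. f \<star> f = f \<and> f \<noteq> 0" using gh nz F by blast
      moreover have "\<forall>x\<in>?G. \<forall>y\<in>?G. x \<noteq> y \<longrightarrow> x \<star> y = 0"
        using e gh F by (metis DiffE insertE)
      ultimately have "card ?G \<le> card F" by (intro max) (simp only: P_def)
      moreover have "card ?G = Suc (card F)"
        using new f card_Suc_Diff1[of F f] by simp
      ultimately show False by simp
    qed
  qed
  then show ?thesis using F by blast
qed

lemma ordered_exists: "\<exists>m k e. ordered m k e"
proof -
  obtain F where pF: "\<And>f. f \<in> F \<Longrightarrow> prim f"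
    and oF: "\<And>f g. f \<in> F \<Longrightarrow> g \<in> F \<Longrightarrow> f \<noteq> g \<Longrightarrow> f \<star> g = 0" and sF: "\<Sum>F = one"
    using complete_set_exists by auto
  define r where "r f = (SOME g. g \<in> F \<and> eqv f g)" for f
  define T where "T = r ` F"
  have r: "r f \<in> F \<and> eqv f (r f)" if "f \<in> F" for f
    unfolding r_def using that eqv_refl[OF prim_idem[OF pF[OF that]]] by (intro someI) blast
  have T: "T \<subseteq> F" using r by (auto simp: T_def)
  have Teq: "s = t" if "s \<in> T" "t \<in> T" "eqv s t" for s t
  proof -
    obtain f g where fg: "f \<in> F" "g \<in> F" "s = r f" "t = r g" using \<open>s \<in> T\<close> \<open>t \<in> T\<close> by (auto simp: T_def)
    have "eqv f g" using r[OF fg(1)] r[OF fg(2)] that(3) fg(3,4) eqv_trans eqv_sym by blast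
    \<comment> \<open>Equivalent \<open>f\<close> and \<open>g\<close> satisfy the same predicate in
      \<open>h\<close>, so the choice operator returns the same representative for both.\<close>
    then have "eqv f h \<longleftrightarrow> eqv g h" for h using eqv_trans eqv_sym by blast
    then show ?thesis unfolding fg(3,4) r_def by simp
  qed
  define k where "k = card T"
  define m where "m = k + card (F - T)"
  obtain h1 where h1: "bij_betw h1 {1..k} T"
    unfolding k_def using ex_bij_betw_nat_finite_1[of T] by auto
  obtain h2 where h2: "bij_betw h2 {1..card (F - T)} (F - T)"
    using ex_bij_betw_nat_finite_1[of "F - T"] by auto
  define e where "e i = (if i \<le> k then h1 i else h2 (i - k))" for i
  have e1: "bij_betw e {1..k} T"
    using h1 bij_betw_cong[of "{1..k}" h1 e T] by (simp add: e_def)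
  have "bij_betw (\<lambda>i. i - k) {k<..m} {1..card (F - T)}"
    by (rule bij_betw_byWitness[where f' = "\<lambda>i. i + k"]) (auto simp: m_def)
  then have "bij_betw (h2 \<circ> (\<lambda>i. i - k)) {k<..m} (F - T)" using h2 by (rule bij_betw_trans)
  then have e2: "bij_betw e {k<..m} (F - T)"
    using bij_betw_cong[of "{k<..m}" "h2 \<circ> (\<lambda>i. i - k)" e "F - T"] by (simp add: e_def)
  have "{1..m} = {1..k} \<union> {k<..m}" by (auto simp: m_def)
  then have e: "bij_betw e {1..m} F"
    using bij_betw_combine[OF e1 e2] T by (simp add: Un_absorb1)
  have eF: "e i \<in> F" if "i \<in> {1..m}" for i using bij_betwE[OF e] that by blast
  have inj: "e i \<noteq> e j" if "i \<in> {1..m}" "j \<in> {1..m}" "i \<noteq> j" for i j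
    using inj_onD[OF bij_betw_imp_inj_on[OF e], of i j] that by blast
  have "complete m e"
    unfolding complete_def
  proof (intro conjI ballI impI)
    show "prim (e i)" if "i \<in> {1..m}" for i using pF[OF eF[OF that]] .
    show "e i \<star> e j = 0" if "i \<in> {1..m}" "j \<in> {1..m}" "i \<noteq> j" for i j
      using oF[OF eF[OF that(1)] eF[OF that(2)] inj[OF that]] .
    show "(\<Sum>i\<in>{1..m}. e i) = one"
      using sum.reindex_bij_betw[OF e, of "\<lambda>x. x"] sF by (simp only:)
  qed
  moreover have "\<not> eqv (e i) (e j)" if "i \<in> {1..k}" "j \<in> {1..k}" "i \<noteq> j" for i j
    using Teq[of "e i" "e j"] bij_betwE[OF e1] inj_onD[OF bij_betw_imp_inj_on[OF e1], of i j] that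
    by blast
  moreover have "\<exists>j\<in>{1..k}. eqv (e i) (e j)" if "i \<in> {k<..m}" for i
  proof -
    have "e i \<in> F" using that by (intro eF) auto
    then have "eqv (e i) (r (e i))" "r (e i) \<in> T" using r by (auto simp: T_def)
    moreover from this have "r (e i) \<in> e ` {1..k}" using e1 by (simp add: bij_betw_def)
    ultimately show ?thesis by auto
  qed
  ultimately have "ordered m k e" by (simp add: ordered_def m_def)
  then show ?thesis by blast
qed

end

section \<open>Left codes\<close>

lemma finite_carrier_vec: "finite (carrier_vec n :: 'a::finite vec set)"
proof -
  have "carrier_vec n \<subseteq> vec_of_list ` {xs :: 'a list. set xs \<subseteq> UNIV \<and> length xs = n}"
  proof
    fix v :: "'a vec" assume "v \<in> carrier_vec n"
    then show "v \<in> vec_of_list ` {xs. set xs \<subseteq> UNIV \<and> length xs = n}"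
      by (intro image_eqI[of _ _ "list_of_vec v"]) (auto simp: vec_list)
  qed
  then show ?thesis
    by (rule finite_subset) (intro finite_imageI finite_lists_length_eq finite)
qed

definition single_vec :: "nat \<Rightarrow> nat \<Rightarrow> 'a::zero \<Rightarrow> 'a vec" where
  "single_vec n i a = vec n (\<lambda>j. if j = i then a else 0)"

lemma single_vec_carrier [simp]: "single_vec n i a \<in> carrier_vec n"
  by (simp add: single_vec_def)

lemma scalar_prod_single:
  fixes x :: "'a::semiring_0 vec"
  assumes "x \<in> carrier_vec n" "i < n"
  shows "x \<bullet> single_vec n i a = x $ i * a" "single_vec n i a \<bullet> x = a * x $ i"
proof -
  have "x \<bullet> single_vec n i a = (\<Sum>j\<in>{0..<n}. if j = i then x $ i * a else 0)"
    unfolding scalar_prod_def single_vec_def by (intro sum.cong) auto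
  then show "x \<bullet> single_vec n i a = x $ i * a" using assms by simp
  have "single_vec n i a \<bullet> x = (\<Sum>j\<in>{0..<n}. if j = i then a * x $ i else 0)"
    unfolding scalar_prod_def single_vec_def using assms by (intro sum.cong) auto
  then show "single_vec n i a \<bullet> x = a * x $ i" using assms by simp
qed

lemma left_code_iff:
  "left_code n C \<longleftrightarrow> C \<subseteq> carrier_vec n \<and> 0\<^sub>v n \<in> C \<and>
     (\<forall>x\<in>C. \<forall>y\<in>C. x + y \<in> C) \<and> (\<forall>r. \<forall>x\<in>C. r \<cdot>\<^sub>v x \<in> C)"
  by (simp add: left_code_def is_submod_def left_vec_mod_def)

lemma right_annihilator_carrier:
  "right_annihilator n (carrier_vec n) = {0\<^sub>v n :: 'a::{ring,monoid_mult} vec}"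
proof (intro equalityI subsetI)
  fix s :: "'a vec" assume s: "s \<in> right_annihilator n (carrier_vec n)"
  then have sc: "s \<in> carrier_vec n" by (simp add: right_annihilator_def)
  have "s $ i = 0" if "i < n" for i
    using s scalar_prod_single(2)[OF sc that, of 1] by (simp add: right_annihilator_def)
  then show "s \<in> {0\<^sub>v n}" using sc by auto
qed (auto simp: right_annihilator_def)

section \<open>Adjoining one word to a code\<close>

definition code_adjoin :: "'a::{ring,monoid_mult} vec set \<Rightarrow> 'a vec \<Rightarrow> 'a vec set" where
  "code_adjoin C x = {c + r \<cdot>\<^sub>v x | c r. c \<in> C}"

lemma one_smult: "(1::'a::{ring,monoid_mult}) \<cdot>\<^sub>v x = x"
  by (rule eq_vecI) auto

lemma zero_smult: "x \<in> carrier_vec n \<Longrightarrow> (0::'a::{ring,monoid_mult}) \<cdot>\<^sub>v x = 0\<^sub>v n"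
  by (rule eq_vecI) auto

lemma code_adjoin:
  fixes C :: "'a::{ring,monoid_mult} vec set"
  assumes C: "left_code n C" and x: "x \<in> carrier_vec n"
  shows "left_code n (code_adjoin C x)" "C \<subseteq> code_adjoin C x" "x \<in> code_adjoin C x"
proof -
  have C': "\<And>c. c \<in> C \<Longrightarrow> c \<in> carrier_vec n" "0\<^sub>v n \<in> C" "\<And>c d. c \<in> C \<Longrightarrow> d \<in> C \<Longrightarrow> c + d \<in> C"
    "\<And>c r. c \<in> C \<Longrightarrow> r \<cdot>\<^sub>v c \<in> C"
    using C by (auto simp: left_code_iff)
  have mem: "c \<in> C \<Longrightarrow> v = c + r \<cdot>\<^sub>v x \<Longrightarrow> v \<in> code_adjoin C x" for v c r
    unfolding code_adjoin_def by blast
  show sub: "C \<subseteq> code_adjoin C x"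
  proof
    fix c assume c: "c \<in> C"
    show "c \<in> code_adjoin C x"
      using C'(1)[OF c] x by (intro mem[OF c, of _ 0]) (simp add: zero_smult[OF x])
  qed
  show "x \<in> code_adjoin C x"
    using x by (intro mem[OF C'(2), of _ 1]) (simp add: one_smult)
  show "left_code n (code_adjoin C x)"
    unfolding left_code_iff
  proof (intro conjI ballI allI)
    show "code_adjoin C x \<subseteq> carrier_vec n" using C'(1) x by (auto simp: code_adjoin_def)
    show "0\<^sub>v n \<in> code_adjoin C x" using C'(2) sub by blast
    fix u v assume "u \<in> code_adjoin C x" "v \<in> code_adjoin C x"
    then obtain c r d s where u: "c \<in> C" "u = c + r \<cdot>\<^sub>v x" and v: "d \<in> C" "v = d + s \<cdot>\<^sub>v x"
      unfolding code_adjoin_def by blast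
    show "u + v \<in> code_adjoin C x"
      unfolding u v using C'(1)[OF u(1)] C'(1)[OF v(1)] x
      by (intro mem[OF C'(3)[OF u(1) v(1)], of _ "r + s"] eq_vecI) (auto simp: algebra_simps)
  next
    fix r u assume "u \<in> code_adjoin C x"
    then obtain c s where u: "c \<in> C" "u = c + s \<cdot>\<^sub>v x" unfolding code_adjoin_def by blast
    show "r \<cdot>\<^sub>v u \<in> code_adjoin C x"
      unfolding u using C'(1)[OF u(1)] x
      by (intro mem[OF C'(4)[OF u(1)], of _ r "r * s"] eq_vecI) (auto simp: algebra_simps)
  qed
qed

lemma code_adjoin_subset:
  assumes "left_code n D" "C \<subseteq> D" "x \<in> D"
  shows "code_adjoin C x \<subseteq> D"
  using assms by (auto simp: code_adjoin_def left_code_iff)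

lemma right_annihilator_adjoin:
  fixes C :: "'a::{ring,monoid_mult} vec set"
  assumes C: "left_code n C" and x: "x \<in> carrier_vec n"
  shows "right_annihilator n (code_adjoin C x) = {s \<in> right_annihilator n C. x \<bullet> s = 0}"
proof -
  have "(c + r \<cdot>\<^sub>v x) \<bullet> s = c \<bullet> s + r * (x \<bullet> s)" if "c \<in> C" "s \<in> carrier_vec n" for c r s
    using that C x by (subst add_scalar_prod_distrib[of _ n]) (auto simp: left_code_iff)
  then have "{s \<in> right_annihilator n C. x \<bullet> s = 0} \<subseteq> right_annihilator n (code_adjoin C x)"
    by (auto simp: right_annihilator_def code_adjoin_def)
  moreover have "right_annihilator n (code_adjoin C x) \<subseteq> {s \<in> right_annihilator n C. x \<bullet> s = 0}"
    using code_adjoin(2,3)[OF C x] by (auto simp: right_annihilator_def)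
  ultimately show ?thesis by blast
qed

text \<open>The map \<open>(c, r) \<mapsto> c + r x\<close> covers the larger code, and the fibre
  through \<open>(c, r)\<close> consists of the pairs \<open>(c - j x, r + j)\<close> with
  \<open>j x \<in> C\<close>.\<close>

lemma code_adjoin_card:
  fixes C :: "'a::{ring,monoid_mult,finite} vec set"
  assumes C: "left_code n C" and x: "x \<in> carrier_vec n"
  shows "card C * card (UNIV :: 'a set) = card (code_adjoin C x) * card {r. r \<cdot>\<^sub>v x \<in> C}"
proof -
  let ?A = "{r. r \<cdot>\<^sub>v x \<in> C}" and ?f = "\<lambda>(c, r). c + r \<cdot>\<^sub>v x"
  have C': "\<And>c. c \<in> C \<Longrightarrow> dim_vec c = n" "\<And>c d. c \<in> C \<Longrightarrow> d \<in> C \<Longrightarrow> c + d \<in> C"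
    "\<And>c r. c \<in> C \<Longrightarrow> r \<cdot>\<^sub>v c \<in> C"
    using C by (auto simp: left_code_iff)
  have fin: "finite C" using C finite_subset[OF _ finite_carrier_vec] by (auto simp: left_code_iff)
  have neg: "(- r) \<cdot>\<^sub>v x \<in> C" if "r \<cdot>\<^sub>v x \<in> C" for r
  proof -
    have "(- r) \<cdot>\<^sub>v x = (- 1) \<cdot>\<^sub>v (r \<cdot>\<^sub>v x)" by (rule eq_vecI) auto
    then show ?thesis using C'(3)[OF that] by simp
  qed
  have "card (C \<times> (UNIV :: 'a set)) = card (?f ` (C \<times> UNIV)) * card ?A"
  proof (rule card_fibers)
    show "finite (C \<times> (UNIV :: 'a set))" using fin by simp
    fix p :: "'a vec \<times> 'a" assume "p \<in> C \<times> UNIV"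
    then obtain c r where p: "p = (c, r)" "c \<in> C" by auto
    have "bij_betw (\<lambda>j. (c + (- j) \<cdot>\<^sub>v x, r + j)) ?A {q \<in> C \<times> UNIV. ?f q = ?f p}"
    proof (rule bij_betw_byWitness[where f' = "\<lambda>(d, s). s - r"])
      show "\<forall>j\<in>?A. (\<lambda>(d, s). s - r) (c + (- j) \<cdot>\<^sub>v x, r + j) = j" by simp
      have *: "d = c + (- (s - r)) \<cdot>\<^sub>v x" "(s - r) \<cdot>\<^sub>v x = c + (- 1) \<cdot>\<^sub>v d"
        if d: "d \<in> C" "d + s \<cdot>\<^sub>v x = c + r \<cdot>\<^sub>v x" for d s
      proof -
        have i: "d $ i + s * x $ i = c $ i + r * x $ i" if "i < n" for i
          using arg_cong[OF d(2), of "\<lambda>v. v $ i"] that C'(1)[OF d(1)] C'(1)[OF p(2)] x by simp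
        show "d = c + (- (s - r)) \<cdot>\<^sub>v x" "(s - r) \<cdot>\<^sub>v x = c + (- 1) \<cdot>\<^sub>v d"
          using i C'(1)[OF d(1)] C'(1)[OF p(2)] x
          by (auto intro!: eq_vecI simp: left_diff_distrib algebra_simps eq_diff_eq)
      qed
      show "\<forall>q\<in>{q \<in> C \<times> UNIV. ?f q = ?f p}.
          (\<lambda>j. (c + (- j) \<cdot>\<^sub>v x, r + j)) ((\<lambda>(d, s). s - r) q) = q"
        using *(1) p by auto
      show "(\<lambda>j. (c + (- j) \<cdot>\<^sub>v x, r + j)) ` ?A \<subseteq> {q \<in> C \<times> UNIV. ?f q = ?f p}"
      proof -
        have "c + (- j) \<cdot>\<^sub>v x + (r + j) \<cdot>\<^sub>v x = c + r \<cdot>\<^sub>v x" for j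
          using C'(1)[OF p(2)] x by (intro eq_vecI) (auto simp: algebra_simps)
        then show ?thesis using C'(2)[OF p(2) neg] p(1) by auto
      qed
      show "(\<lambda>(d, s). s - r) ` {q \<in> C \<times> UNIV. ?f q = ?f p} \<subseteq> ?A"
        using *(2) C'(2)[OF p(2) C'(3)] p by auto
    qed
    then show "card {q \<in> C \<times> UNIV. ?f q = ?f p} = card ?A" by (simp add: bij_betw_same_card)
  qed
  moreover have "?f ` (C \<times> UNIV) = code_adjoin C x" by (auto simp: code_adjoin_def)
  ultimately show ?thesis by (simp add: card_cartesian_product)
qed

text \<open>The first isomorphism theorem for \<open>s \<mapsto> x s\<close> on the annihilator of
  \<open>C\<close>; its kernel is the annihilator of the extended code.\<close>

lemma right_annihilator_card:
  fixes C :: "'a::{ring,monoid_mult,finite} vec set"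
  assumes C: "left_code n C" and x: "x \<in> carrier_vec n"
  shows "card (right_annihilator n C) =
    card ((\<bullet>) x ` right_annihilator n C) * card (right_annihilator n (code_adjoin C x))"
proof (rule card_fibers)
  let ?P = "right_annihilator n C"
  have Cc: "C \<subseteq> carrier_vec n" using C by (simp add: left_code_iff)
  show "finite ?P"
    by (rule finite_subset[OF _ finite_carrier_vec[of n]]) (auto simp: right_annihilator_def)
  fix s assume s: "s \<in> ?P"
  have neg: "c \<bullet> (- t) = - (c \<bullet> t)" if "t \<in> carrier_vec n" for c t :: "'a vec"
    using that unfolding scalar_prod_def by (auto simp: sum_negf intro: sum.cong)
  have add: "t + u \<in> ?P" "x \<bullet> (t + u) = x \<bullet> t + x \<bullet> u" if "t \<in> ?P" "u \<in> ?P" for t u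
    using that x Cc scalar_prod_add_distrib[of _ n t u] by (auto simp: right_annihilator_def subset_iff)
  have minus: "- t \<in> ?P" "x \<bullet> (- t) = - (x \<bullet> t)" if "t \<in> ?P" for t
    using that neg by (auto simp: right_annihilator_def)
  have dim: "t \<in> ?P \<Longrightarrow> t \<in> carrier_vec n" for t by (simp add: right_annihilator_def)
  have "bij_betw (\<lambda>t. t + s) {t \<in> ?P. x \<bullet> t = 0} {t \<in> ?P. x \<bullet> t = x \<bullet> s}"
  proof (rule bij_betw_byWitness[where f' = "\<lambda>t. t + - s"])
    show "\<forall>t\<in>{t \<in> ?P. x \<bullet> t = 0}. t + s + - s = t" "\<forall>t\<in>{t \<in> ?P. x \<bullet> t = x \<bullet> s}. t + - s + s = t"
      using dim s by (auto intro!: eq_vecI dest!: dim)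
    show "(\<lambda>t. t + s) ` {t \<in> ?P. x \<bullet> t = 0} \<subseteq> {t \<in> ?P. x \<bullet> t = x \<bullet> s}"
      using add[OF _ s] by auto
    show "(\<lambda>t. t + - s) ` {t \<in> ?P. x \<bullet> t = x \<bullet> s} \<subseteq> {t \<in> ?P. x \<bullet> t = 0}"
      using add[OF _ minus(1)[OF s]] minus(2)[OF s] by auto
  qed
  then show "card {t \<in> ?P. x \<bullet> t = x \<bullet> s} = card (right_annihilator n (code_adjoin C x))"
    unfolding right_annihilator_adjoin[OF C x] by (simp add: bij_betw_same_card)
qed

text \<open>All that the code argument asks of the ring. The condition with \<open>s\<close> states
  maximality of \<open>A\<close>: modulo \<open>A\<close>, every \<open>r\<close> outside
  \<open>A\<close> can be multiplied to \<open>1\<close>.\<close>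

definition maximal_annihilator_bound :: "'a::{ring,monoid_mult} itself \<Rightarrow> bool" where
  "maximal_annihilator_bound _ \<longleftrightarrow> (\<forall>A :: 'a set.
     0 \<in> A \<and> (\<forall>a\<in>A. \<forall>b\<in>A. a + b \<in> A) \<and> (\<forall>r. \<forall>a\<in>A. r * a \<in> A) \<and>
     1 \<notin> A \<and> (\<forall>r. r \<notin> A \<longrightarrow> (\<exists>s. 1 - s * r \<in> A)) \<longrightarrow>
     card A * card {x. \<forall>a\<in>A. a * x = 0} \<le> card (UNIV :: 'a set))"

lemma code_step:
  fixes C D :: "'a::{ring,monoid_mult,finite} vec set"
  assumes H: "maximal_annihilator_bound TYPE('a)"
    and C: "left_code n C" and D: "left_code n D" and CD: "C \<subset> D"
  shows "\<exists>G. left_code n G \<and> C \<subset> G \<and> G \<subseteq> D \<and>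
    card C * card (right_annihilator n C) \<le> card G * card (right_annihilator n G)"
proof -
  have Dc: "x \<in> carrier_vec n" if "x \<in> D" for x using that D by (auto simp: left_code_iff)
  have C': "0\<^sub>v n \<in> C" "\<And>c d. c \<in> C \<Longrightarrow> d \<in> C \<Longrightarrow> c + d \<in> C" "\<And>c r. c \<in> C \<Longrightarrow> r \<cdot>\<^sub>v c \<in> C"
    using C by (auto simp: left_code_iff)
  obtain x0 where "x0 \<in> D - C" using CD by blast
  \<comment> \<open>Least size makes the extension minimal: for \<open>r\<close> with
    \<open>r x \<notin> C\<close> the code \<open>C + R r x\<close> cannot be smaller, hence
    contains \<open>x\<close>, and this yields the \<open>s\<close> required for maximality.\<close>
  from ex_has_least_nat[of "\<lambda>x. x \<in> D - C", OF this, of "\<lambda>x. card (code_adjoin C x)"]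
  obtain x where x: "x \<in> D - C"
    and min: "\<And>y. y \<in> D - C \<Longrightarrow> card (code_adjoin C x) \<le> card (code_adjoin C y)"
    by blast
  have xc: "x \<in> carrier_vec n" using x Dc by blast
  let ?G = "code_adjoin C x" and ?A = "{r. r \<cdot>\<^sub>v x \<in> C}" and ?U = "card (UNIV :: 'a set)"
  note G = code_adjoin[OF C xc]
  have "card ?A * card {y. \<forall>a\<in>?A. a * y = 0} \<le> ?U"
  proof (intro H[unfolded maximal_annihilator_bound_def, rule_format] conjI ballI allI impI)
    show "0 \<in> ?A" using C'(1) zero_smult[OF xc] by simp
    show "a + b \<in> ?A" if "a \<in> ?A" "b \<in> ?A" for a b
      using that C'(2) by (simp add: add_smult_distrib_vec)
    show "r * a \<in> ?A" if "a \<in> ?A" for r a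
      using that C'(3)[of "a \<cdot>\<^sub>v x" r] by (simp add: smult_smult_assoc)
    show "1 \<notin> ?A" using x by (simp add: one_smult)
    fix r assume "r \<notin> ?A"
    then have r: "r \<cdot>\<^sub>v x \<in> D - C" using x D by (auto simp: left_code_iff)
    note R = code_adjoin[OF C Dc[OF DiffD1[OF r]]]
    have "r \<cdot>\<^sub>v x \<in> ?G" using G(1,3) by (auto simp: left_code_iff)
    then have sub: "code_adjoin C (r \<cdot>\<^sub>v x) \<subseteq> ?G" by (intro code_adjoin_subset[OF G(1,2)])
    have "finite ?G"
      using G(1) by (intro finite_subset[OF _ finite_carrier_vec[of n]]) (simp add: left_code_iff)
    then have "code_adjoin C (r \<cdot>\<^sub>v x) = ?G" using sub min[OF r] by (rule card_seteq)
    then obtain c s where c: "c \<in> C" "x = c + s \<cdot>\<^sub>v (r \<cdot>\<^sub>v x)"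
      using G(3) unfolding code_adjoin_def by blast
    have cd: "dim_vec c = n" using c(1) C by (auto simp: left_code_iff)
    have "(1 - s * r) \<cdot>\<^sub>v x = c"
    proof (rule eq_vecI)
      fix i assume "i < dim_vec c"
      then have "x $ i = c $ i + s * (r * x $ i)"
        using arg_cong[OF c(2), of "\<lambda>v. v $ i"] cd xc by simp
      then show "((1 - s * r) \<cdot>\<^sub>v x) $ i = c $ i"
        using \<open>i < dim_vec c\<close> cd xc by (simp add: left_diff_distrib mult.assoc diff_eq_eq)
    qed (use cd xc in auto)
    then show "\<exists>s. 1 - s * r \<in> ?A" using c(1) by auto
  qed
  moreover have "(\<bullet>) x ` right_annihilator n C \<subseteq> {y. \<forall>a\<in>?A. a * y = 0}"
  proof clarify
    fix s a assume s: "s \<in> right_annihilator n C" and a: "a \<cdot>\<^sub>v x \<in> C"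
    then have "(a \<cdot>\<^sub>v x) \<bullet> s = 0" by (simp add: right_annihilator_def)
    then show "a * (x \<bullet> s) = 0"
      using s xc smult_scalar_prod_distrib[of x n s a] by (simp add: right_annihilator_def)
  qed
  then have "card ((\<bullet>) x ` right_annihilator n C) \<le> card {y. \<forall>a\<in>?A. a * y = 0}"
    by (intro card_mono) auto
  ultimately have "card ?A * card ((\<bullet>) x ` right_annihilator n C) \<le> ?U"
    by (meson le_trans mult_le_mono2)
  then have "card ?G * card (right_annihilator n ?G) * (card ?A * card ((\<bullet>) x ` right_annihilator n C))
      \<le> card ?G * card (right_annihilator n ?G) * ?U"
    by (rule mult_le_mono2)
  \<comment> \<open>The two counts \<open>|G| |A| = |C| |R|\<close> and
    \<open>|C^\<bottom>| = |x C^\<bottom>| |G^\<bottom>|\<close> rearrange the product so that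
    \<open>|R|\<close> can be cancelled.\<close>
  moreover have "card ?G * card (right_annihilator n ?G) * (card ?A * card ((\<bullet>) x ` right_annihilator n C))
      = (card C * ?U) * card (right_annihilator n C)"
    unfolding code_adjoin_card[OF C xc] right_annihilator_card[OF C xc] by (simp only: ac_simps)
  ultimately have "(card C * card (right_annihilator n C)) * ?U \<le> (card ?G * card (right_annihilator n ?G)) * ?U"
    by (simp only: ac_simps)
  moreover have "?U > 0" by (simp add: card_gt_0_iff)
  ultimately have "card C * card (right_annihilator n C) \<le> card ?G * card (right_annihilator n ?G)"
    by (simp only: mult_le_cancel2)
  moreover have "C \<subset> ?G" "?G \<subseteq> D"
    using G(2,3) x code_adjoin_subset[OF D, of C x] CD by auto
  ultimately show ?thesis using G(1) by blast
qed

lemma code_mono: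
  fixes C D :: "'a::{ring,monoid_mult,finite} vec set"
  assumes H: "maximal_annihilator_bound TYPE('a)"
    and D: "left_code n D"
  shows "left_code n C \<Longrightarrow> C \<subseteq> D \<Longrightarrow>
    card C * card (right_annihilator n C) \<le> card D * card (right_annihilator n D)"
proof (induction "card D - card C" arbitrary: C rule: less_induct)
  case less
  show ?case
  proof (cases "C = D")
    case False
    then obtain G where G: "left_code n G" "C \<subset> G" "G \<subseteq> D"
      "card C * card (right_annihilator n C) \<le> card G * card (right_annihilator n G)"
      using code_step[OF H less.prems(1) D] less.prems(2) by blast
    have "finite D"
      using D by (intro finite_subset[OF _ finite_carrier_vec[of n]]) (simp add: left_code_iff)
    then have "card C < card G" "card G \<le> card D"
      using G(2,3) by (auto intro: psubset_card_mono card_mono finite_subset)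
    then have "card G * card (right_annihilator n G) \<le> card D * card (right_annihilator n D)"
      by (intro less.hyps G) simp
    then show ?thesis using G(4) by linarith
  qed simp
qed

lemma code_card_eq:
  fixes C :: "'a::{ring,monoid_mult,finite} vec set"
  assumes H: "maximal_annihilator_bound TYPE('a)"
    and C: "left_code n C"
  shows "card C * card (right_annihilator n C) = card (carrier_vec n :: 'a vec set)"
proof (rule antisym)
  have "left_code n (carrier_vec n :: 'a vec set)" by (simp add: left_code_iff)
  from code_mono[OF H this C] show "card C * card (right_annihilator n C) \<le> card (carrier_vec n :: 'a vec set)"
    using C by (simp add: right_annihilator_carrier left_code_iff)
  have "left_code n {0\<^sub>v n :: 'a vec}" by (auto simp: left_code_iff)
  from code_mono[OF H C this] have "card (right_annihilator n {0\<^sub>v n :: 'a vec}) \<le> card C * card (right_annihilator n C)"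
    using C by (simp add: left_code_iff)
  moreover have "right_annihilator n {0\<^sub>v n :: 'a vec} = carrier_vec n"
    by (auto simp: right_annihilator_def)
  ultimately show "card (carrier_vec n :: 'a vec set) \<le> card C * card (right_annihilator n C)" by simp
qed

section \<open>Annihilator identities for ideals from codes\<close>

lemma left_ideal_card:
  fixes I :: "'a::{ring,monoid_mult,finite} set"
  assumes code: "\<And>C :: 'a vec set. left_code 1 C \<Longrightarrow>
      card C * card (right_annihilator 1 C) = card (carrier_vec 1 :: 'a vec set)"
    and I: "0 \<in> I" "\<And>a b. a \<in> I \<Longrightarrow> b \<in> I \<Longrightarrow> a + b \<in> I" "\<And>r a. a \<in> I \<Longrightarrow> r * a \<in> I"
  shows "card I * card {x. \<forall>a\<in>I. a * x = 0} = card (UNIV :: 'a set)"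
proof -
  define v where "v a = vec 1 (\<lambda>_. a)" for a :: 'a
  have v0: "v a $ 0 = a" for a by (simp add: v_def)
  have inj: "inj v" by (rule injI) (metis v0)
  have onto: "s \<in> range v" if "s \<in> carrier_vec 1" for s :: "'a vec"
    using that by (intro image_eqI[of _ _ "s $ 0"] eq_vecI) (auto simp: v_def)
  have carr: "carrier_vec 1 = range v" using onto by (auto simp: v_def)
  have prod: "v a \<bullet> v b = a * b" for a b by (simp add: scalar_prod_def v_def)
  have "left_code 1 (v ` I)"
    unfolding left_code_iff
  proof (intro conjI ballI allI)
    show "v ` I \<subseteq> carrier_vec 1" unfolding carr by blast
    show "0\<^sub>v 1 \<in> v ` I" using I(1) by (intro image_eqI[of _ _ 0] eq_vecI) (auto simp: v_def)
    fix x y assume "x \<in> v ` I" "y \<in> v ` I"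
    then obtain a b where "x = v a" "a \<in> I" "y = v b" "b \<in> I" by blast
    then show "x + y \<in> v ` I" using I(2) by (intro image_eqI[of _ _ "a + b"] eq_vecI) (auto simp: v_def)
  next
    fix r x assume "x \<in> v ` I"
    then obtain a where "x = v a" "a \<in> I" by blast
    then show "r \<cdot>\<^sub>v x \<in> v ` I" using I(3) by (intro image_eqI[of _ _ "r * a"] eq_vecI) (auto simp: v_def)
  qed
  moreover have "right_annihilator 1 (v ` I) = v ` {x. \<forall>a\<in>I. a * x = 0}"
    unfolding right_annihilator_def carr using prod by auto
  ultimately show ?thesis
    using code[of "v ` I"] inj_on_subset[OF inj subset_UNIV] unfolding carr by (simp add: card_image)
qed

text \<open>The code generated by a single word whose entries run through \<open>K\<close> has \<open>|K|\<close> elements.\<close>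

lemma right_ideal_card:
  fixes K :: "'a::{ring,monoid_mult,finite} set"
  assumes code: "\<And>n C. n > 0 \<Longrightarrow> left_code n (C :: 'a vec set) \<Longrightarrow>
      card C * card (right_annihilator n C) = card (carrier_vec n :: 'a vec set)"
    and K: "0 \<in> K" "\<And>a b. a \<in> K \<Longrightarrow> b \<in> K \<Longrightarrow> a + b \<in> K" "\<And>r a. a \<in> K \<Longrightarrow> a * r \<in> K"
  shows "card K * card {x. \<forall>a\<in>K. x * a = 0} = card (UNIV :: 'a set)"
proof -
  obtain xs where xs: "set xs = K" using finite_list[OF finite, of K] by blast
  define n where "n = length xs"
  define x where "x = vec n (\<lambda>i. xs ! i)"
  have n: "n > 0" using xs K(1) by (auto simp: n_def)
  have xc: "x \<in> carrier_vec n" by (simp add: x_def)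
  have xK: "x $ i \<in> K" if "i < n" for i using that xs by (auto simp: x_def n_def)
  have Z: "left_code n {0\<^sub>v n :: 'a vec}" by (auto simp: left_code_iff)
  let ?C = "code_adjoin {0\<^sub>v n} x" and ?L = "{r. \<forall>a\<in>K. r * a = 0}" and ?V = "carrier_vec n :: 'a vec set"
  have "{r. r \<cdot>\<^sub>v x \<in> {0\<^sub>v n}} = ?L"
  proof (intro equalityI subsetI CollectI ballI)
    fix r a assume r: "r \<in> {r. r \<cdot>\<^sub>v x \<in> {0\<^sub>v n}}" and "a \<in> K"
    then obtain i where i: "i < n" "xs ! i = a" using xs by (auto simp: n_def in_set_conv_nth)
    have "(r \<cdot>\<^sub>v x) $ i = 0" using r i by simp
    then show "r * a = 0" using i by (simp add: x_def)
  next
    fix r assume "r \<in> ?L"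
    then show "r \<cdot>\<^sub>v x \<in> {0\<^sub>v n}" using xK xc by (auto intro!: eq_vecI)
  qed
  then have C: "card (UNIV :: 'a set) = card ?C * card ?L"
    using code_adjoin_card[OF Z xc] by simp
  have R0: "right_annihilator n {0\<^sub>v n} = ?V" by (auto simp: right_annihilator_def)
  have "(\<bullet>) x ` ?V = K"
  proof (intro equalityI subsetI)
    fix y assume "y \<in> (\<bullet>) x ` ?V"
    then obtain s where s: "s \<in> ?V" "y = x \<bullet> s" by blast
    have "(\<Sum>i\<in>J. x $ i * s $ i) \<in> K" if "J \<subseteq> {0..<n}" for J
      using finite_subset[OF that finite_atLeastLessThan] that
      by (induction J rule: finite_induct) (auto intro!: K xK)
    then show "y \<in> K" using s by (simp add: scalar_prod_def)
  next
    fix a assume "a \<in> K"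
    then obtain i where i: "i < n" "xs ! i = a" using xs by (auto simp: n_def in_set_conv_nth)
    then have "x \<bullet> single_vec n i 1 = a" using scalar_prod_single(1)[OF xc i(1), of 1] by (simp add: x_def)
    then show "a \<in> (\<bullet>) x ` ?V" by (intro image_eqI[of _ _ "single_vec n i 1"]) auto
  qed
  then have "card ?V = card K * card (right_annihilator n ?C)"
    using right_annihilator_card[OF Z xc] unfolding R0 by simp
  moreover have "card ?C * card (right_annihilator n ?C) = card ?V"
    by (rule code[OF n code_adjoin(1)[OF Z xc]])
  moreover have "card ?V > 0"
    using finite_carrier_vec[of n] xc by (auto simp: card_gt_0_iff)
  \<comment> \<open>The products of \<open>|K|\<close> and of \<open>|C|\<close> with
    \<open>|C^\<bottom>|\<close> both equal the size of the whole space, which is positive, so the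
    common factor cancels.\<close>
  ultimately have "card ?C = card K" by (metis mult_is_0 mult_cancel2 less_irrefl)
  then show ?thesis using C by simp
qed

section \<open>Frobenius rings\<close>

interpretation right: finite_ring "(*) :: 'a::{ring,monoid_mult,finite} \<Rightarrow> 'a \<Rightarrow> 'a" 1
  by unfold_locales (simp_all add: algebra_simps)

interpretation left: finite_ring "\<lambda>x y :: 'a::{ring,monoid_mult,finite}. y * x" 1
  by (rule right.opposite)

section \<open>Translation between the defined notions and their element forms\<close>

lemma regular_eq: "right.regular = right_regular" "left.regular = left_regular"
  by (simp_all add: right.regular_def left.regular_def right_regular_def left_regular_def)

lemma principal_eq: "right.principal = right_principal" "left.principal = left_principal"
  by (simp_all add: fun_eq_iff right.principal_def left.principal_def right_principal_def
      left_principal_def regular_eq)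

lemma prim_iff: "primitive_idempotent e \<longleftrightarrow> right.prim e"
  unfolding primitive_idempotent_def right.prim_def idempotent_elem_def orthogonal_elems_def by auto

lemma complete_iff: "complete_primitive_idempotents m e \<longleftrightarrow> right.complete m e"
  unfolding complete_primitive_idempotents_def right.complete_def prim_iff orthogonal_elems_def by auto

text \<open>Isomorphism of \<open>e\<^sub>i R\<close> and \<open>e\<^sub>j R\<close> turns into
  \<open>eqv\<close> for idempotents, which completeness provides; without completeness or
  \<open>k \<le> m\<close> both sides are false.\<close>

lemma ordered_iff: "ordered_idempotents m k e \<longleftrightarrow> right.ordered m k e"
proof (cases "right.complete m e \<and> k \<le> m")
  case True
  have iso: "mod_iso (right_principal (e i)) (right_principal (e j)) \<longleftrightarrow> right.eqv (e i) (e j)"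
    if "i \<in> {1..m}" "j \<in> {1..m}" for i j
    using right.principal_iso_iff[of "e i" "e j"] right.prim_idem[OF right.complete_prim[of m e]] True that
    unfolding principal_eq by blast
  have "(\<forall>i\<in>{1..k}. \<forall>j\<in>{1..k}. i \<noteq> j \<longrightarrow>
        \<not> mod_iso (right_principal (e i)) (right_principal (e j))) \<longleftrightarrow>
      (\<forall>i\<in>{1..k}. \<forall>j\<in>{1..k}. i \<noteq> j \<longrightarrow> \<not> right.eqv (e i) (e j))"
    using True by (intro ball_cong refl) (simp add: iso)
  moreover have "(\<forall>i\<in>{k<..m}. \<exists>j\<in>{1..k}. mod_iso (right_principal (e i)) (right_principal (e j))) \<longleftrightarrow>
      (\<forall>i\<in>{k<..m}. \<exists>j\<in>{1..k}. right.eqv (e i) (e j))"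
    using True by (intro ball_cong bex_cong refl) (simp add: iso)
  ultimately show ?thesis
    unfolding ordered_idempotents_def right.ordered_def complete_iff by (simp only:)
next
  case False
  then show ?thesis unfolding ordered_idempotents_def right.ordered_def complete_iff by blast
qed

lemma nakayama_iff:
  assumes o: "right.ordered m k e"
  shows "nakayama_permutation k e \<pi> \<longleftrightarrow> right.nakayama k e \<pi>"
proof (cases "\<pi> permutes {1..k}")
  case True
  note c = right.ordered_complete[OF o]
  have "mod_iso (soc_mod (right_principal (e i))) (top_mod (right_principal (e (\<pi> i)))) \<longleftrightarrow>
      (\<exists>z. right.socle_gen (e i) (e (\<pi> i)) z)"
    "mod_iso (soc_mod (left_principal (e (\<pi> i)))) (top_mod (left_principal (e i))) \<longleftrightarrow>
      (\<exists>w. right.left_socle_gen (e i) (e (\<pi> i)) w)" if i: "i \<in> {1..k}" for i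
  proof -
    have "\<pi> i \<in> {1..k}" using True i by (simp only: permutes_in_image)
    note p = right.ordered_prim[OF o i] right.ordered_prim[OF o this]
    show "mod_iso (soc_mod (right_principal (e i))) (top_mod (right_principal (e (\<pi> i)))) \<longleftrightarrow>
      (\<exists>z. right.socle_gen (e i) (e (\<pi> i)) z)"
      unfolding principal_eq[symmetric] right.socle_iso_top[OF c p] right.socle_gen_def ..
    have "left.prim (e i)" "left.prim (e (\<pi> i))" using p by (simp_all only: right.prim_opposite)
    \<comment> \<open>The condition on left modules takes the socle at \<open>\<pi> i\<close> and
      the top at \<open>i\<close>, so the idempotents enter in reversed order; reversing the
      multiplication restores the order in \<open>left_socle_gen\<close>.\<close>
    note q = left.socle_iso_top[OF right.complete_opposite[OF c] this(2,1)]
    show "mod_iso (soc_mod (left_principal (e (\<pi> i)))) (top_mod (left_principal (e i))) \<longleftrightarrow>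
      (\<exists>w. right.left_socle_gen (e i) (e (\<pi> i)) w)"
      unfolding principal_eq[symmetric] q right.socle_opposite right.left_socle_gen_def by auto
  qed
  then show ?thesis using True unfolding nakayama_permutation_def right.nakayama_def by blast
next
  case False
  then show ?thesis unfolding nakayama_permutation_def right.nakayama_def by blast
qed

lemma multiplicity_eq: "idem_multiplicity e = right.multiplicity e"
  unfolding idem_multiplicity_def right.multiplicity_def regular_eq principal_eq ..

lemma artinian_finite: "artinian_mod (M :: ('r, 'm::finite) mod_struct)"
  unfolding artinian_mod_def
proof (intro allI impI)
  fix N :: "nat \<Rightarrow> 'm set"
  assume N: "(\<forall>i. is_submod M (N i)) \<and> (\<forall>i. N (Suc i) \<subseteq> N i)"
  obtain n where n: "\<And>i. card (N n) \<le> card (N i)"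
    using ex_has_least_nat[of "\<lambda>_. True" 0 "\<lambda>i. card (N i)"] by auto
  have "N i = N n" if "i \<ge> n" for i
    using lift_Suc_antimono_le[of N n i] N that n[of i] by (intro card_seteq) auto
  then show "\<exists>n. \<forall>i\<ge>n. N i = N n" by blast
qed

theorem theorem15:
  shows "frobenius TYPE('a::{ring,monoid_mult,finite}) \<longleftrightarrow>
    (\<forall>n>0. \<forall>C :: 'a vec set. left_code n C \<longrightarrow>
       card C * card (right_annihilator n C) = card (carrier_vec n :: 'a vec set))"
proof
  assume "frobenius TYPE('a)"
  then obtain m k \<pi> and e :: "nat \<Rightarrow> 'a" where o: "ordered_idempotents m k e"
    and n: "nakayama_permutation k e \<pi>"
    and \<mu>: "\<And>i. i \<in> {1..k} \<Longrightarrow> idem_multiplicity (e i) = idem_multiplicity (e (\<pi> i))"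
    unfolding frobenius_def by blast
  have o': "right.ordered m k e" using o by (simp only: ordered_iff)
  have n': "right.nakayama k e \<pi>" using n by (simp only: nakayama_iff[OF o'])
  have "maximal_annihilator_bound TYPE('a)"
    unfolding maximal_annihilator_bound_def
    using right.maximal_left_ideal_card[OF o' right.frobenius_socle_card[OF o' n']] \<mu>
    by (simp add: multiplicity_eq right.left_ideal_def)
  then show "\<forall>n>0. \<forall>C :: 'a vec set. left_code n C \<longrightarrow>
       card C * card (right_annihilator n C) = card (carrier_vec n :: 'a vec set)"
    using code_card_eq by blast
next
  assume H: "\<forall>n>0. \<forall>C :: 'a vec set. left_code n C \<longrightarrow>
       card C * card (right_annihilator n C) = card (carrier_vec n :: 'a vec set)"
  have D: "right.annihilator_cards TYPE('a)"
    unfolding right.annihilator_cards_def right.left_ideal_def right.right_ideal_def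
    using H by (auto intro!: left_ideal_card right_ideal_card)
  obtain m k and e :: "nat \<Rightarrow> 'a" where o: "right.ordered m k e" using right.ordered_exists by blast
  obtain \<pi> where "right.nakayama k e \<pi>"
    "\<forall>i\<in>{1..k}. right.multiplicity (e i) = right.multiplicity (e (\<pi> i))"
    using right.annihilator_cards_nakayama[OF D o] by blast
  then have "ordered_idempotents m k e \<and> nakayama_permutation k e \<pi> \<and>
      (\<forall>i\<in>{1..k}. idem_multiplicity (e i) = idem_multiplicity (e (\<pi> i)))"
    using o by (simp add: ordered_iff nakayama_iff[OF o] multiplicity_eq)
  then show "frobenius TYPE('a)"
    unfolding frobenius_def quasi_frobenius_def using artinian_finite by blast
qed

end
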